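(* Let $(W,S)$ be a Coxeter system of type $A_n$, so $W=\mathfrak{S}_{n+1}$ and $B(W)=\mathcal{B}_{n+1}$, and let $c$ be a standard Coxeter element of $(W,S)$. Then any element of $\mathbf{D}_c\subset B_c^*(W)\subset B(W)$ (i.e. any simple element of the dual braid monoid) is a Mikado braid, and thus a rational permutation braid.
   Context: $S=\{s_1,\ldots,s_n\}$ with $s_i=(i,i+1)$. A standard Coxeter element is a product of the elements of $S$, each appearing once, in some order. $T=\bigcup_{w\in W}wSw^{-1}$, $\ell_T$ is the length function on $W$ with respect to $T$; $x\preccurlyeq_T y$ means $\ell_T(x)+\ell_T(x^{-1}y)=\ell_T(y)$, and $\mathrm{Div}(c)=\{x\in W\mid x\preccurlyeq_T c\}$. Artin–Tits group: $B(W)$ is generated by a copy $\mathbf{S}=\{\mathbf{s}\mid s\in S\}$ of $S$ with the braid relations; $B^+(W)$ is the submonoid generated by $\mathbf{S}$; $\mathbf{W}\subset B^+(W)$ is the set of lifts $\mathbf{w}$ of elements $w\in W$ obtained by lifting reduced expressions; $\Delta$ is the lift of the longest element. Write $u\preccurlyeq v$ if $u^{-1}v\in B^+(W)$. A rational permutation braid is $\beta\in B(W)$ with $\Delta^{-1}\preccurlyeq\beta\preccurlyeq\Delta$ (equivalently $\beta=\mathbf{x}^{-1}\mathbf{y}$ with $\mathbf{x},\mathbf{y}\in\mathbf{W}$). Dual braid monoid: $B_c^*(W)$ is the monoid generated by a copy $\mathbf{D}_c=\{\mathbf{x}\mid x\in\mathrm{Div}(c)\}$ of $\mathrm{Div}(c)$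 with relations $\mathbf{x}\mathbf{y}=\mathbf{z}$ whenever $x,y,z\in\mathrm{Div}(c)$, $xy=z$ and $\ell_T(z)=\ell_T(x)+\ell_T(y)$. By a theorem of Bessis, it embeds in its group of fractions, and sending each $\mathbf{s}\in\mathbf{S}$ to the element of $\mathbf{D}_c$ corresponding to $s$ extends to an isomorphism from $B(W)$ to this group of fractions; via it $\mathbf{D}_c\subset B_c^*(W)$ is viewed inside $B(W)$. Mikado braids: a braid diagram is reduced if it has the minimal number of crossings among diagrams of the braid. A strand of a reduced diagram is good if it is over all the other strands that it crosses. The trivial braid $e\in\mathcal{B}_1$ is a Mikado braid; a braid $\beta\in\mathcal{B}_{n+1}$ is a Mikado braid if in any reduced diagram for $\beta$ there exists at least one good strand and removing any such strand yields a Mikado braid in $\mathcal{B}_n$. *)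

theory Defs
  imports "HOL-Algebra.Sym_Groups"
begin

section \<open>Monoids given by generators and relations\<close>

inductive_set word_cong :: "'a set \<Rightarrow> ('a list \<times> 'a list) set \<Rightarrow> ('a list \<times> 'a list) set"
  for X :: "'a set" and R :: "('a list \<times> 'a list) set" where
  rel: "\<lbrakk>(u, v) \<in> R; u \<in> lists X; v \<in> lists X; a \<in> lists X; b \<in> lists X\<rbrakk>
    \<Longrightarrow> (a @ u @ b, a @ v @ b) \<in> word_cong X R"
| refl: "u \<in> lists X \<Longrightarrow> (u, u) \<in> word_cong X R"
| sym: "(u, v) \<in> word_cong X R \<Longrightarrow> (v, u) \<in> word_cong X R"
| trans: "\<lbrakk>(u, v) \<in> word_cong X R; (v, w) \<in> word_cong X R\<rbrakk> \<Longrightarrow> (u, w) \<in> word_cong X R"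

definition word_class :: "'a set \<Rightarrow> ('a list \<times> 'a list) set \<Rightarrow> 'a list \<Rightarrow> 'a list set" where
  "word_class X R w = word_cong X R `` {w}"

definition presented_monoid :: "'a set \<Rightarrow> ('a list \<times> 'a list) set \<Rightarrow> 'a list set monoid" where
  "presented_monoid X R =
    \<lparr> carrier = lists X // word_cong X R,
      mult = (\<lambda>A B. \<Union>u\<in>A. \<Union>v\<in>B. word_class X R (u @ v)),
      one = word_class X R [] \<rparr>"

lemma word_cong_lists:
  assumes "(u, v) \<in> word_cong X R"
  shows "u \<in> lists X" "v \<in> lists X"
  using assms by (induction rule: word_cong.induct) auto

lemma equiv_word_cong: "equiv (lists X) (word_cong X R)"
proof (rule equivI)
  show "word_cong X R \<subseteq> lists X \<times> lists X"
    by (intro subrelI SigmaI) (simp_all add: word_cong_lists del: in_lists_conv_set)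
  show "refl_on (lists X) (word_cong X R)"
    by (intro refl_onI word_cong.refl)
  show "Relation.sym (word_cong X R)"
    by (intro symI) (rule word_cong.sym)
  show "Relation.trans (word_cong X R)"
    by (intro transI) (rule word_cong.trans)
qed

lemma word_cong_append_left:
  "(u, v) \<in> word_cong X R \<Longrightarrow> a \<in> lists X \<Longrightarrow> (a @ u, a @ v) \<in> word_cong X R"
proof (induction rule: word_cong.induct)
  case (rel u v c d)
  then show ?case using word_cong.rel[of u v R X "a @ c" d] by simp
next
  case (refl u)
  then show ?case by (simp add: word_cong.refl)
next
  case (sym u v)
  then show ?case by (simp add: word_cong.sym)
next
  case (trans u v w)
  then show ?case by (meson word_cong.trans)
qed

lemma word_cong_append_right:
  "(u, v) \<in> word_cong X R \<Longrightarrow> a \<in> lists X \<Longrightarrow> (u @ a, v @ a) \<in> word_cong X R"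
proof (induction rule: word_cong.induct)
  case (rel u v c d)
  then show ?case using word_cong.rel[of u v R X c "d @ a"] by simp
next
  case (refl u)
  then show ?case by (simp add: word_cong.refl)
next
  case (sym u v)
  then show ?case by (simp add: word_cong.sym)
next
  case (trans u v w)
  then show ?case by (meson word_cong.trans)
qed

lemma word_cong_append:
  assumes "(u, u') \<in> word_cong X R" "(v, v') \<in> word_cong X R"
  shows "(u @ v, u' @ v') \<in> word_cong X R"
proof (rule word_cong.trans)
  show "(u @ v, u' @ v) \<in> word_cong X R"
    by (intro word_cong_append_right assms word_cong_lists(1)[OF assms(2)])
  show "(u' @ v, u' @ v') \<in> word_cong X R"
    by (intro word_cong_append_left assms word_cong_lists(2)[OF assms(1)])
qed

lemma word_class_eq_iff:
  "u \<in> lists X \<Longrightarrow> v \<in> lists X \<Longrightarrow>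
    word_class X R u = word_class X R v \<longleftrightarrow> (u, v) \<in> word_cong X R"
  unfolding word_class_def by (rule eq_equiv_class_iff[OF equiv_word_cong])

lemma carrier_presented_monoid:
  "carrier (presented_monoid X R) = word_class X R ` lists X"
  by (auto simp: presented_monoid_def word_class_def quotient_def)

lemma one_presented_monoid: "\<one>\<^bsub>presented_monoid X R\<^esub> = word_class X R []"
  by (simp add: presented_monoid_def)

lemma mult_presented_monoid:
  assumes "u \<in> lists X" "v \<in> lists X"
  shows "word_class X R u \<otimes>\<^bsub>presented_monoid X R\<^esub> word_class X R v = word_class X R (u @ v)"
proof -
  have eq: "word_class X R (u' @ v') = word_class X R (u @ v)"
    if "u' \<in> word_class X R u" "v' \<in> word_class X R v" for u' v'
  proof -
    have uv: "(u @ v, u' @ v') \<in> word_cong X R"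
      using that by (intro word_cong_append) (simp_all add: word_class_def)
    show ?thesis
      unfolding word_class_def using equiv_class_eq[OF equiv_word_cong uv] by (rule HOL.sym)
  qed
  have "u \<in> word_class X R u" "v \<in> word_class X R v"
    unfolding word_class_def using assms by (simp_all add: word_cong.refl del: in_lists_conv_set)
  moreover have "(\<Union>u'\<in>word_class X R u. \<Union>v'\<in>word_class X R v. word_class X R (u' @ v'))
      = (\<Union>u'\<in>word_class X R u. \<Union>v'\<in>word_class X R v. word_class X R (u @ v))"
    by (intro SUP_cong HOL.refl eq)
  ultimately show ?thesis
    unfolding presented_monoid_def by (simp, blast)
qed

lemma monoid_presented_monoid: "monoid (presented_monoid X R)"
proof -
  let ?M = "presented_monoid X R"
  have app: "u @ v \<in> lists X" if "u \<in> lists X" "v \<in> lists X" for u v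
    using that by simp
  show ?thesis
  proof (rule monoidI)
    fix x y z assume "x \<in> carrier ?M" "y \<in> carrier ?M" "z \<in> carrier ?M"
    then obtain u v w where u: "u \<in> lists X" "x = word_class X R u"
      and v: "v \<in> lists X" "y = word_class X R v" and w: "w \<in> lists X" "z = word_class X R w"
      by (auto simp: carrier_presented_monoid simp del: in_lists_conv_set)
    show "x \<otimes>\<^bsub>?M\<^esub> y \<in> carrier ?M"
      using u v app[OF u(1) v(1)] by (simp add: carrier_presented_monoid mult_presented_monoid)
    show "x \<otimes>\<^bsub>?M\<^esub> y \<otimes>\<^bsub>?M\<^esub> z = x \<otimes>\<^bsub>?M\<^esub> (y \<otimes>\<^bsub>?M\<^esub> z)"
      unfolding u(2) v(2) w(2) using u(1) v(1) w(1) app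
      by (simp only: mult_presented_monoid append_assoc)
  next
    show "\<one>\<^bsub>?M\<^esub> \<in> carrier ?M"
      by (simp add: carrier_presented_monoid one_presented_monoid)
  next
    fix x assume "x \<in> carrier ?M"
    then obtain u where u: "u \<in> lists X" "x = word_class X R u"
      by (auto simp: carrier_presented_monoid simp del: in_lists_conv_set)
    show "\<one>\<^bsub>?M\<^esub> \<otimes>\<^bsub>?M\<^esub> x = x" "x \<otimes>\<^bsub>?M\<^esub> \<one>\<^bsub>?M\<^esub> = x"
      unfolding u(2) one_presented_monoid using u(1)
      by (simp_all only: mult_presented_monoid lists.Nil append_Nil append_Nil2)
  qed
qed


section \<open>The Coxeter system of type A\<close>

text \<open>The group \<open>W\<close> of type \<open>A\<^sub>n\<close> is \<open>sym_group (n + 1)\<close>; its product \<open>x y\<close> is \<open>x \<circ> y\<close>.\<close>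

definition simple_refl :: "nat \<Rightarrow> nat \<Rightarrow> nat" where
  "simple_refl i = transpose i (i + 1)"

definition simple_refls :: "nat \<Rightarrow> (nat \<Rightarrow> nat) set" where
  "simple_refls n = simple_refl ` {1..n}"

definition reflections :: "nat \<Rightarrow> (nat \<Rightarrow> nat) set" where
  "reflections n = (\<Union>w \<in> carrier (sym_group (n + 1)).
     (\<lambda>s. w \<otimes>\<^bsub>sym_group (n + 1)\<^esub> s \<otimes>\<^bsub>sym_group (n + 1)\<^esub> inv\<^bsub>sym_group (n + 1)\<^esub> w) ` simple_refls n)"

definition list_mult :: "('a, 'b) monoid_scheme \<Rightarrow> 'a list \<Rightarrow> 'a" where
  "list_mult G xs = foldr (mult G) xs (one G)"

definition word_length :: "('a, 'b) monoid_scheme \<Rightarrow> 'a set \<Rightarrow> 'a \<Rightarrow> nat" where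
  "word_length G X w = (LEAST k. \<exists>xs. set xs \<subseteq> X \<and> length xs = k \<and> list_mult G xs = w)"

definition len_S :: "nat \<Rightarrow> (nat \<Rightarrow> nat) \<Rightarrow> nat" where
  "len_S n = word_length (sym_group (n + 1)) (simple_refls n)"

definition len_T :: "nat \<Rightarrow> (nat \<Rightarrow> nat) \<Rightarrow> nat" where
  "len_T n = word_length (sym_group (n + 1)) (reflections n)"

definition abs_le :: "nat \<Rightarrow> (nat \<Rightarrow> nat) \<Rightarrow> (nat \<Rightarrow> nat) \<Rightarrow> bool" where
  "abs_le n x y \<longleftrightarrow>
    len_T n x + len_T n (inv\<^bsub>sym_group (n + 1)\<^esub> x \<otimes>\<^bsub>sym_group (n + 1)\<^esub> y) = len_T n y"

definition Div :: "nat \<Rightarrow> (nat \<Rightarrow> nat) \<Rightarrow> (nat \<Rightarrow> nat) set" where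
  "Div n c = {x \<in> carrier (sym_group (n + 1)). abs_le n x c}"

definition standard_coxeter_element :: "nat \<Rightarrow> (nat \<Rightarrow> nat) \<Rightarrow> bool" where
  "standard_coxeter_element n c \<longleftrightarrow>
    (\<exists>xs. distinct xs \<and> set xs = simple_refls n \<and> c = list_mult (sym_group (n + 1)) xs)"


section \<open>The braid group\<close>

text \<open>A letter \<open>(i, True)\<close> stands for the generator \<open>\<sigma>\<^sub>i\<close> (the copy of \<open>s\<^sub>i\<close>), and
  \<open>(i, False)\<close> for its inverse. The argument \<open>m\<close> is the number of strands, so the
  Artin-Tits group of type \<open>A\<^sub>n\<close> is \<open>braid_group (n + 1)\<close>.\<close>

definition braid_letters :: "nat \<Rightarrow> (nat \<times> bool) set" where
  "braid_letters m = {1..<m} \<times> UNIV"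

definition braid_rels :: "((nat \<times> bool) list \<times> (nat \<times> bool) list) set" where
  "braid_rels =
     {([(i, b), (i, \<not> b)], []) | i b. True}
   \<union> {([(i, True), (j, True)], [(j, True), (i, True)]) | i j. i + 1 < j}
   \<union> {([(i, True), (i + 1, True), (i, True)], [(i + 1, True), (i, True), (i + 1, True)]) | i. True}"

definition braid_class :: "nat \<Rightarrow> (nat \<times> bool) list \<Rightarrow> (nat \<times> bool) list set" where
  "braid_class m = word_class (braid_letters m) braid_rels"

definition braid_group :: "nat \<Rightarrow> (nat \<times> bool) list set monoid" where
  "braid_group m = presented_monoid (braid_letters m) braid_rels"

lemma group_braid_group: "group (braid_group m)"
proof -
  interpret monoid "braid_group m"
    unfolding braid_group_def by (rule monoid_presented_monoid)
  let ?inv = "\<lambda>w::(nat \<times> bool) list. rev (map (\<lambda>(i, b). (i, \<not> b)) w)"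
  have inv_lists: "?inv w \<in> lists (braid_letters m)" if "w \<in> lists (braid_letters m)" for w
    using that by (fastforce simp: braid_letters_def)
  have canc: "(?inv w @ w, []) \<in> word_cong (braid_letters m) braid_rels"
    if "w \<in> lists (braid_letters m)" for w
    using that
  proof (induction w rule: list.induct)
    case Nil
    then show ?case by (auto intro: word_cong.refl)
  next
    case (Cons x w)
    obtain i b where x: "x = (i, b)" by (cases x)
    have w: "w \<in> lists (braid_letters m)" and i: "i \<in> {1..<m}"
      using Cons.prems x by (auto simp: braid_letters_def)
    have "([(i, \<not> b), (i, b)], []) \<in> braid_rels"
      unfolding braid_rels_def by force
    then have "(?inv w @ [(i, \<not> b), (i, b)] @ w, ?inv w @ [] @ w)
        \<in> word_cong (braid_letters m) braid_rels"
      using w i inv_lists by (intro word_cong.rel) (auto simp: braid_letters_def)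
    then show ?case
      using Cons.IH[OF w] x word_cong.trans by fastforce
  qed
  show ?thesis
  proof (rule groupI)
    fix x assume "x \<in> carrier (braid_group m)"
    then obtain w where w: "w \<in> lists (braid_letters m)" "x = braid_class m w"
      by (auto simp: braid_group_def braid_class_def carrier_presented_monoid)
    have "braid_class m (?inv w) \<otimes>\<^bsub>braid_group m\<^esub> x = \<one>\<^bsub>braid_group m\<^esub>"
      using w canc[OF w(1)] inv_lists[OF w(1)]
      by (simp add: braid_group_def braid_class_def mult_presented_monoid one_presented_monoid
          word_class_eq_iff del: in_lists_conv_set)
    moreover have "braid_class m (?inv w) \<in> carrier (braid_group m)"
      using inv_lists[OF w(1)]
      by (simp add: braid_group_def braid_class_def carrier_presented_monoid del: in_lists_conv_set)
    ultimately show "\<exists>y\<in>carrier (braid_group m). y \<otimes>\<^bsub>braid_group m\<^esub> x = \<one>\<^bsub>braid_group m\<^esub>"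
      by blast
  qed (auto simp: m_assoc)
qed


section \<open>Rational permutation braids\<close>

definition pos_word :: "nat list \<Rightarrow> (nat \<times> bool) list" where
  "pos_word is = map (\<lambda>i. (i, True)) is"

definition positive_braids :: "nat \<Rightarrow> (nat \<times> bool) list set set" where
  "positive_braids n = (\<lambda>is. braid_class (n + 1) (pos_word is)) ` lists {1..n}"

definition braid_le :: "nat \<Rightarrow> (nat \<times> bool) list set \<Rightarrow> (nat \<times> bool) list set \<Rightarrow> bool" where
  "braid_le n u v \<longleftrightarrow>
    inv\<^bsub>braid_group (n + 1)\<^esub> u \<otimes>\<^bsub>braid_group (n + 1)\<^esub> v \<in> positive_braids n"

definition reduced_expression :: "nat \<Rightarrow> (nat \<Rightarrow> nat) \<Rightarrow> nat list \<Rightarrow> bool" where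
  "reduced_expression n w is \<longleftrightarrow>
    set is \<subseteq> {1..n} \<and> list_mult (sym_group (n + 1)) (map simple_refl is) = w
    \<and> length is = len_S n w"

text \<open>The lift does not depend on the reduced expression chosen (Matsumoto).\<close>

definition lift :: "nat \<Rightarrow> (nat \<Rightarrow> nat) \<Rightarrow> (nat \<times> bool) list set" where
  "lift n w = braid_class (n + 1) (pos_word (SOME is. reduced_expression n w is))"

definition longest_element :: "nat \<Rightarrow> (nat \<Rightarrow> nat)" where
  "longest_element n = (ARG_MAX (len_S n) w. w \<in> carrier (sym_group (n + 1)))"

definition Delta :: "nat \<Rightarrow> (nat \<times> bool) list set" where
  "Delta n = lift n (longest_element n)"

definition rational_permutation_braid :: "nat \<Rightarrow> (nat \<times> bool) list set \<Rightarrow> bool" where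
  "rational_permutation_braid n \<beta> \<longleftrightarrow>
    \<beta> \<in> carrier (braid_group (n + 1))
    \<and> braid_le n (inv\<^bsub>braid_group (n + 1)\<^esub> (Delta n)) \<beta> \<and> braid_le n \<beta> (Delta n)"


section \<open>The dual braid monoid\<close>

text \<open>The relation \<open>([id], [])\<close> identifies the generator attached to the identity of \<open>W\<close> with the
  unit of the monoid. The relations \<open>x y = z\<close> alone only make that generator idempotent, and then the
  monoid would not be cancellative.\<close>

definition dual_rels :: "nat \<Rightarrow> (nat \<Rightarrow> nat) \<Rightarrow> ((nat \<Rightarrow> nat) list \<times> (nat \<Rightarrow> nat) list) set" where
  "dual_rels n c =
     {([x, y], [z]) | x y z. x \<in> Div n c \<and> y \<in> Div n c \<and> z \<in> Div n c
        \<and> x \<otimes>\<^bsub>sym_group (n + 1)\<^esub> y = z \<and> len_T n z = len_T n x + len_T n y}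
   \<union> {([\<one>\<^bsub>sym_group (n + 1)\<^esub>], [])}"

definition dual_monoid :: "nat \<Rightarrow> (nat \<Rightarrow> nat) \<Rightarrow> (nat \<Rightarrow> nat) list set monoid" where
  "dual_monoid n c = presented_monoid (Div n c) (dual_rels n c)"

definition dual_simple :: "nat \<Rightarrow> (nat \<Rightarrow> nat) \<Rightarrow> (nat \<Rightarrow> nat) \<Rightarrow> (nat \<Rightarrow> nat) list set" where
  "dual_simple n c x = word_class (Div n c) (dual_rels n c) [x]"

definition dual_simples :: "nat \<Rightarrow> (nat \<Rightarrow> nat) \<Rightarrow> (nat \<Rightarrow> nat) list set set" where
  "dual_simples n c = dual_simple n c ` Div n c"

text \<open>The embedding of the dual braid monoid into the braid group given by Bessis' theorem: it
  exhibits the braid group as the group of fractions of the dual braid monoid, with the copy of each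
  \<open>s\<^sub>i\<close> in the one corresponding to \<open>\<sigma>\<^sub>i\<close> in the other. By that theorem such a \<open>\<phi>\<close> exists; it is unique
  on the carrier, because the \<open>\<sigma>\<^sub>i\<close> generate the group of fractions.\<close>

definition bessis_embedding ::
  "nat \<Rightarrow> (nat \<Rightarrow> nat) \<Rightarrow> ((nat \<Rightarrow> nat) list set \<Rightarrow> (nat \<times> bool) list set) \<Rightarrow> bool" where
  "bessis_embedding n c \<phi> \<longleftrightarrow>
    \<phi> \<in> mon (dual_monoid n c) (braid_group (n + 1))
    \<and> (\<forall>\<beta> \<in> carrier (braid_group (n + 1)).
         \<exists>a \<in> carrier (dual_monoid n c). \<exists>b \<in> carrier (dual_monoid n c).
           \<beta> = inv\<^bsub>braid_group (n + 1)\<^esub> (\<phi> a) \<otimes>\<^bsub>braid_group (n + 1)\<^esub> \<phi> b)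
    \<and> (\<forall>i \<in> {1..n}. \<phi> (dual_simple n c (simple_refl i)) = braid_class (n + 1) [(i, True)])"


section \<open>Mikado braids\<close>

text \<open>A braid diagram is a word in the letters, read from top to bottom, and a strand is named by its
  position at the top. The letter \<open>(i, b)\<close> is a crossing of the strands in positions \<open>i\<close> and \<open>i + 1\<close>;
  the strand going from position \<open>i\<close> to \<open>i + 1\<close> is the upper one if \<open>b\<close>, the lower one otherwise.\<close>

definition reduced_diagram :: "(nat \<times> bool) list set \<Rightarrow> (nat \<times> bool) list \<Rightarrow> bool" where
  "reduced_diagram \<beta> w \<longleftrightarrow> w \<in> \<beta> \<and> (\<forall>v \<in> \<beta>. length w \<le> length v)"

fun good_strand :: "nat \<Rightarrow> (nat \<times> bool) list \<Rightarrow> bool" where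
  "good_strand k [] = True"
| "good_strand k ((i, b) # w) =
    (if k = i then b \<and> good_strand (i + 1) w
     else if k = i + 1 then \<not> b \<and> good_strand i w
     else good_strand k w)"

text \<open>Removing a strand deletes the crossings it takes part in; the strands to the right of it are
  shifted by one position to the left.\<close>

fun remove_strand :: "nat \<Rightarrow> (nat \<times> bool) list \<Rightarrow> (nat \<times> bool) list" where
  "remove_strand k [] = []"
| "remove_strand k ((i, b) # w) =
    (if k = i then remove_strand (i + 1) w
     else if k = i + 1 then remove_strand i w
     else if k < i then (i - 1, b) # remove_strand k w
     else (i, b) # remove_strand k w)"

fun mikado :: "nat \<Rightarrow> (nat \<times> bool) list set \<Rightarrow> bool" where
  "mikado 0 \<beta> = False"
| "mikado (Suc 0) \<beta> = (\<beta> = \<one>\<^bsub>braid_group 1\<^esub>)"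
| "mikado (Suc (Suc m)) \<beta> =
    (\<beta> \<in> carrier (braid_group (Suc (Suc m)))
     \<and> (\<forall>w. reduced_diagram \<beta> w \<longrightarrow>
          (\<exists>k \<in> {1..Suc (Suc m)}. good_strand k w)
          \<and> (\<forall>k \<in> {1..Suc (Suc m)}. good_strand k w \<longrightarrow>
               mikado (Suc m) (braid_class (Suc m) (remove_strand k w)))))"

end

theory Submission
  imports Defs
begin

text \<open>Call a braid layered if it has a diagram whose strands run at pairwise different constant
  heights. By exchange arguments such a diagram can be pulled tight, so that no two strands cross
  twice. Linking numbers then force every reduced diagram to be layered with the same heights; its
  highest strand is good, and removing a strand leaves a layered diagram. Rearranging the strands
  by decreasing height in the middle writes the braid as \<open>a\<inverse> b\<close> with permutation braids \<open>a\<close> and \<open>b\<close>.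

  It remains to see that simple dual braids are layered. The Coxeter element \<open>c\<close> is a cycle running
  once around a circle seen from its upper side, and the strands of \<open>x \<preceq> c\<close> follow the sides of
  the noncrossing polygons of \<open>x\<close>, which can be ordered by height. No planar geometry is needed: a
  factorization \<open>c = x y\<close> into as few transpositions as possible is a tree, a leaf \<open>p\<close> of it is fixed
  by \<open>x\<close> or by \<open>y\<close>, and \<open>p\<close> can be removed from the circle.\<close>

section \<open>Layered braid words\<close>

text \<open>The Mikado condition speaks about every reduced diagram, and no length-preserving moves
  between two such diagrams are at hand. Linking numbers avoid this: they depend on the braid only,
  their absolute values bound the crossings of each pair of strands from below, and a layered word
  without double crossings attains all bounds at once. A word that is not longer must attain them
  too, which determines its signs. Constant heights survive the exchange arguments because three
  strands at distinct heights never lie cyclically over each other; this excludes just the two sign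
  patterns for which the braid relation fails. For dual simples the difficulty is that one height
  function has to serve all chords of \<open>x\<close>, while the induction adds the chords one by
  one. Hence heights \<open>g\<close> on the current points matter only through their order,
  layeredness is asserted for every \<open>h\<close> that extends \<open>g\<close>, and the
  invariant \<open>upper_over_lower\<close> records just enough about \<open>g\<close> to insert a
  chord between neighbours on the circle.\<close>

definition braid_eq :: "nat \<Rightarrow> (nat \<times> bool) list \<Rightarrow> (nat \<times> bool) list \<Rightarrow> bool" where
  "braid_eq m u v \<longleftrightarrow> (u, v) \<in> word_cong (braid_letters m) braid_rels"

definition braid_words :: "nat \<Rightarrow> (nat \<times> bool) list set" where
  "braid_words m = lists (braid_letters m)"

abbreviation inv_word :: "(nat \<times> bool) list \<Rightarrow> (nat \<times> bool) list" where
  "inv_word w \<equiv> rev (map (\<lambda>(i, b). (i, \<not> b)) w)"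

text \<open>Leads from a position at the bottom to the position where its strand starts, so that
  \<open>h \<circ> word_perm w\<close> lists the heights at the bottom. Its inverse
  \<open>end_pos\<close> follows the strands downwards.\<close>

fun word_perm :: "(nat \<times> bool) list \<Rightarrow> nat \<Rightarrow> nat" where
  "word_perm [] = id"
| "word_perm ((i, b) # w) = transpose i (Suc i) \<circ> word_perm w"

fun end_pos :: "(nat \<times> bool) list \<Rightarrow> nat \<Rightarrow> nat" where
  "end_pos [] p = p"
| "end_pos ((i, b) # w) p = end_pos w (transpose i (Suc i) p)"

text \<open>\<open>h p\<close> is the height of the strand in position \<open>p\<close> at the top; a word is layered if each strand
  stays at its height.\<close>

fun layered :: "(nat \<Rightarrow> int) \<Rightarrow> (nat \<times> bool) list \<Rightarrow> bool" where
  "layered h [] = True"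
| "layered h ((i, b) # w) = ((b \<longleftrightarrow> h (Suc i) < h i) \<and> layered (h \<circ> transpose i (Suc i)) w)"

text \<open>The inductive form of a reduced word, for any signs: each letter adds an inversion to
  what follows it. Single crossings are a consequence (\<open>crosses_once_tight\<close>), but the
  exchange argument needs this form.\<close>

fun tight :: "(nat \<times> bool) list \<Rightarrow> bool" where
  "tight [] = True"
| "tight ((i, b) # w) = (end_pos w i < end_pos w (Suc i) \<and> tight w)"

section \<open>Equality of braid words, and the relations with inverse letters\<close>

lemma braid_letters_iff [simp]: "(i, b) \<in> braid_letters m \<longleftrightarrow> 1 \<le> i \<and> i < m"
  by (auto simp: braid_letters_def)

lemma braid_words_simps [simp]:
  "[] \<in> braid_words m"
  "(i, b) # w \<in> braid_words m \<longleftrightarrow> 1 \<le> i \<and> i < m \<and> w \<in> braid_words m"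
  "u @ v \<in> braid_words m \<longleftrightarrow> u \<in> braid_words m \<and> v \<in> braid_words m"
  by (auto simp: braid_words_def)

lemma inv_word_in [simp]: "w \<in> braid_words m \<Longrightarrow> inv_word w \<in> braid_words m"
  by (induction w) auto

lemma inv_word_inv_word: "inv_word (inv_word w) = w"
  by (induction w) auto

lemma braid_eq_refl: "u \<in> braid_words m \<Longrightarrow> braid_eq m u u"
  unfolding braid_eq_def braid_words_def by (rule word_cong.refl)

lemma braid_eq_sym: "braid_eq m u v \<Longrightarrow> braid_eq m v u"
  unfolding braid_eq_def by (rule word_cong.sym)

lemma braid_eq_trans [trans]: "braid_eq m u v \<Longrightarrow> braid_eq m v w \<Longrightarrow> braid_eq m u w"
  unfolding braid_eq_def by (rule word_cong.trans)

lemma braid_eq_append: "braid_eq m u u' \<Longrightarrow> braid_eq m v v' \<Longrightarrow> braid_eq m (u @ v) (u' @ v')"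
  unfolding braid_eq_def by (rule word_cong_append)

lemma braid_eq_words: "braid_eq m u v \<Longrightarrow> u \<in> braid_words m \<and> v \<in> braid_words m"
  unfolding braid_eq_def braid_words_def using word_cong_lists by blast

lemma braid_eq_rel:
  "(u, v) \<in> braid_rels \<Longrightarrow> u \<in> braid_words m \<Longrightarrow> v \<in> braid_words m \<Longrightarrow> braid_eq m u v"
  using word_cong.rel[of u v braid_rels "braid_letters m" "[]" "[]"] by (simp add: braid_eq_def braid_words_def)

lemma braid_eq_Cons: "braid_eq m u v \<Longrightarrow> 1 \<le> i \<Longrightarrow> i < m \<Longrightarrow> braid_eq m ((i, b) # u) ((i, b) # v)"
  using braid_eq_append[of m "[(i, b)]" "[(i, b)]" u v] by (simp add: braid_eq_refl)

lemma braid_eq_cancel: "1 \<le> i \<Longrightarrow> i < m \<Longrightarrow> braid_eq m [(i, b), (i, \<not> b)] []"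
  by (intro braid_eq_rel) (auto simp: braid_rels_def)

lemma braid_eq_cancel_word: "w \<in> braid_words m \<Longrightarrow> braid_eq m (w @ inv_word w) []"
proof (induction w)
  case Nil
  then show ?case by (simp add: braid_eq_refl)
next
  case (Cons a w)
  obtain i b where a: "a = (i, b)" by (cases a)
  have i: "1 \<le> i" "i < m" and w: "w \<in> braid_words m" using Cons.prems a by auto
  have "braid_eq m ([(i, b)] @ (w @ inv_word w) @ [(i, \<not> b)]) ([(i, b)] @ [] @ [(i, \<not> b)])"
    using i Cons.IH[OF w] by (intro braid_eq_append braid_eq_refl) auto
  also have "braid_eq m ([(i, b)] @ [] @ [(i, \<not> b)]) []" using braid_eq_cancel i by simp
  finally show ?case by (simp add: a)
qed

lemma braid_eq_cancel_word': "w \<in> braid_words m \<Longrightarrow> braid_eq m (inv_word w @ w) []"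
  using braid_eq_cancel_word[of "inv_word w" m] by (simp add: inv_word_inv_word)

lemma braid_eq_inv_word:
  assumes "braid_eq m u v" shows "braid_eq m (inv_word u) (inv_word v)"
proof -
  note uv = braid_eq_words[OF assms]
  have "braid_eq m (inv_word u @ []) (inv_word u @ (v @ inv_word v))"
    using uv by (intro braid_eq_append braid_eq_refl braid_eq_sym[OF braid_eq_cancel_word]) auto
  also have "braid_eq m \<dots> (inv_word u @ (u @ inv_word v))"
    using uv assms by (intro braid_eq_append braid_eq_refl) (auto intro: braid_eq_sym)
  also have "inv_word u @ (u @ inv_word v) = (inv_word u @ u) @ inv_word v"
    by simp
  also have "braid_eq m \<dots> ([] @ inv_word v)"
    using uv by (intro braid_eq_append braid_eq_refl braid_eq_cancel_word') auto
  finally show ?thesis by simp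
qed

text \<open>Carries \<open>u\<close> and \<open>w\<close> to the other sides of an equation. Applied
  to the defining relations, which are positive, it yields relations with inverse letters.\<close>

lemma braid_eq_move:
  assumes "braid_eq m (u @ v) (v' @ w)" "u \<in> braid_words m" "v \<in> braid_words m"
    "v' \<in> braid_words m" "w \<in> braid_words m"
  shows "braid_eq m (v @ inv_word w) (inv_word u @ v')"
proof -
  have "braid_eq m ([] @ (v @ inv_word w)) ((inv_word u @ u) @ (v @ inv_word w))"
    using assms by (intro braid_eq_append braid_eq_refl braid_eq_sym[OF braid_eq_cancel_word']) auto
  also have "(inv_word u @ u) @ (v @ inv_word w) = inv_word u @ (u @ v) @ inv_word w"
    by simp
  also have "braid_eq m \<dots> (inv_word u @ (v' @ w) @ inv_word w)"
    using assms by (intro braid_eq_append[OF braid_eq_refl braid_eq_append[OF assms(1) braid_eq_refl]]) auto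
  also have "inv_word u @ (v' @ w) @ inv_word w = (inv_word u @ v') @ (w @ inv_word w)"
    by simp
  also have "braid_eq m \<dots> ((inv_word u @ v') @ [])"
    using assms by (intro braid_eq_append braid_eq_refl braid_eq_cancel_word) auto
  finally show ?thesis by simp
qed

lemma braid_eq_commute:
  assumes "1 \<le> i" "i < m" "1 \<le> j" "j < m" "Suc i < j \<or> Suc j < i"
  shows "braid_eq m [(i, a), (j, b)] [(j, b), (i, a)]"
proof -
  have base: "braid_eq m [(i, True), (j, b)] [(j, b), (i, True)]"
    if ij: "1 \<le> i" "i < m" "1 \<le> j" "j < m" "Suc i < j \<or> Suc j < i" for i j b
  proof -
    have tt: "braid_eq m [(i, True), (j, True)] [(j, True), (i, True)]"
    proof (cases "Suc i < j")
      case True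
      then show ?thesis using ij by (intro braid_eq_rel) (auto simp: braid_rels_def)
    next
      case False
      then have "braid_eq m [(j, True), (i, True)] [(i, True), (j, True)]"
        using ij by (intro braid_eq_rel) (auto simp: braid_rels_def)
      then show ?thesis by (rule braid_eq_sym)
    qed
    have "braid_eq m [(i, True), (j, False)] [(j, False), (i, True)]"
      using braid_eq_move[of m "[(j, True)]" "[(i, True)]" "[(i, True)]" "[(j, True)]"]
        braid_eq_sym[OF tt] ij by simp
    then show ?thesis using tt by (cases b) auto
  qed
  show ?thesis
  proof (cases a)
    case True then show ?thesis using base assms by simp
  next
    case False
    have "braid_eq m ([(j, b)] @ inv_word [(i, True)]) (inv_word [(i, True)] @ [(j, b)])"
      using base[of i j b] assms by (intro braid_eq_move) auto
    then show ?thesis using False by (auto intro: braid_eq_sym)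
  qed
qed

text \<open>The signs compare the heights of the strands 1 and 2, 1 and 3, 2 and 3. The condition on
  them excludes the two patterns in which the three strands lie cyclically over each other; the
  other six follow from the positive relation.\<close>

lemma braid_eq_braid:
  assumes i: "1 \<le> i" "Suc i < m" and sgn: "a \<noteq> c \<or> b = a"
  shows "braid_eq m [(i, a), (Suc i, b), (i, c)] [(Suc i, c), (i, b), (Suc i, a)]"
proof -
  let ?L = "\<lambda>a b c. [(i, a), (Suc i, b), (i, c)]" and ?R = "\<lambda>a b c. [(Suc i, c), (i, b), (Suc i, a)]"
  have ppp: "braid_eq m (?L True True True) (?R True True True)"
    using i by (intro braid_eq_rel) (auto simp: braid_rels_def)
  have mpp: "braid_eq m (?L False True True) (?R False True True)"
    using braid_eq_move[of m "[(i, True)]" "[(Suc i, True), (i, True)]"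
        "[(Suc i, True), (i, True)]" "[(Suc i, True)]"] ppp i
    by (auto intro: braid_eq_sym)
  have ppm: "braid_eq m (?L True True False) (?R True True False)"
    using braid_eq_move[of m "[(Suc i, True)]" "[(i, True), (Suc i, True)]"
        "[(i, True), (Suc i, True)]" "[(i, True)]"] braid_eq_sym[OF ppp] i by simp
  \<comment> \<open>Inverting an equation reverses and negates its sign pattern, so three patterns
    yield all six.\<close>
  have inv: "braid_eq m (?L (\<not> c) (\<not> b) (\<not> a)) (?R (\<not> c) (\<not> b) (\<not> a))"
    if "braid_eq m (?L a b c) (?R a b c)" for a b c
    using braid_eq_inv_word[OF that] by simp
  show ?thesis
    using sgn ppp mpp ppm inv[OF ppp] inv[OF mpp] inv[OF ppm] by (cases a; cases b; cases c) auto
qed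

section \<open>Strand positions and heights along a word\<close>

lemma layered_append: "layered h (u @ v) \<longleftrightarrow> layered h u \<and> layered (h \<circ> word_perm u) v"
  by (induction h u rule: layered.induct) (simp_all add: o_def)

lemma word_perm_append: "word_perm (u @ v) = word_perm u \<circ> word_perm v"
  by (induction u rule: word_perm.induct) (auto simp: comp_assoc)

lemma end_pos_append: "end_pos (u @ v) p = end_pos v (end_pos u p)"
  by (induction u arbitrary: p) auto

lemma end_pos_word_perm [simp]: "end_pos w (word_perm w p) = p"
  by (induction w rule: word_perm.induct) auto

lemma word_perm_end_pos [simp]: "word_perm w (end_pos w p) = p"
  by (induction w arbitrary: p rule: word_perm.induct) auto

lemma word_perm_inv_word: "word_perm (inv_word w) = end_pos w"
  by (rule ext, induction w) (auto simp: word_perm_append)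

lemma end_pos_inv_word: "end_pos (inv_word w) = word_perm w"
  using word_perm_inv_word[of "inv_word w"] by (simp add: inv_word_inv_word)

lemma inj_end_pos: "inj (end_pos w)"
  by (metis injI word_perm_end_pos)

lemma inj_word_perm: "inj (word_perm w)"
  by (metis injI end_pos_word_perm)

lemma transpose_Suc_in: "1 \<le> i \<Longrightarrow> i < m \<Longrightarrow> transpose i (Suc i) p \<in> {1..m} \<longleftrightarrow> p \<in> {1..m}"
  by (auto simp: Transposition.transpose_def)

lemma end_pos_in: "w \<in> braid_words m \<Longrightarrow> end_pos w p \<in> {1..m} \<longleftrightarrow> p \<in> {1..m}"
  by (induction w p rule: end_pos.induct) (use transpose_Suc_in in auto)

lemma word_perm_in: "w \<in> braid_words m \<Longrightarrow> word_perm w p \<in> {1..m} \<longleftrightarrow> p \<in> {1..m}"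
  using end_pos_in[of w m "word_perm w p"] by simp

lemma word_perm_cong: "braid_eq m u v \<Longrightarrow> word_perm u = word_perm v"
  unfolding braid_eq_def
proof (induction rule: word_cong.induct)
  case (rel u v a b)
  have "word_perm u = word_perm v"
    using rel(1) unfolding braid_rels_def
    by (auto simp: fun_eq_iff Transposition.transpose_def)
  then show ?case by (simp add: word_perm_append)
qed auto

lemma end_pos_cong: assumes "braid_eq m u v" shows "end_pos u = end_pos v"
  using word_perm_cong[OF braid_eq_inv_word[OF assms]] by (simp add: word_perm_inv_word)

text \<open>The inverse word is the diagram reflected in a horizontal line, so it starts with the
  heights at the bottom of \<open>w\<close>. The negated signs fit because distinct heights leave no
  ties.\<close>

lemma layered_inv_word: 
  assumes "inj h" "layered h w" shows "layered (h \<circ> word_perm w) (inv_word w)"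
  using assms
proof (induction h w rule: layered.induct)
  case (2 h i b w)
  have inj: "inj (h \<circ> transpose i (Suc i))"
    using 2(2) by (simp add: inj_compose)
  have "h (Suc i) \<noteq> h i" using 2(2) by (simp add: inj_eq)
  then have "layered (h \<circ> transpose i (Suc i)) [(i, \<not> b)]"
    using 2(3) by auto
  moreover have "layered (h \<circ> transpose i (Suc i) \<circ> word_perm w) (inv_word w)"
    using 2(1) 2(3) inj by (simp add: o_def)
  ultimately show ?case
    by (simp add: layered_append word_perm_inv_word o_def)
qed simp

text \<open>The exchange condition for signed words. If the first letter \<open>j\<close> is a
  neighbour of \<open>i\<close>, the three strands there cross pairwise: two uses of the induction
  hypothesis bring \<open>j i j\<close> to the front, and the braid relation turns it into
  \<open>i j i\<close>. Its sign condition holds because the three heights are linearly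
  ordered.\<close>

lemma tight_exchange:
  assumes "w \<in> braid_words m" "tight w" "layered h w" "inj h" "1 \<le> i" "i < m"
    "end_pos w (Suc i) < end_pos w i"
  shows "\<exists>b v. braid_eq m w ((i, b) # v) \<and> v \<in> braid_words m \<and> tight ((i, b) # v)
    \<and> layered h ((i, b) # v) \<and> length w = Suc (length v)"
  using assms
proof (induction "length w" arbitrary: w h i rule: less_induct)
  case less
  from less.prems(7) obtain j b w' where w: "w = (j, b) # w'"
    by (cases w) auto
  let ?s = "\<lambda>j. transpose j (Suc j)"
  have j: "1 \<le> j" "j < m" and w': "w' \<in> braid_words m" "tight w'" "layered (h \<circ> ?s j) w'"
    and asc: "end_pos w' j < end_pos w' (Suc j)" and b: "b \<longleftrightarrow> h (Suc j) < h j"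
    using less.prems w by auto
  have injs: "inj (h \<circ> ?s k)" "inj (h \<circ> ?s k \<circ> ?s l)" for k l
    using less.prems(4) by (auto intro!: inj_compose)
  have neq: "h k \<noteq> h l" if "k \<noteq> l" for k l
    using less.prems(4) that by (simp add: inj_eq)
  consider "j = i" | "Suc i < j \<or> Suc j < i" | "j = Suc i" | "i = Suc j" by linarith
  then show ?case
  proof cases
    case 1
    then show ?thesis using less.prems w by (auto intro!: exI braid_eq_refl)
  next
    case 2
    then have s: "?s j i = i" "?s j (Suc i) = Suc i" "?s i j = j" "?s i (Suc j) = Suc j"
      and comm: "?s i \<circ> ?s j = ?s j \<circ> ?s i"
      by (auto simp: Transposition.transpose_def fun_eq_iff)
    have "end_pos w' (Suc i) < end_pos w' i" using less.prems(7) s by (simp add: w)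
    then obtain c v where v: "braid_eq m w' ((i, c) # v)" "v \<in> braid_words m" "tight ((i, c) # v)"
      "layered (h \<circ> ?s j) ((i, c) # v)" "length w' = Suc (length v)"
      using less.hyps[of w' "h \<circ> ?s j" i] w w' injs less.prems(5,6) by auto
    have "braid_eq m w ([(j, b), (i, c)] @ v)"
      using braid_eq_Cons[OF v(1) j] by (simp add: w)
    also have "braid_eq m \<dots> ([(i, c), (j, b)] @ v)"
      using braid_eq_commute[of j m i b c] 2 j less.prems(5,6) v(2)
      by (intro braid_eq_append braid_eq_refl) auto
    finally have eq: "braid_eq m w ((i, c) # (j, b) # v)" by simp
    have "end_pos w' = end_pos ((i, c) # v)" by (rule end_pos_cong[OF v(1)])
    then have "end_pos v j < end_pos v (Suc j)" using asc s by simp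
    moreover have "layered h ((i, c) # (j, b) # v)"
      using v(4) b s by (simp add: comp_assoc comm)
    ultimately have "tight ((i, c) # (j, b) # v)" "layered h ((i, c) # (j, b) # v)"
      using v(3) s by auto
    then show ?thesis using eq v(2,5) w j by (intro exI[of _ c] exI[of _ "(j, b) # v"]) auto
  next
    case 3
    let ?k = "Suc (Suc i)"
    have sj: "?s j i = i" "?s j (Suc i) = ?k" "?s j ?k = Suc i" using 3 by auto
    \<comment> \<open>Below the first crossing the strands in \<open>Suc i\<close>,
      \<open>?k\<close>, \<open>i\<close> end in this order from left to right, so the strand in
      \<open>i\<close> still has to cross the other two.\<close>
    have "end_pos w' ?k < end_pos w' i" using less.prems(7) sj by (simp add: w)
    moreover have asc': "end_pos w' (Suc i) < end_pos w' ?k" using asc 3 by simp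
    ultimately have "end_pos w' (Suc i) < end_pos w' i" by simp
    then obtain c v where v: "braid_eq m w' ((i, c) # v)" "v \<in> braid_words m" "tight ((i, c) # v)"
      "layered (h \<circ> ?s j) ((i, c) # v)" "length w' = Suc (length v)"
      using less.hyps[of w' "h \<circ> ?s j" i] w w' injs less.prems(5,6) by auto
    have ew': "end_pos w' = end_pos ((i, c) # v)" by (rule end_pos_cong[OF v(1)])
    have "end_pos v ?k < end_pos v (Suc i)" using \<open>end_pos w' ?k < end_pos w' i\<close> by (simp add: ew')
    then obtain d u where u: "braid_eq m v ((j, d) # u)" "u \<in> braid_words m" "tight ((j, d) # u)"
      "layered (h \<circ> ?s j \<circ> ?s i) ((j, d) # u)" "length v = Suc (length u)"
      using less.hyps[of v "h \<circ> ?s j \<circ> ?s i" j] w v injs j 3 by auto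
    have ev: "end_pos v = end_pos ((j, d) # u)" by (rule end_pos_cong[OF u(1)])
    have c: "c \<longleftrightarrow> h ?k < h i" and d: "d \<longleftrightarrow> h (Suc i) < h i"
      using v(4) u(4) 3 by auto
    have sgn: "b \<noteq> d \<or> c = b"
      using b c d neq[of i "Suc i"] neq[of i ?k] neq[of "Suc i" ?k] 3 by auto
    have "braid_eq m w ([(j, b)] @ (i, c) # v)"
      using braid_eq_Cons[OF v(1) j] by (simp add: w)
    also have "braid_eq m \<dots> ([(j, b), (i, c)] @ (j, d) # u)"
      using braid_eq_append[OF braid_eq_refl u(1), of "[(j, b), (i, c)]"] j less.prems(5,6) by simp
    also have "braid_eq m \<dots> ([(j, b), (i, c), (j, d)] @ u)" 
      using j less.prems(5,6) u(2) by (auto intro!: braid_eq_refl)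
    also have "braid_eq m \<dots> ([(i, d), (j, c), (i, b)] @ u)"
      using braid_eq_braid[of i m d b c] 3 j less.prems(5,6) sgn u(2)
      by (intro braid_eq_append braid_eq_refl) (auto intro: braid_eq_sym)
    finally have eq: "braid_eq m w ((i, d) # (j, c) # (i, b) # u)" by simp
    have e: "end_pos u i < end_pos u (Suc i)" "end_pos u (Suc i) < end_pos u ?k"
    proof -
      have 1: "end_pos v i < end_pos v (Suc i)" "end_pos u (Suc i) < end_pos u ?k"
        using v(3) u(3) 3 by auto
      have "end_pos v i < end_pos v ?k" using asc' ew' by simp
      with 1 show "end_pos u i < end_pos u (Suc i)" "end_pos u (Suc i) < end_pos u ?k"
        using ev 3 by auto
    qed
    have comm: "?s i \<circ> ?s j \<circ> ?s i = ?s j \<circ> ?s i \<circ> ?s j"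
      using 3 by (auto simp: Transposition.transpose_def fun_eq_iff)
    have "layered h ((i, d) # (j, c) # (i, b) # u)"
      using u(4) b c d 3 comm by (simp add: comp_assoc)
    moreover have "tight ((i, d) # (j, c) # (i, b) # u)"
      using u(3) e 3 by auto
    ultimately show ?thesis
      using eq u(2,5) v(5) w j less.prems(5,6)
      by (intro exI[of _ d] exI[of _ "(j, c) # (i, b) # u"]) auto
  next
    case 4
    let ?k = "Suc (Suc j)"
    have asc': "end_pos w' j < end_pos w' i" using asc 4 by simp
    moreover have lt: "end_pos w' ?k < end_pos w' j" using less.prems(7) 4 by (simp add: w)
    ultimately have "end_pos w' (Suc i) < end_pos w' i" using 4 by simp
    then obtain c v where v: "braid_eq m w' ((i, c) # v)" "v \<in> braid_words m" "tight ((i, c) # v)"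
      "layered (h \<circ> ?s j) ((i, c) # v)" "length w' = Suc (length v)"
      using less.hyps[of w' "h \<circ> ?s j" i] w w' injs less.prems(5,6) by auto
    have ew': "end_pos w' = end_pos ((i, c) # v)" by (rule end_pos_cong[OF v(1)])
    have "end_pos v (Suc j) < end_pos v j" using lt 4 by (simp add: ew')
    then obtain d u where u: "braid_eq m v ((j, d) # u)" "u \<in> braid_words m" "tight ((j, d) # u)"
      "layered (h \<circ> ?s j \<circ> ?s i) ((j, d) # u)" "length v = Suc (length u)"
      using less.hyps[of v "h \<circ> ?s j \<circ> ?s i" j] w v injs j by auto
    have ev: "end_pos v = end_pos ((j, d) # u)" by (rule end_pos_cong[OF u(1)])
    have c: "c \<longleftrightarrow> h ?k < h j" and d: "d \<longleftrightarrow> h ?k < h (Suc j)"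
      using v(4) u(4) 4 by auto
    have sgn: "b \<noteq> d \<or> c = b"
      using b c d neq[of j "Suc j"] neq[of j ?k] neq[of "Suc j" ?k] by auto
    have "braid_eq m w ([(j, b)] @ (i, c) # v)"
      using braid_eq_Cons[OF v(1) j] by (simp add: w)
    also have "braid_eq m \<dots> ([(j, b), (i, c)] @ (j, d) # u)"
      using braid_eq_append[OF braid_eq_refl u(1), of "[(j, b), (i, c)]"] j less.prems(5,6) by simp
    also have "braid_eq m \<dots> ([(j, b), (i, c), (j, d)] @ u)" 
      using j less.prems(5,6) u(2) by (auto intro!: braid_eq_refl)
    also have "braid_eq m \<dots> ([(i, d), (j, c), (i, b)] @ u)"
      using braid_eq_braid[of j m b d c] 4 j less.prems(5,6) sgn u(2)
      by (intro braid_eq_append braid_eq_refl) auto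
    finally have eq: "braid_eq m w ((i, d) # (j, c) # (i, b) # u)" by simp
    have e: "end_pos u j < end_pos u (Suc j)" "end_pos u (Suc j) < end_pos u ?k"
    proof -
      have 1: "end_pos v i < end_pos v ?k" "end_pos u j < end_pos u (Suc j)"
        using v(3) u(3) 4 by auto
      have "end_pos v j < end_pos v ?k" using asc' ew' 4 by simp
      with 1 show "end_pos u j < end_pos u (Suc j)" "end_pos u (Suc j) < end_pos u ?k"
        using ev 4 by auto
    qed
    have comm: "?s i \<circ> ?s j \<circ> ?s i = ?s j \<circ> ?s i \<circ> ?s j"
      using 4 by (auto simp: Transposition.transpose_def fun_eq_iff)
    have "layered h ((i, d) # (j, c) # (i, b) # u)"
      using u(4) b c d 4 comm by (simp add: comp_assoc)
    moreover have "tight ((i, d) # (j, c) # (i, b) # u)"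
      using u(3) e 4 by auto
    ultimately show ?thesis
      using eq u(2,5) v(5) w j less.prems(5,6)
      by (intro exI[of _ d] exI[of _ "(j, c) # (i, b) # u"]) auto
  qed
qed

text \<open>A letter that makes two strands cross a second time meets, after an exchange, the other
  crossing of the same strands. Their heights are the same at both, so the signs are opposite and
  the letters cancel; without heights a full twist could remain.\<close>

lemma layered_tighten:
  assumes "w \<in> braid_words m" "layered h w" "inj h"
  shows "\<exists>v. braid_eq m w v \<and> tight v \<and> layered h v \<and> length v \<le> length w"
  using assms
proof (induction w arbitrary: h)
  case Nil
  then show ?case by (auto intro: braid_eq_refl)
next
  case (Cons a w)
  obtain i b where a: "a = (i, b)" by (cases a)
  let ?s = "transpose i (Suc i)"
  have i: "1 \<le> i" "i < m" using Cons.prems a by auto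
  have inj: "inj (h \<circ> ?s)" using Cons.prems by (auto intro!: inj_compose)
  have b: "b \<longleftrightarrow> h (Suc i) < h i" using Cons.prems a by simp
  obtain v where v: "braid_eq m w v" "tight v" "layered (h \<circ> ?s) v" "length v \<le> length w"
    using Cons.IH[OF _ _ inj] Cons.prems a by (auto simp: o_def)
  have eq: "braid_eq m (a # w) ((i, b) # v)" using braid_eq_Cons[OF v(1) i] a by simp
  consider "end_pos v i < end_pos v (Suc i)" | "end_pos v (Suc i) < end_pos v i"
    using inj_end_pos[of v] by (metis inj_eq linorder_neqE_nat n_not_Suc_n)
  then show ?case
  proof cases
    case 1
    then show ?thesis using v b eq by (intro exI[of _ "(i, b) # v"]) auto
  next
    case 2
    then obtain c u where u: "braid_eq m v ((i, c) # u)" "u \<in> braid_words m" "tight ((i, c) # u)"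
      "layered (h \<circ> ?s) ((i, c) # u)" "length v = Suc (length u)"
      using tight_exchange[of v m "h \<circ> ?s" i] v inj i braid_eq_words[OF v(1)] by auto
    have "h i \<noteq> h (Suc i)" using Cons.prems(3) by (simp add: inj_eq)
    then have c: "c = (\<not> b)" using u(4) b by auto
    note eq
    also have "braid_eq m ((i, b) # v) ((i, b) # (i, c) # u)" by (rule braid_eq_Cons[OF u(1) i])
    also have "braid_eq m \<dots> ([] @ u)"
      using braid_eq_append[OF braid_eq_cancel[OF i, of b] braid_eq_refl[OF u(2)]] c by simp
    finally show ?thesis using u v by (intro exI[of _ u]) (auto simp: comp_assoc)
  qed
qed

section \<open>Crossings and linking numbers\<close>

fun crossings :: "(nat \<times> bool) list \<Rightarrow> nat \<Rightarrow> nat \<Rightarrow> nat" where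
  "crossings [] p q = 0"
| "crossings ((i, b) # w) p q = (if {p, q} = {i, Suc i} then 1 else 0)
    + crossings w (transpose i (Suc i) p) (transpose i (Suc i) q)"

text \<open>The exponent sum of the letters at which two given strands cross. For a pure braid it is
  twice their linking number, up to the sign convention.\<close>

fun linking :: "(nat \<times> bool) list \<Rightarrow> nat \<Rightarrow> nat \<Rightarrow> int" where
  "linking [] p q = 0"
| "linking ((i, b) # w) p q = (if {p, q} = {i, Suc i} then if b then 1 else - 1 else 0)
    + linking w (transpose i (Suc i) p) (transpose i (Suc i) q)"

definition crosses_once :: "(nat \<times> bool) list \<Rightarrow> bool" where
  "crosses_once w \<longleftrightarrow> (\<forall>p q. p \<noteq> q \<longrightarrow> crossings w p q \<le> 1)"

lemma linking_append:
  "linking (u @ v) p q = linking u p q + linking v (end_pos u p) (end_pos u q)"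
  by (induction u p q rule: linking.induct) auto

text \<open>A free cancellation contributes \<open>1 - 1\<close>, and the other relations only
  rearrange the crossings of the strands involved.\<close>

lemma linking_cong: "braid_eq m u v \<Longrightarrow> linking u p q = linking v p q"
  unfolding braid_eq_def
proof (induction arbitrary: p q rule: word_cong.induct)
  case (rel u v a b)
  have "linking u p q = linking v p q" for p q
    using rel(1) unfolding braid_rels_def
    by (auto simp: doubleton_eq_iff Transposition.transpose_def)
  moreover have "braid_eq m u v"
    using rel by (auto intro!: braid_eq_rel simp: braid_words_def)
  ultimately show ?case by (simp add: linking_append end_pos_cong)
qed auto

lemma crossings_commute: "crossings w p q = crossings w q p"
  by (induction w p q rule: crossings.induct) (auto simp: insert_commute)

lemma abs_linking_le: "\<bar>linking w p q\<bar> \<le> int (crossings w p q)"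
proof (induction w p q rule: crossings.induct)
  case (2 i b w p q)
  then show ?case by (cases b) auto
qed simp

lemma crossings_same: "crossings w p p = 0"
  by (induction w p p rule: crossings.induct) auto

text \<open>Each letter is counted for both orders of its two strands, hence the factor 2.\<close>

lemma sum_crossings:
  assumes "w \<in> braid_words m"
  shows "(\<Sum>p\<in>{1..m}. \<Sum>q\<in>{1..m}. crossings w p q) = 2 * length w"
  using assms
proof (induction w)
  case (Cons a w)
  obtain i b where a: "a = (i, b)" by (cases a)
  have i: "1 \<le> i" "i < m" and w: "w \<in> braid_words m" using Cons.prems a by auto
  let ?s = "transpose i (Suc i)"
  have bij: "bij_betw ?s {1..m} {1..m}" using i by (intro bij_betw_transpose_iff) auto
  have "(\<Sum>p\<in>{1..m}. \<Sum>q\<in>{1..m}. crossings w (?s p) (?s q))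
      = (\<Sum>p\<in>{1..m}. \<Sum>q\<in>{1..m}. crossings w (?s p) q)"
    by (intro sum.cong sum.reindex_bij_betw[OF bij, of "crossings w _"] HOL.refl)
  also have "\<dots> = (\<Sum>p\<in>{1..m}. \<Sum>q\<in>{1..m}. crossings w p q)"
    by (rule sum.reindex_bij_betw[OF bij, of "\<lambda>p. \<Sum>q\<in>{1..m}. crossings w p q"])
  also have "\<dots> = 2 * length w" using Cons.IH[OF w] .
  finally have 1: "(\<Sum>p\<in>{1..m}. \<Sum>q\<in>{1..m}. crossings w (?s p) (?s q)) = 2 * length w" .
  have "(\<Sum>p\<in>{1..m}. \<Sum>q\<in>{1..m}. if {p, q} = {i, Suc i} then 1 else 0 :: nat)
      = (\<Sum>p\<in>{1..m}. (if p = i then 1 else 0) + (if p = Suc i then 1 else 0))"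
  proof (intro sum.cong HOL.refl)
    fix p
    have "(\<Sum>q\<in>{1..m}. if {p, q} = {i, Suc i} then 1 else 0 :: nat)
        = (\<Sum>q\<in>{1..m}. (if q = Suc i then if p = i then 1 else 0 else 0)
            + (if q = i then if p = Suc i then 1 else 0 else 0))"
      by (intro sum.cong HOL.refl) (auto simp: doubleton_eq_iff)
    also have "\<dots> = (if p = i then 1 else 0) + (if p = Suc i then 1 else 0)"
      using i by (subst sum.distrib) (simp add: sum.delta)
    finally show "(\<Sum>q\<in>{1..m}. if {p, q} = {i, Suc i} then 1 else 0 :: nat)
      = (if p = i then 1 else 0) + (if p = Suc i then 1 else 0)" .
  qed
  also have "\<dots> = 2" using i by (subst sum.distrib) (simp add: sum.delta)
  finally show ?case using 1 by (simp add: a sum.distrib)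
qed simp

lemma tight_crossings:
  "tight w \<Longrightarrow> p < q \<Longrightarrow> crossings w p q = (if end_pos w q < end_pos w p then 1 else 0)"
proof (induction w arbitrary: p q)
  case (Cons a w)
  obtain i b where a: "a = (i, b)" by (cases a)
  let ?s = "transpose i (Suc i)"
  have w: "tight w" "end_pos w i < end_pos w (Suc i)" using Cons.prems a by auto
  show ?case
  proof (cases "p = i \<and> q = Suc i")
    case True
    then show ?thesis
      using Cons.IH[OF w(1), of i "Suc i"] w(2) by (simp add: a crossings_commute)
  next
    case False
    then have "?s p < ?s q" using Cons.prems(2) by (auto simp: Transposition.transpose_def)
    then show ?thesis
      using Cons.IH[OF w(1)] False Cons.prems(2) by (auto simp: a doubleton_eq_iff)
  qed
qed simp

lemma crosses_once_tight:
  assumes "tight w" shows "crosses_once w"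
  unfolding crosses_once_def
proof (intro allI impI)
  fix p q :: nat assume "p \<noteq> q"
  then consider "p < q" | "q < p" by linarith
  then show "crossings w p q \<le> 1"
    using tight_crossings[OF assms, of p q] tight_crossings[OF assms, of q p]
    by cases (auto simp: crossings_commute[of w p q])
qed

lemma crosses_once_Cons:
  assumes "crosses_once ((i, b) # w)"
  shows "crosses_once w" "crossings w i (Suc i) = 0"
proof -
  let ?s = "transpose i (Suc i)"
  have cr: "crossings ((i, b) # w) p q \<le> 1" if "p \<noteq> q" for p q
    using assms that by (simp add: crosses_once_def)
  show "crossings w i (Suc i) = 0" using cr[of i "Suc i"] by (simp add: crossings_commute)
  show "crosses_once w"
    unfolding crosses_once_def
  proof (intro allI impI)
    fix p q :: nat assume "p \<noteq> q"
    then have "?s p \<noteq> ?s q" by (simp add: inj_eq[OF inj_transpose])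
    from cr[OF this] show "crossings w p q \<le> 1" by simp
  qed
qed

text \<open>The two strands meet at most once, and then still in their initial order, so the sign of
  the crossing compares their heights.\<close>

lemma layered_linking:
  assumes "crosses_once w" "layered h w" "p < q"
  shows "linking w p q = (if crossings w p q = 0 then 0 else if h q < h p then 1 else - 1)"
  using assms
proof (induction w arbitrary: h p q)
  case (Cons a w)
  obtain i b where a: "a = (i, b)" by (cases a)
  let ?s = "transpose i (Suc i)"
  have once: "crosses_once w" "crossings w i (Suc i) = 0"
    using Cons.prems(1) crosses_once_Cons unfolding a by blast+
  have w: "layered (h \<circ> ?s) w" "b \<longleftrightarrow> h (Suc i) < h i" using Cons.prems(2) a by auto
  show ?case
  proof (cases "p = i \<and> q = Suc i")
    case True
    then show ?thesis
      using abs_linking_le[of w "Suc i" i] once(2) w(2)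
      by (simp add: a crossings_commute[of w "Suc i" i])
  next
    case False
    then have "?s p < ?s q" using Cons.prems(3) by (auto simp: Transposition.transpose_def)
    then show ?thesis
      using Cons.IH[OF once(1) w(1)] False Cons.prems(3) by (auto simp: a doubleton_eq_iff)
  qed
qed simp

text \<open>The converse of \<open>layered_linking\<close>: when two strands cross only once, their
  linking number is the sign of that letter, so heights that fit all linking numbers fit every
  letter.\<close>

lemma layered_if_linking:
  assumes "crosses_once w"
    "\<And>p q. p < q \<Longrightarrow> crossings w p q \<noteq> 0 \<Longrightarrow> linking w p q = (if h q < h p then 1 else - 1)"
  shows "layered h w"
  using assms
proof (induction w arbitrary: h)
  case (Cons a w)
  obtain i b where a: "a = (i, b)" by (cases a)
  let ?s = "transpose i (Suc i)"
  have once: "crosses_once w" "crossings w i (Suc i) = 0"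
    using Cons.prems(1) crosses_once_Cons unfolding a by blast+
  have "linking w (Suc i) i = 0"
    using abs_linking_le[of w "Suc i" i] once(2) by (simp add: crossings_commute[of w "Suc i" i])
  then have b: "b \<longleftrightarrow> h (Suc i) < h i"
    using Cons.prems(2)[of i "Suc i"] by (auto simp: a split: if_splits)
  have "layered (h \<circ> ?s) w"
  proof (rule Cons.IH[OF once(1)])
    fix p q :: nat assume pq: "p < q" "crossings w p q \<noteq> 0"
    then have ne: "\<not> (p = i \<and> q = Suc i)" using once(2) by auto
    then have "?s p < ?s q" using pq(1) by (auto simp: Transposition.transpose_def)
    moreover have "{?s p, ?s q} \<noteq> {i, Suc i}"
      using ne pq(1) by (auto simp: doubleton_eq_iff transpose_eq_iff)
    ultimately show "linking w p q = (if (h \<circ> ?s) q < (h \<circ> ?s) p then 1 else - 1)"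
      using Cons.prems(2)[of "?s p" "?s q"] pq(2) by (simp add: a)
  qed
  then show ?case using b by (simp add: a)
qed simp

lemma end_pos_eq_iff: "end_pos w p = end_pos w q \<longleftrightarrow> p = q"
  using inj_end_pos by (auto simp: inj_eq)

lemma crossings_ge:
  "p < q \<Longrightarrow> end_pos w q < end_pos w p \<Longrightarrow> 1 \<le> crossings w p q"
proof (induction w arbitrary: p q)
  case (Cons a w)
  obtain i b where a: "a = (i, b)" by (cases a)
  show ?case
  proof (cases "p = i \<and> q = Suc i")
    case True
    then show ?thesis by (simp add: a)
  next
    case False
    then have "transpose i (Suc i) p < transpose i (Suc i) q"
      using Cons.prems(1) by (auto simp: Transposition.transpose_def)
    then show ?thesis using Cons.IH Cons.prems by (auto simp: a le_Suc_eq)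
  qed
qed simp

text \<open>Strands with inverted ends must cross in any word, and a tight word has no other
  crossings.\<close>

lemma tight_length_le:
  assumes "tight v" "v \<in> braid_words m" "w \<in> braid_words m" "end_pos v = end_pos w"
  shows "length v \<le> length w"
proof -
  have le: "crossings v p q \<le> crossings w p q" if "p < q" for p q
    using tight_crossings[OF assms(1) that] crossings_ge[OF that, of w] assms(4) by auto
  have "crossings v p q \<le> crossings w p q" for p q
  proof -
    consider "p < q" | "q < p" | "p = q" by linarith
    then show ?thesis
      using le[of p q] le[of q p]
      by cases (auto simp: crossings_same crossings_commute[of _ p q])
  qed
  then have "(\<Sum>p\<in>{1..m}. \<Sum>q\<in>{1..m}. crossings v p q)
      \<le> (\<Sum>p\<in>{1..m}. \<Sum>q\<in>{1..m}. crossings w p q)"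
    by (intro sum_mono)
  then show ?thesis unfolding sum_crossings[OF assms(2)] sum_crossings[OF assms(3)] by simp
qed

section \<open>Layered braids are Mikado braids\<close>

text \<open>Pair by pair, \<open>g\<close> has at least \<open>\<bar>linking w p q\<bar>\<close>
  crossings, which is the number of crossings in \<open>w\<close>. As the total of \<open>g\<close>
  is not larger, equality holds for every pair.\<close>

lemma layered_shortest:
  assumes w: "w \<in> braid_words m" "crosses_once w" "layered h w"
    and g: "braid_eq m w g" "length g \<le> length w"
  shows "crosses_once g" "layered h g"
proof -
  have gw: "g \<in> braid_words m" using braid_eq_words[OF g(1)] by simp
  have lk: "linking g p q = linking w p q" for p q using linking_cong[OF g(1)] by simp
  have abs: "\<bar>linking w p q\<bar> = int (crossings w p q)" if "p < q" for p q
  proof -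
    have "crossings w p q \<le> 1" using w(2) that by (simp add: crosses_once_def)
    then show ?thesis using layered_linking[OF w(2,3) that] by auto
  qed
  have le: "crossings w p q \<le> crossings g p q" for p q
  proof -
    have "crossings w p q \<le> crossings g p q" if "p < q" for p q
      using abs[OF that] abs_linking_le[of g p q] lk[of p q] by simp
    from this[of p q] this[of q p] show ?thesis
      by (cases p q rule: linorder_cases) (auto simp: crossings_same crossings_commute[of _ p q])
  qed
  have eq: "crossings w p q = crossings g p q" if "p \<in> {1..m}" "q \<in> {1..m}" for p q
  proof (rule ccontr)
    assume "crossings w p q \<noteq> crossings g p q"
    then have lt: "crossings w p q < crossings g p q" using le[of p q] by simp
    have "(\<Sum>p\<in>{1..m}. \<Sum>q\<in>{1..m}. crossings w p q) < (\<Sum>p\<in>{1..m}. \<Sum>q\<in>{1..m}. crossings g p q)"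
    proof (rule sum_strict_mono_ex1)
      show "\<forall>p\<in>{1..m}. (\<Sum>q\<in>{1..m}. crossings w p q) \<le> (\<Sum>q\<in>{1..m}. crossings g p q)"
        by (intro ballI sum_mono le)
      have "(\<Sum>q\<in>{1..m}. crossings w p q) < (\<Sum>q\<in>{1..m}. crossings g p q)"
        by (rule sum_strict_mono_ex1) (use le lt that in auto)
      then show "\<exists>p\<in>{1..m}. (\<Sum>q\<in>{1..m}. crossings w p q) < (\<Sum>q\<in>{1..m}. crossings g p q)"
        using that by blast
    qed simp
    then show False using g(2) unfolding sum_crossings[OF w(1)] sum_crossings[OF gw] by simp
  qed
  \<comment> \<open>The sums control only the strands in \<open>{1..m}\<close>; elsewhere there are
    no crossings, while \<open>crosses_once\<close> ranges over all naturals.\<close>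
  have out: "crossings u p q = 0" if "u \<in> braid_words m" "p \<notin> {1..m} \<or> q \<notin> {1..m}" for u p q
    using that
  proof (induction u p q rule: crossings.induct)
    case (2 i b w p q)
    then show ?case using transpose_Suc_in[of i m p] transpose_Suc_in[of i m q]
      by (auto simp: doubleton_eq_iff)
  qed simp
  have eq': "crossings g p q = crossings w p q" for p q
    using eq[of p q] out[OF w(1), of p q] out[OF gw, of p q] by metis
  show "crosses_once g" using w(2) by (simp add: crosses_once_def eq')
  then show "layered h g"
    by (rule layered_if_linking) (simp add: lk eq' layered_linking[OF w(2,3)])
qed

lemma good_strand_highest:
  "layered h w \<Longrightarrow> w \<in> braid_words m \<Longrightarrow> k \<in> {1..m}
    \<Longrightarrow> (\<And>p. p \<in> {1..m} \<Longrightarrow> p \<noteq> k \<Longrightarrow> h p < h k) \<Longrightarrow> good_strand k w"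
proof (induction w arbitrary: h k)
  case (Cons a w)
  obtain i b where a: "a = (i, b)" by (cases a)
  let ?s = "transpose i (Suc i)"
  have i: "1 \<le> i" "i < m" and w: "w \<in> braid_words m" "layered (h \<circ> ?s) w" 
    and b: "b \<longleftrightarrow> h (Suc i) < h i"
    using Cons.prems a by auto
  have "good_strand (?s k) w"
  proof (rule Cons.IH[OF w(2,1)])
    show "?s k \<in> {1..m}" using transpose_Suc_in[OF i] Cons.prems(3) by blast
    fix p assume "p \<in> {1..m}" "p \<noteq> ?s k"
    then show "(h \<circ> ?s) p < (h \<circ> ?s) (?s k)"
      using Cons.prems(4)[of "?s p"] transpose_Suc_in[OF i, of p]
      by (metis comp_apply transpose_involutory)
  qed
  moreover have "k = i \<Longrightarrow> b" using b Cons.prems(4)[of "Suc i"] i by simp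
  moreover have "k = Suc i \<Longrightarrow> \<not> b" using b Cons.prems(4)[of i] i by simp
  ultimately show ?case by (auto simp: a)
qed simp

text \<open>The order embedding of the naturals that omits \<open>k\<close>: strand \<open>p\<close>
  of the diagram without strand \<open>k\<close> is strand \<open>skip k p\<close> of the full
  diagram.\<close>

definition skip :: "nat \<Rightarrow> nat \<Rightarrow> nat" where
  "skip k p = (if p < k then p else Suc p)"

lemma skip_eq_iff [simp]: "skip k p = skip k q \<longleftrightarrow> p = q"
  by (auto simp: skip_def)

lemma transpose_skip:
  "transpose i (Suc i) (skip i p) = skip (Suc i) p"
  "transpose i (Suc i) (skip (Suc i) p) = skip i p"
  "k < i \<Longrightarrow> transpose i (Suc i) (skip k p) = skip k (transpose (i - 1) i p)"
  "Suc i < k \<Longrightarrow> transpose i (Suc i) (skip k p) = skip k (transpose i (Suc i) p)"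
  by (auto simp: skip_def Transposition.transpose_def)

lemma crossings_remove_strand:
  "crossings (remove_strand k w) p q = crossings w (skip k p) (skip k q)"
proof (induction k w arbitrary: p q rule: remove_strand.induct)
  case (2 k i b w)
  consider "k = i" | "k = Suc i" | "k < i" | "Suc i < k" by linarith
  then show ?case
  proof cases
    case 3
    then have "{skip k p, skip k q} = {i, Suc i} \<longleftrightarrow> {p, q} = {i - 1, i}"
      by (auto simp: skip_def doubleton_eq_iff split: if_splits)
    then show ?thesis using 3 2(3) by (auto simp: transpose_skip)
  next
    case 4
    then have "{skip k p, skip k q} = {i, Suc i} \<longleftrightarrow> {p, q} = {i, Suc i}"
      by (auto simp: skip_def doubleton_eq_iff split: if_splits)
    then show ?thesis using 4 2(4) by (auto simp: transpose_skip)
  next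
    case 1
    then have "{skip k p, skip k q} \<noteq> {i, Suc i}"
      by (auto simp: skip_def doubleton_eq_iff split: if_splits)
    then show ?thesis using 1 2(1) by (simp add: transpose_skip)
  next
    case 2
    then have "{skip k p, skip k q} \<noteq> {i, Suc i}"
      by (auto simp: skip_def doubleton_eq_iff split: if_splits)
    then show ?thesis using 2 "2.IH"(2) by (simp add: transpose_skip)
  qed
qed simp

lemma layered_remove_strand:
  "layered h w \<Longrightarrow> layered (h \<circ> skip k) (remove_strand k w)"
proof (induction k w arbitrary: h rule: remove_strand.induct)
  case (2 k i b w)
  let ?s = "transpose i (Suc i)"
  have w: "layered (h \<circ> ?s) w" "b \<longleftrightarrow> h (Suc i) < h i" using 2 by auto
  consider "k = i" | "k = Suc i" | "k < i" | "Suc i < k" by linarith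
  then show ?case
  proof cases
    case 1
    then show ?thesis using 2(1)[OF 1 w(1)] by (simp add: o_def transpose_skip)
  next
    case 2
    then show ?thesis using "2.IH"(2)[OF _ _ w(1)] by (simp add: o_def transpose_skip)
  next
    case 3
    then have "skip k (i - 1) = i" "skip k (Suc (i - 1)) = Suc i" "Suc (i - 1) = i"
      by (auto simp: skip_def)
    then show ?thesis using 3 2(3)[OF _ _ _ w(1)] w(2) by (simp add: o_def transpose_skip)
  next
    case 4
    then have "skip k i = i" "skip k (Suc i) = Suc i" by (auto simp: skip_def)
    then show ?thesis using 4 2(4)[OF _ _ _ w(1)] w(2) by (simp add: o_def transpose_skip)
  qed
qed simp

lemma remove_strand_in:
  "w \<in> braid_words (Suc m) \<Longrightarrow> k \<in> {1..Suc m} \<Longrightarrow> remove_strand k w \<in> braid_words m"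
  by (induction k w rule: remove_strand.induct) auto

lemma mem_braid_class:
  "w \<in> braid_words m \<Longrightarrow> g \<in> braid_class m w \<longleftrightarrow> braid_eq m w g"
  by (simp add: braid_class_def word_class_def braid_eq_def)

lemma braid_class_eq_iff:
  "u \<in> braid_words m \<Longrightarrow> v \<in> braid_words m \<Longrightarrow> braid_class m u = braid_class m v \<longleftrightarrow> braid_eq m u v"
  unfolding braid_class_def braid_eq_def braid_words_def by (rule word_class_eq_iff)

lemma braid_class_in_carrier: "w \<in> braid_words m \<Longrightarrow> braid_class m w \<in> carrier (braid_group m)"
  unfolding braid_class_def braid_group_def braid_words_def by (simp add: carrier_presented_monoid)

lemma mikado_layered:
  assumes "1 \<le> m" "w \<in> braid_words m" "crosses_once w" "layered h w" "inj h"
  shows "mikado m (braid_class m w)"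
  using assms
proof (induction m arbitrary: w h)
  case (Suc m)
  show ?case
  proof (cases m)
    case 0
    then have "w = []" using Suc.prems(2) by (cases w) auto
    then show ?thesis using 0
      by (simp add: braid_class_def braid_group_def one_presented_monoid)
  next
    case (Suc m')
    note m = this
    have "(\<exists>k \<in> {1..Suc m}. good_strand k g) \<and> (\<forall>k \<in> {1..Suc m}. good_strand k g \<longrightarrow>
        mikado m (braid_class m (remove_strand k g)))"
      if red: "reduced_diagram (braid_class (Suc m) w) g" for g
    proof -
      have g: "braid_eq (Suc m) w g" "length g \<le> length w"
        using red Suc.prems(2) by (auto simp: reduced_diagram_def mem_braid_class braid_eq_refl)
      have lg: "crosses_once g" "layered h g"
        using layered_shortest[OF Suc.prems(2-4) g] by auto
      have gw: "g \<in> braid_words (Suc m)" using braid_eq_words[OF g(1)] by simp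
      have fin: "finite (h ` {1..Suc m})" "h ` {1..Suc m} \<noteq> {}" by auto
      obtain k where k: "k \<in> {1..Suc m}" "h k = Max (h ` {1..Suc m})"
        using Max_in[OF fin] by (metis imageE)
      have "h p < h k" if "p \<in> {1..Suc m}" "p \<noteq> k" for p
      proof -
        have "h p \<le> h k" using k(2) fin(1) that(1) by (metis Max_ge imageI)
        moreover have "h p \<noteq> h k" using Suc.prems(5) that(2) by (simp add: inj_eq)
        ultimately show ?thesis by simp
      qed
      then have "good_strand k g" by (rule good_strand_highest[OF lg(2) gw k(1)])
      \<comment> \<open>Any strand may be removed here, not only a good one: the remaining strands
        keep their heights and their mutual crossings.\<close>
      moreover have "mikado m (braid_class m (remove_strand k g))" if "k \<in> {1..Suc m}" for k
      proof (rule Suc.IH)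
        show "1 \<le> m" using m by simp
        show "remove_strand k g \<in> braid_words m" by (rule remove_strand_in[OF gw that])
        show "crosses_once (remove_strand k g)"
          using lg(1) by (simp add: crosses_once_def crossings_remove_strand)
        show "layered (h \<circ> skip k) (remove_strand k g)" by (rule layered_remove_strand[OF lg(2)])
        show "inj (h \<circ> skip k)" 
          using Suc.prems(5) by (intro inj_compose) (simp_all add: inj_on_def)
      qed
      ultimately show ?thesis using k(1) by blast
    qed
    then show ?thesis
      using braid_class_in_carrier[OF Suc.prems(2)] unfolding m mikado.simps by blast
  qed
qed simp

section \<open>Layered braids are rational permutation braids\<close>

abbreviation positive :: "(nat \<times> bool) list \<Rightarrow> bool" where
  "positive w \<equiv> (\<forall>x\<in>set w. snd x)"

lemma braid_group_mult:
  assumes "u \<in> braid_words m" "v \<in> braid_words m"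
  shows "braid_class m u \<otimes>\<^bsub>braid_group m\<^esub> braid_class m v = braid_class m (u @ v)"
  using assms unfolding braid_group_def braid_class_def braid_words_def
  by (rule mult_presented_monoid)

lemma braid_group_one: "\<one>\<^bsub>braid_group m\<^esub> = braid_class m []"
  by (simp add: braid_group_def braid_class_def one_presented_monoid)

lemma braid_group_inv:
  assumes "w \<in> braid_words m"
  shows "inv\<^bsub>braid_group m\<^esub> (braid_class m w) = braid_class m (inv_word w)"
proof -
  interpret group "braid_group m" by (rule group_braid_group)
  have "braid_class m (inv_word w) \<otimes>\<^bsub>braid_group m\<^esub> braid_class m w = \<one>\<^bsub>braid_group m\<^esub>"
    using assms braid_eq_cancel_word'[OF assms]
    by (simp add: braid_group_mult braid_group_one braid_class_eq_iff)
  then show ?thesis using assms by (intro inv_equality) (simp_all add: braid_class_in_carrier)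
qed

lemma positive_braids_class:
  assumes "w \<in> braid_words (n + 1)" "positive w"
  shows "braid_class (n + 1) w \<in> positive_braids n"
proof -
  have "w = pos_word (map fst w)" 
    using assms(2) unfolding pos_word_def by (induction w) auto
  moreover have "map fst w \<in> lists {1..n}"
    using assms(1) by (force simp: braid_words_def)
  ultimately show ?thesis unfolding positive_braids_def by (metis image_eqI)
qed

text \<open>Makes it possible to choose new signs for a word without losing control of its
  underlying word in the simple reflections.\<close>

lemma map_fst_cong:
  assumes "map fst u = map fst v"
  shows "word_perm u = word_perm v" "end_pos u = end_pos v" "tight u = tight v"
    "u \<in> braid_words m \<longleftrightarrow> v \<in> braid_words m"
proof -
  have "word_perm u = word_perm v \<and> end_pos u = end_pos v \<and> tight u = tight v
    \<and> (u \<in> braid_words m \<longleftrightarrow> v \<in> braid_words m)"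
    using assms
  proof (induction u arbitrary: v)
    case (Cons a u)
    then obtain a' v' where "v = a' # v'" "fst a = fst a'" "map fst u = map fst v'" by (cases v) auto
    then show ?case using Cons.IH[of v'] by (cases a; cases a') (auto simp: fun_eq_iff)
  qed simp
  then show "word_perm u = word_perm v" "end_pos u = end_pos v" "tight u = tight v"
    "u \<in> braid_words m \<longleftrightarrow> v \<in> braid_words m" by auto
qed

lemma ex_layered_signs: "\<exists>v. map fst v = is \<and> layered h v"
proof (induction "is" arbitrary: h)
  case (Cons i "is")
  obtain v where v: "map fst v = is" "layered (h \<circ> transpose i (Suc i)) v"
    using Cons.IH by blast
  then show ?case by (intro exI[of _ "(i, h (Suc i) < h i) # v"]) simp
qed simp

lemma crosses_once_imp_tight: "crosses_once w \<Longrightarrow> tight w"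
proof (induction w)
  case (Cons a w)
  obtain i b where a: "a = (i, b)" by (cases a)
  note once = crosses_once_Cons[OF Cons.prems[unfolded a]]
  have "\<not> end_pos w (Suc i) < end_pos w i" using crossings_ge[of i "Suc i" w] once(2) by auto
  moreover have "end_pos w i \<noteq> end_pos w (Suc i)" by (simp add: end_pos_eq_iff)
  ultimately show ?case using Cons.IH[OF once(1)] by (simp add: a)
qed simp

text \<open>In a tight word the strands that cross are those with inverted ends. If of two such
  strands the left one is always higher, every sign that the heights demand is positive.\<close>

lemma tight_layered_iff_positive:
  assumes "tight w" "w \<in> braid_words m"
    "\<And>p q. p \<in> {1..m} \<Longrightarrow> q \<in> {1..m} \<Longrightarrow> p < q \<Longrightarrow> end_pos w q < end_pos w p \<Longrightarrow> h q < h p"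
  shows "layered h w \<longleftrightarrow> positive w"
  using assms
proof (induction w arbitrary: h)
  case (Cons a w)
  obtain i b where a: "a = (i, b)" by (cases a)
  let ?s = "transpose i (Suc i)"
  have i: "1 \<le> i" "i < m" and w: "w \<in> braid_words m" "tight w" "end_pos w i < end_pos w (Suc i)"
    using Cons.prems a by auto
  have "h (Suc i) < h i" using Cons.prems(3)[of i "Suc i"] i w(3) by (simp add: a)
  moreover have "layered (h \<circ> ?s) w \<longleftrightarrow> positive w"
  proof (rule Cons.IH[OF w(2,1)])
    fix p q assume pq: "p \<in> {1..m}" "q \<in> {1..m}" "p < q" "end_pos w q < end_pos w p"
    then have "\<not> (p = i \<and> q = Suc i)" using w(3) by auto
    then have "?s p < ?s q" using pq(3) by (auto simp: Transposition.transpose_def)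
    then show "(h \<circ> ?s) q < (h \<circ> ?s) p"
      using Cons.prems(3)[of "?s p" "?s q"] pq transpose_Suc_in[OF i] by (simp add: a del: atLeastAtMost_iff)
  qed
  ultimately show ?case by (auto simp: a)
qed simp

section \<open>Tight words and reduced expressions of permutations\<close>

lemma list_mult_simple_refl:
  "list_mult (sym_group m) (map simple_refl is) = word_perm (pos_word is)"
  by (induction "is") (simp_all add: list_mult_def pos_word_def simple_refl_def sym_group_mult sym_group_one)

lemma word_perm_permutes: "w \<in> braid_words m \<Longrightarrow> word_perm w permutes {1..m}"
proof (induction w)
  case (Cons a w)
  obtain i b where a: "a = (i, b)" by (cases a)
  then have "transpose i (Suc i) permutes {1..m}" using Cons.prems by (intro permutes_swap_id) auto
  then show ?case 
    using Cons permutes_compose[of "word_perm w" "{1..m}" "transpose i (Suc i)"] by (simp add: a o_def)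
qed (simp add: permutes_id)

lemma ex_word_perm:
  assumes "x permutes {1..m}"
  shows "\<exists>is. set is \<subseteq> {1..<m} \<and> word_perm (pos_word is) = x"
proof -
  let ?P = "\<lambda>x. \<exists>is. set is \<subseteq> {1..<m} \<and> word_perm (pos_word is) = x"
  have comp: "?P (x \<circ> y)" if "?P x" "?P y" for x y
  proof -
    from that obtain "is" js where "set is \<subseteq> {1..<m}" "word_perm (pos_word is) = x"
      "set js \<subseteq> {1..<m}" "word_perm (pos_word js) = y" by blast
    then show ?thesis
      by (intro exI[of _ "is @ js"]) (auto simp: pos_word_def word_perm_append)
  qed
  have adj: "?P (transpose i (Suc i))" if "1 \<le> i" "i < m" for i
    using that by (intro exI[of _ "[i]"]) (simp add: pos_word_def)
  have swap: "?P (transpose a (Suc (a + d)))" if "1 \<le> a" "a + d < m" for a d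
    using that
  proof (induction d)
    case 0
    then show ?case using adj by simp
  next
    case (Suc d)
    let ?b = "Suc (a + d)"
    have "?P (transpose ?b (Suc ?b) \<circ> transpose a ?b \<circ> transpose ?b (Suc ?b))"
      using Suc by (intro comp adj) auto
    also have "transpose ?b (Suc ?b) \<circ> transpose a ?b \<circ> transpose ?b (Suc ?b) = transpose a (Suc ?b)"
      by (auto simp: fun_eq_iff Transposition.transpose_def)
    finally show ?case by simp
  qed
  have swap': "?P (transpose a b)" if "a \<in> {1..m}" "b \<in> {1..m}" "a < b" for a b
    using swap[of a "b - a - 1"] that by simp
  have tr: "?P (transpose a b)" if "a \<in> {1..m}" "b \<in> {1..m}" "a \<noteq> b" for a b
    using swap'[OF that(1,2)] swap'[OF that(2,1)] that(3)
    by (metis linorder_neqE_nat transpose_commute)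
  have "finite {1..m}" by simp
  from this assms show ?thesis
  proof (induction rule: permutes_rev_induct)
    case id
    show ?case by (intro exI[of _ "[]"]) (simp add: pos_word_def)
  next
    case (swap a b p)
    then show ?case using comp[OF _ tr[of a b], of p] by auto
  qed
qed

lemma len_S_le:
  assumes "set is \<subseteq> {1..n}"
  shows "len_S n (word_perm (pos_word is)) \<le> length is"
  unfolding len_S_def word_length_def
proof (rule Least_le)
  show "\<exists>xs. set xs \<subseteq> simple_refls n \<and> length xs = length is
      \<and> list_mult (sym_group (n + 1)) xs = word_perm (pos_word is)"
    using assms by (intro exI[of _ "map simple_refl is"])
      (auto simp: list_mult_simple_refl simple_refls_def)
qed

lemma ex_reduced_expression:
  assumes "x permutes {1..n + 1}"
  shows "\<exists>is. reduced_expression n x is"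
proof -
  obtain "is" where "is": "set is \<subseteq> {1..<n + 1}" "word_perm (pos_word is) = x"
    using ex_word_perm[OF assms] by blast
  let ?P = "\<lambda>k. \<exists>xs. set xs \<subseteq> simple_refls n \<and> length xs = k \<and> list_mult (sym_group (n + 1)) xs = x"
  have "?P (length is)"
    using "is" by (intro exI[of _ "map simple_refl is"])
      (auto simp: list_mult_simple_refl simple_refls_def)
  then have "?P (len_S n x)" unfolding len_S_def word_length_def by (rule LeastI)
  then obtain xs where xs: "set xs \<subseteq> simple_refl ` {1..n}" "length xs = len_S n x"
    "list_mult (sym_group (n + 1)) xs = x" by (auto simp: simple_refls_def)
  have "xs \<in> lists (simple_refl ` {1..n})" using xs(1) by auto
  then obtain js where "js \<in> lists {1..n}" "xs = map simple_refl js"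
    unfolding lists_image by blast
  then show ?thesis using xs by (intro exI[of _ js]) (auto simp: reduced_expression_def)
qed

lemma pos_word_in: "pos_word is \<in> braid_words (n + 1) \<longleftrightarrow> set is \<subseteq> {1..n}"
  by (induction "is") (auto simp: pos_word_def)

lemma map_fst_pos_word [simp]: "map fst (pos_word is) = is"
  by (simp add: pos_word_def o_def)

lemma positive_pos_word [simp]: "positive (pos_word is)"
  by (simp add: pos_word_def)

lemma len_S_tight:
  assumes "tight v" "v \<in> braid_words (n + 1)"
  shows "len_S n (word_perm v) = length v"
proof (rule antisym)
  have "v \<in> braid_words (n + 1) \<longleftrightarrow> pos_word (map fst v) \<in> braid_words (n + 1)"
    by (rule map_fst_cong) simp
  then have "set (map fst v) \<subseteq> {1..n}" using assms(2) pos_word_in by blast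
  from len_S_le[OF this] show "len_S n (word_perm v) \<le> length v"
    using map_fst_cong(1)[of v "pos_word (map fst v)"] by simp
  obtain js where js: "reduced_expression n (word_perm v) js"
    using ex_reduced_expression word_perm_permutes[OF assms(2)] by blast
  then have "end_pos v = end_pos (pos_word js)"
    unfolding reduced_expression_def list_mult_simple_refl
    by (metis end_pos_word_perm word_perm_end_pos ext)
  moreover have "pos_word js \<in> braid_words (n + 1)"
    using js by (simp only: pos_word_in reduced_expression_def)
  ultimately have "length v \<le> length (pos_word js)"
    using assms by (intro tight_length_le)
  then show "length v \<le> len_S n (word_perm v)"
    using js by (simp add: reduced_expression_def pos_word_def)
qed

text \<open>The word is signed so as to be layered, for which any distinct heights serve, and pulled
  tight. The result has the same permutation and is tight, hence it has the length of the reduced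
  expression. So \<open>layered_shortest\<close> carries single crossings back to the original
  word.\<close>

lemma tight_reduced_expression:
  assumes "reduced_expression n x is"
  shows "tight (pos_word is)"
proof -
  let ?h = "\<lambda>p. - int p"
  have inj: "inj ?h" by (simp add: inj_def)
  obtain g where g: "map fst g = is" "layered ?h g" using ex_layered_signs by blast
  have "set is \<subseteq> {1..n}" using assms by (simp add: reduced_expression_def)
  then have gw: "g \<in> braid_words (n + 1)"
    using map_fst_cong(4)[of g "pos_word is" "n + 1"] g(1) pos_word_in by simp
  obtain v where v: "braid_eq (n + 1) g v" "tight v" "layered ?h v"
    using layered_tighten[OF gw g(2) inj] by blast
  have vw: "v \<in> braid_words (n + 1)" using braid_eq_words[OF v(1)] by simp
  have "word_perm v = word_perm (pos_word is)"
    using word_perm_cong[OF v(1)] map_fst_cong(1)[of g "pos_word is"] g(1) by simp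
  then have "length g = length v"
    using assms len_S_tight[OF v(2) vw] g(1)
    by (auto simp: reduced_expression_def list_mult_simple_refl)
  then have "crosses_once g"
    using layered_shortest(1)[OF vw crosses_once_tight[OF v(2)] v(3) braid_eq_sym[OF v(1)]] by simp
  then have "tight g" by (rule crosses_once_imp_tight)
  then show ?thesis using map_fst_cong(3)[of g "pos_word is"] g(1) by simp
qed

text \<open>The words for the positive half twist, in which any two strands cross exactly
  once.\<close>

definition half_twist_word :: "nat \<Rightarrow> (nat \<times> bool) list \<Rightarrow> bool" where
  "half_twist_word m D \<longleftrightarrow> D \<in> braid_words m \<and> tight D \<and> positive D
    \<and> (\<forall>p\<in>{1..m}. \<forall>q\<in>{1..m}. p < q \<longrightarrow> end_pos D q < end_pos D p)"

lemma half_twist_wordD: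
  assumes "half_twist_word m D"
  shows "D \<in> braid_words m" "tight D" "positive D"
    "p \<in> {1..m} \<Longrightarrow> q \<in> {1..m} \<Longrightarrow> p < q \<Longrightarrow> end_pos D q < end_pos D p"
  using assms unfolding half_twist_word_def by blast+

text \<open>If two neighbouring strands in the word of the longest element did not cross, prepending
  their crossing would give a tight word, hence a longer element. So all neighbours have inverted
  ends, and by transitivity all pairs.\<close>

lemma ex_Delta_word:
  obtains D where "half_twist_word (n + 1) D" "Delta n = braid_class (n + 1) D"
proof -
  let ?x = "longest_element n" and ?C = "carrier (sym_group (n + 1))"
  have C: "?C = {x. x permutes {1..n + 1}}" by (simp add: sym_group_def)
  have "finite ?C" unfolding C by (rule finite_permutations) simp
  moreover have "id \<in> ?C" unfolding C using permutes_id by blast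
  ultimately have "?x \<in> ?C \<and> (\<forall>y. y \<in> ?C \<longrightarrow> len_S n y \<le> len_S n ?x)"
    unfolding longest_element_def
    by (intro arg_max_nat_lemma[of _ id _ "Suc (Max (len_S n ` ?C))"]) (simp_all add: less_Suc_eq_le)
  then have x: "?x permutes {1..n + 1}" and max: "\<And>y. y permutes {1..n + 1} \<Longrightarrow> len_S n y \<le> len_S n ?x"
    unfolding C by auto
  define js where "js = (SOME is. reduced_expression n ?x is)"
  define D where "D = pos_word js"
  have red: "reduced_expression n ?x js"
    unfolding js_def using ex_reduced_expression[OF x] by (rule someI_ex)
  have D: "D \<in> braid_words (n + 1)" "tight D" "word_perm D = ?x"
    using red tight_reduced_expression[OF red] unfolding D_def pos_word_in
    by (auto simp only: reduced_expression_def list_mult_simple_refl)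
  have desc: "end_pos D (Suc i) < end_pos D i" if "i \<in> {1..n}" for i
  proof (rule ccontr)
    assume "\<not> ?thesis"
    then have "end_pos D i < end_pos D (Suc i)" 
      using end_pos_eq_iff[of D i "Suc i"] by simp
    then have "tight ((i, True) # D)" using D by simp
    moreover have w: "(i, True) # D \<in> braid_words (n + 1)" using D that by simp
    ultimately have "len_S n (word_perm ((i, True) # D)) = Suc (length D)"
      using len_S_tight[of "(i, True) # D" n] by simp
    then show False
      using max[OF word_perm_permutes[OF w]] len_S_tight[OF D(2,1)] D(3) by simp
  qed
  have "end_pos D q < end_pos D p" if "p \<in> {1..n + 1}" "q \<in> {1..n + 1}" "p < q" for p q
    using that(3,1,2)
  proof (induction rule: strict_inc_induct)
    case (base i)
    then show ?case using desc[of i] by auto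
  next
    case (step i)
    then show ?case using desc[of i] by force
  qed
  then show thesis
    using that[of D] D unfolding half_twist_word_def by (simp add: Delta_def lift_def D_def js_def)
qed

text \<open>A word \<open>u\<close> sorts the strands, so that below it the heights decrease from
  left to right. Starting there, \<open>u^-1\<close> and \<open>u^-1 w\<close> are layered for
  decreasing heights, hence positive once pulled tight to \<open>a\<close> and \<open>b\<close>; and
  \<open>w = u (u^-1 w)\<close>.\<close>

lemma layered_unfold:
  assumes w: "w \<in> braid_words m" "layered h w" "inj h"
  obtains a b where "a \<in> braid_words m" "b \<in> braid_words m" "tight a" "tight b" "positive a" "positive b"
    "braid_eq m w (inv_word a @ b)"
proof -
  \<comment> \<open>The rank of strand \<open>p\<close> by height, the highest strand having rank 1.
    Extended by the identity, this is the permutation that \<open>u\<close> has to realize: strand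
    \<open>p\<close> ends in position \<open>r p\<close>.\<close>
  define r where "r p = (if p \<in> {1..m} then card {q \<in> {1..m}. h p \<le> h q} else p)" for p
  have r_less: "r q < r p" if "p \<in> {1..m}" "q \<in> {1..m}" "h p < h q" for p q
  proof -
    have "p \<in> {p' \<in> {1..m}. h p \<le> h p'} - {p' \<in> {1..m}. h q \<le> h p'}"
      "{p' \<in> {1..m}. h q \<le> h p'} \<subseteq> {p' \<in> {1..m}. h p \<le> h p'}"
      using that by auto
    then have "{p' \<in> {1..m}. h q \<le> h p'} \<subset> {p' \<in> {1..m}. h p \<le> h p'}" by blast
    then show ?thesis using that(1,2) unfolding r_def by (simp add: psubset_card_mono)
  qed
  have "inj_on r {1..m}"
    by (intro inj_onI) (metis r_less inj_eq[OF w(3)] less_irrefl linorder_neqE)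
  moreover have "r ` {1..m} \<subseteq> {1..m}"
  proof
    fix y assume "y \<in> r ` {1..m}"
    then obtain p where p: "p \<in> {1..m}" "y = card {q \<in> {1..m}. h p \<le> h q}" by (auto simp: r_def)
    have "card {q \<in> {1..m}. h p \<le> h q} \<le> card {1..m}" by (intro card_mono) auto
    moreover have "0 < card {q \<in> {1..m}. h p \<le> h q}" using p(1) by (auto simp: card_gt_0_iff)
    ultimately show "y \<in> {1..m}" using p(2) by simp
  qed
  ultimately have "bij_betw r {1..m} {1..m}"
    by (simp add: bij_betw_def card_image card_subset_eq)
  then have rp: "r permutes {1..m}" by (rule bij_imp_permutes) (auto simp: r_def)
  obtain "is" where "is": "set is \<subseteq> {1..<m}" "word_perm (pos_word is) = inv' r"
    using ex_word_perm[OF permutes_inv[OF rp]] by blast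
  obtain u where u: "map fst u = is" "layered h u" using ex_layered_signs by blast
  have "fst ` set u \<subseteq> {1..<m}" using "is"(1) u(1) by (metis list.set_map)
  then have uw: "u \<in> braid_words m" by (induction u) auto
  have "word_perm u = inv' r" using map_fst_cong(1)[of u "pos_word is"] u(1) "is"(2) by simp
  then have eu: "r (word_perm u p) = p" for p using permutes_inverses(1)[OF rp] by simp
  let ?k = "h \<circ> word_perm u"
  have k: "?k q < ?k p" if "p \<in> {1..m}" "q \<in> {1..m}" "p < q" for p q
  proof (rule ccontr)
    assume "\<not> ?k q < ?k p"
    then have "h (word_perm u p) < h (word_perm u q)"
      using that(3) inj_eq[OF w(3)] inj_eq[OF inj_word_perm[of u]] by (metis comp_apply linorder_neqE less_irrefl)
    then have "q < p"
      using r_less[of "word_perm u p" "word_perm u q"] that(1,2) word_perm_in[OF uw]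
      unfolding eu by blast
    then show False using that(3) by simp
  qed
  have injk: "inj ?k" by (intro inj_compose w(3) inj_word_perm)
  have li: "layered ?k (inv_word u)" by (rule layered_inv_word[OF w(3) u(2)])
  have "?k \<circ> word_perm (inv_word u) = h" by (simp add: word_perm_inv_word fun_eq_iff)
  then have lb: "layered ?k (inv_word u @ w)" using li w(2) by (simp add: layered_append)
  obtain a where a: "braid_eq m (inv_word u) a" "tight a" "layered ?k a"
    using layered_tighten[OF _ li injk, of m] uw by auto
  obtain b where b: "braid_eq m (inv_word u @ w) b" "tight b" "layered ?k b"
    using layered_tighten[OF _ lb injk, of m] uw w(1) by auto
  have aw: "a \<in> braid_words m" and bw: "b \<in> braid_words m"
    using braid_eq_words[OF a(1)] braid_eq_words[OF b(1)] by auto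
  have "positive a" "positive b"
    using tight_layered_iff_positive[OF a(2) aw, of ?k] tight_layered_iff_positive[OF b(2) bw, of ?k]
      a(3) b(3) k by blast+
  moreover have "braid_eq m w (inv_word a @ b)"
  proof -
    have "braid_eq m ([] @ w) ((inv_word (inv_word u) @ inv_word u) @ w)"
      using uw w(1) by (intro braid_eq_append braid_eq_refl braid_eq_sym[OF braid_eq_cancel_word']) auto
    also have "(inv_word (inv_word u) @ inv_word u) @ w = inv_word (inv_word u) @ (inv_word u @ w)"
      by simp
    also have "braid_eq m \<dots> (inv_word a @ b)"
      by (intro braid_eq_append braid_eq_inv_word a(1) b(1))
    finally show ?thesis by simp
  qed
  ultimately show thesis using that aw bw a(2) b(2) by blast
qed

text \<open>Each strand gets as height its position in the middle, which is the bottom of both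
  \<open>D\<close> and \<open>a\<close>. Both words are layered for these heights, and at the top of
  \<open>D\<close> the heights decrease, so the tight form of the product is positive.\<close>

lemma positive_left_complement:
  assumes twist: "half_twist_word m D"
    and a: "a \<in> braid_words m" "tight a" "positive a"
  obtains v where "v \<in> braid_words m" "tight v" "positive v" "braid_eq m (D @ inv_word a) v"
proof -
  note D = half_twist_wordD[OF twist]
  let ?h = "\<lambda>p. int (end_pos D p)" and ?k = "\<lambda>p. int (end_pos a p)"
  have inj: "inj ?h" "inj ?k" using inj_end_pos by (auto simp: inj_def end_pos_eq_iff)
  have "layered ?h D" using tight_layered_iff_positive[OF D(2,1), of ?h] D(3,4) by simp
  moreover have "layered ?k a" using tight_layered_iff_positive[OF a(2,1), of ?k] a(3) by simp
  then have "layered (?k \<circ> word_perm a) (inv_word a)" by (rule layered_inv_word[OF inj(2)])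
  moreover have "?k \<circ> word_perm a = ?h \<circ> word_perm D" by auto
  ultimately have "layered ?h (D @ inv_word a)" by (simp add: layered_append)
  from layered_tighten[OF _ this inj(1), of m] obtain v
    where v: "braid_eq m (D @ inv_word a) v" "tight v" "layered ?h v" using D(1) a(1) by auto
  then have "positive v"
    using tight_layered_iff_positive[of v m ?h] D(4) braid_eq_words[OF v(1)] by simp
  then show thesis using that v braid_eq_words[OF v(1)] by blast
qed

text \<open>The middle is now the top of both \<open>a\<close> and \<open>D\<close>, and the heights
  decrease there. Since \<open>D\<close> inverts all pairs, two strands are inverted by the product
  only if they reach the middle in their initial order, and then the left one is higher.\<close>

lemma positive_right_complement:
  assumes twist: "half_twist_word m D"
    and a: "a \<in> braid_words m" "tight a" "positive a"
  obtains v where "v \<in> braid_words m" "tight v" "positive v" "braid_eq m (inv_word a @ D) v"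
proof -
  note D = half_twist_wordD[OF twist]
  let ?h = "\<lambda>p. - int p"
  have inj: "inj ?h" by (simp add: inj_def)
  have "layered ?h D" using tight_layered_iff_positive[OF D(2,1), of ?h] D(3) by simp
  have la: "layered ?h a" using tight_layered_iff_positive[OF a(2,1), of ?h] a(3) by simp
  let ?k = "?h \<circ> word_perm a"
  have injk: "inj ?k" by (intro inj_compose inj inj_word_perm)
  have "layered ?k (inv_word a)" by (rule layered_inv_word[OF inj la])
  moreover have "?k \<circ> word_perm (inv_word a) = ?h" by (simp add: word_perm_inv_word fun_eq_iff)
  ultimately have "layered ?k (inv_word a @ D)" using \<open>layered ?h D\<close> by (simp add: layered_append)
  from layered_tighten[OF _ this injk, of m] obtain v
    where v: "braid_eq m (inv_word a @ D) v" "tight v" "layered ?k v" using D(1) a(1) by auto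
  have vw: "v \<in> braid_words m" using braid_eq_words[OF v(1)] by simp
  have ev: "end_pos v p = end_pos D (word_perm a p)" for p
    using end_pos_cong[OF v(1)] by (metis end_pos_append end_pos_inv_word)
  have "?k q < ?k p" if "p \<in> {1..m}" "q \<in> {1..m}" "p < q" "end_pos v q < end_pos v p" for p q
  proof -
    have in_: "word_perm a p \<in> {1..m}" "word_perm a q \<in> {1..m}"
      using that(1,2) word_perm_in[OF a(1)] by blast+
    have "word_perm a p < word_perm a q"
    proof (rule ccontr)
      assume "\<not> ?thesis"
      then have "word_perm a q < word_perm a p"
        using that(3) inj_eq[OF inj_word_perm[of a], of p q] by linarith
      then show False using D(4)[OF in_(2,1)] that(4) by (simp add: ev)
    qed
    then show ?thesis by simp
  qed
  then have "positive v" using tight_layered_iff_positive[OF v(2) vw, of ?k] v(3) by blast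
  then show thesis using that v(1,2) vw by blast
qed

text \<open>With \<open>w = a^-1 b\<close>, the two bounds require that
  \<open>\<Delta> w = (\<Delta> a^-1) b\<close> and
  \<open>w^-1 \<Delta> = (b^-1 \<Delta>) (\<Delta>^-1 a \<Delta>)\<close> be positive.\<close>

lemma rational_permutation_braid_layered:
  assumes w: "w \<in> braid_words (n + 1)" "layered h w" "inj h"
  shows "rational_permutation_braid n (braid_class (n + 1) w)"
proof -
  let ?m = "n + 1"
  obtain D where twist: "half_twist_word ?m D" and Delta: "Delta n = braid_class ?m D"
    by (rule ex_Delta_word[of n])
  have D: "D \<in> braid_words ?m" using twist by (rule half_twist_wordD(1))
  obtain a b where ab: "a \<in> braid_words ?m" "b \<in> braid_words ?m" "tight a" "tight b" "positive a"
    "positive b" "braid_eq ?m w (inv_word a @ b)"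
    by (rule layered_unfold[OF w])
  have posI: "braid_class ?m u \<in> positive_braids n"
    if "braid_eq ?m u v" "positive v" for u v
  proof -
    have uv: "u \<in> braid_words ?m" "v \<in> braid_words ?m" using braid_eq_words[OF that(1)] by auto
    have "braid_class ?m u = braid_class ?m v" using braid_class_eq_iff[OF uv] that(1) by blast
    then show ?thesis using positive_braids_class[OF uv(2) that(2)] by metis
  qed
  obtain v1 where v1: "v1 \<in> braid_words ?m" "tight v1" "positive v1" "braid_eq ?m (D @ inv_word a) v1"
    by (rule positive_left_complement[OF twist ab(1,3,5)])
  obtain v2 where v2: "v2 \<in> braid_words ?m" "tight v2" "positive v2" "braid_eq ?m (inv_word b @ D) v2"
    by (rule positive_right_complement[OF twist ab(2,4,6)])
  text \<open>Conjugation by \<open>\<Delta>\<close> preserves positivity: \<open>\<Delta>\<inverse> \<sigma>\<^sub>i \<Delta>\<close> is the right complement of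
    the right complement of \<open>\<sigma>\<^sub>i\<close> in \<open>\<Delta>\<close>.\<close>
  have conj: "\<exists>v \<in> braid_words ?m. positive v \<and> braid_eq ?m (inv_word D @ u @ D) v"
    if "u \<in> braid_words ?m" "positive u" for u
    using that
  proof (induction u)
    case Nil
    then show ?case using braid_eq_cancel_word'[OF D] by (intro bexI[of _ "[]"]) auto
  next
    case (Cons x u)
    obtain i where x: "x = (i, True)" using Cons.prems(2) by (cases x) auto
    have i: "1 \<le> i" "i < ?m" and u: "u \<in> braid_words ?m" "positive u"
      using Cons.prems by (auto simp: x)
    obtain v where v: "v \<in> braid_words ?m" "positive v" "braid_eq ?m (inv_word D @ u @ D) v"
      using Cons.IH[OF u] by blast
    obtain z where z: "z \<in> braid_words ?m" "tight z" "positive z"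
      "braid_eq ?m (inv_word [(i, True)] @ D) z"
      by (rule positive_right_complement[OF twist, of "[(i, True)]"]) (use i in auto)
    obtain y where y: "y \<in> braid_words ?m" "tight y" "positive y" "braid_eq ?m (inv_word z @ D) y"
      by (rule positive_right_complement[OF twist z(1-3)])
    have "inv_word D @ [(i, True)] @ D = inv_word (inv_word [(i, True)] @ D) @ D" by simp
    also have "braid_eq ?m \<dots> (inv_word z @ D)"
      by (intro braid_eq_append[OF braid_eq_inv_word[OF z(4)] braid_eq_refl] D)
    also note y(4)
    finally have y': "braid_eq ?m (inv_word D @ [(i, True)] @ D) y" .
    have "braid_eq ?m (inv_word D @ ([(i, True)] @ [] @ u) @ D)
        (inv_word D @ ([(i, True)] @ (D @ inv_word D) @ u) @ D)"
      using D i u(1)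
      by (intro braid_eq_append braid_eq_refl braid_eq_sym[OF braid_eq_cancel_word]) auto
    also have "inv_word D @ ([(i, True)] @ (D @ inv_word D) @ u) @ D
        = (inv_word D @ [(i, True)] @ D) @ (inv_word D @ u @ D)" by simp
    also have "braid_eq ?m \<dots> (y @ v)" by (intro braid_eq_append y' v(3))
    finally show ?case using y v by (intro bexI[of _ "y @ v"]) (auto simp: x)
  qed
  obtain v3 where v3: "v3 \<in> braid_words ?m" "positive v3" "braid_eq ?m (inv_word D @ a @ D) v3"
    using conj[OF ab(1,5)] by blast
  have "braid_eq ?m (D @ w) (v1 @ b)"
  proof -
    have "braid_eq ?m (D @ w) (D @ (inv_word a @ b))"
      by (intro braid_eq_append[OF braid_eq_refl ab(7)] D)
    also have "D @ (inv_word a @ b) = (D @ inv_word a) @ b" by simp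
    also have "braid_eq ?m \<dots> (v1 @ b)" by (intro braid_eq_append[OF v1(4) braid_eq_refl] ab(2))
    finally show ?thesis .
  qed
  moreover have "braid_eq ?m (inv_word w @ D) (v2 @ v3)"
  proof -
    have "braid_eq ?m (inv_word w @ D) (inv_word (inv_word a @ b) @ D)"
      by (intro braid_eq_append[OF braid_eq_inv_word[OF ab(7)] braid_eq_refl] D)
    also have "inv_word (inv_word a @ b) @ D = inv_word b @ inv_word (inv_word a) @ D" by simp
    also have "\<dots> = inv_word b @ [] @ a @ D" unfolding inv_word_inv_word by simp
    also have "braid_eq ?m \<dots> (inv_word b @ (D @ inv_word D) @ a @ D)"
      using D ab by (intro braid_eq_append braid_eq_refl braid_eq_sym[OF braid_eq_cancel_word]) auto
    also have "inv_word b @ (D @ inv_word D) @ a @ D = (inv_word b @ D) @ (inv_word D @ a @ D)"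
      by simp
    also have "braid_eq ?m \<dots> (v2 @ v3)" by (intro braid_eq_append v2(4) v3(3))
    finally show ?thesis .
  qed
  moreover have "positive (v1 @ b)" "positive (v2 @ v3)" using v1(3) ab(6) v2(3) v3(2) by auto
  ultimately have "braid_class ?m (D @ w) \<in> positive_braids n"
    "braid_class ?m (inv_word w @ D) \<in> positive_braids n"
    using posI by blast+
  moreover interpret group "braid_group ?m" by (rule group_braid_group)
  have "inv\<^bsub>braid_group ?m\<^esub> (inv\<^bsub>braid_group ?m\<^esub> (Delta n)) = braid_class ?m D"
    unfolding Delta by (rule inv_inv[OF braid_class_in_carrier[OF D]])
  ultimately show ?thesis
    using w(1) D Delta
    by (simp add: rational_permutation_braid_def braid_le_def braid_group_mult braid_group_inv
        braid_class_in_carrier)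
qed

section \<open>Products of transpositions and cycles on a circle\<close>

fun trans_prod :: "(nat \<times> nat) list \<Rightarrow> nat \<Rightarrow> nat" where
  "trans_prod [] = id"
| "trans_prod ((a, b) # ts) = transpose a b \<circ> trans_prod ts"

definition transps_on :: "nat set \<Rightarrow> (nat \<times> nat) list \<Rightarrow> bool" where
  "transps_on P ts \<longleftrightarrow> (\<forall>(a, b)\<in>set ts. a \<in> P \<and> b \<in> P \<and> a \<noteq> b)"

lemma transps_on_simps [simp]:
  "transps_on P []"
  "transps_on P ((a, b) # ts) \<longleftrightarrow> a \<in> P \<and> b \<in> P \<and> a \<noteq> b \<and> transps_on P ts"
  "transps_on P (ts @ us) \<longleftrightarrow> transps_on P ts \<and> transps_on P us"
  by (auto simp: transps_on_def)

lemma trans_prod_append: "trans_prod (ts @ us) = trans_prod ts \<circ> trans_prod us"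
  by (induction ts rule: trans_prod.induct) (simp_all add: comp_assoc)

lemma bij_trans_prod: "bij (trans_prod ts)"
proof (induction ts rule: trans_prod.induct)
  case (2 a b ts)
  then show ?case unfolding trans_prod.simps by (intro bij_comp) auto
qed (simp add: id_def[symmetric])

lemma trans_prod_permutes: "transps_on P ts \<Longrightarrow> trans_prod ts permutes P"
proof (induction ts rule: trans_prod.induct)
  case (2 a b ts)
  then show ?case unfolding trans_prod.simps by (intro permutes_compose permutes_swap_id) auto
qed (simp add: permutes_id)

lemma comp_transpose: "bij f \<Longrightarrow> f \<circ> transpose a b = transpose (f a) (f b) \<circ> f"
  by (simp add: transpose_comp_eq bij_is_inj)

lemma transps_on_mono: "transps_on P ts \<Longrightarrow> P \<subseteq> Q \<Longrightarrow> transps_on Q ts"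
  by (auto simp: transps_on_def)

text \<open>The points \<open>1, \<dots>, m\<close> lie on a circle, ordered from left to right, the point \<open>1\<close> being the
  leftmost one; \<open>low\<close> tells which of them lie on the lower half. They are listed counterclockwise.\<close>

definition circle_list :: "nat \<Rightarrow> (nat \<Rightarrow> bool) \<Rightarrow> nat set \<Rightarrow> nat list" where
  "circle_list m low P = filter low (filter (\<lambda>i. i \<in> P) [1..<Suc m])
    @ rev (filter (\<lambda>i. \<not> low i) (filter (\<lambda>i. i \<in> P) [1..<Suc m]))"

definition circle_cycle :: "nat \<Rightarrow> (nat \<Rightarrow> bool) \<Rightarrow> nat set \<Rightarrow> nat \<Rightarrow> nat" where
  "circle_cycle m low P = cycle_of_list (circle_list m low P)"

lemma set_circle_list: "set (circle_list m low P) = P \<inter> {1..m}"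
  by (auto simp: circle_list_def)

lemma distinct_circle_list: "distinct (circle_list m low P)"
  by (auto simp: circle_list_def)

lemma circle_list_remove: "circle_list m low (P - {p}) = filter (\<lambda>i. i \<noteq> p) (circle_list m low P)"
  by (simp add: circle_list_def rev_filter filter_filter conj_ac)

lemma cycle_of_list_rotate:
  "distinct (as @ bs) \<Longrightarrow> cycle_of_list (as @ bs) = cycle_of_list (bs @ as)"
  using cycle_of_list_rotate_independent[of "as @ bs" "length as"] by (simp add: rotate_append)

lemma cycle_of_list_snoc: "cycle_of_list (l @ [x, y]) = cycle_of_list (l @ [x]) \<circ> transpose x y"
proof (induction l)
  case (Cons a l)
  then show ?case by (cases l) (simp_all add: comp_assoc)
qed simp

text \<open>The second assumption makes \<open>q\<close> the cyclic successor of \<open>p\<close>.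
  Once the list is rotated to begin with \<open>p\<close>, the equation is the recursion of
  \<open>cycle_of_list\<close>.\<close>

lemma circle_cycle_remove:
  assumes "circle_list m low P = as @ p # bs" "bs @ as = q # cs"
  shows "circle_cycle m low P = transpose p q \<circ> circle_cycle m low (P - {p})"
proof -
  have d: "distinct (as @ p # bs)" using distinct_circle_list assms(1) by metis
  then have "circle_list m low (P - {p}) = as @ bs"
    unfolding circle_list_remove assms(1)
    by (simp, intro arg_cong2[of _ _ _ _ append] filter_True) auto
  then have "circle_cycle m low (P - {p}) = cycle_of_list (q # cs)"
    using d cycle_of_list_rotate[of as bs] assms(2) by (simp add: circle_cycle_def)
  moreover have "circle_cycle m low P = cycle_of_list (p # q # cs)"
    using d cycle_of_list_rotate[of as "p # bs"] assms by (simp add: circle_cycle_def)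
  ultimately show ?thesis by simp
qed

lemma circle_cycle_permutes: "circle_cycle m low P permutes (P \<inter> {1..m})"
  unfolding circle_cycle_def by (metis cycle_permutes set_circle_list)

lemma ex_circle_cycle_remove:
  assumes "P \<subseteq> {1..m}" "p \<in> P" "P \<noteq> {p}"
  shows "\<exists>q\<in>P. q \<noteq> p \<and> circle_cycle m low P = transpose p q \<circ> circle_cycle m low (P - {p})"
proof -
  have set: "set (circle_list m low P) = P" using assms(1) by (auto simp: set_circle_list)
  then obtain as bs where l: "circle_list m low P = as @ p # bs" using assms(2) by (metis split_list)
  have "bs @ as \<noteq> []" using l set assms(3) by auto
  then obtain q cs where q: "bs @ as = q # cs" by (cases "bs @ as") auto
  have "q \<in> set (bs @ as)" using q by simp
  moreover have "distinct (as @ p # bs)" using distinct_circle_list l by metis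
  ultimately have "q \<in> P" "q \<noteq> p" using l set by auto
  then show ?thesis using circle_cycle_remove[OF l q] by blast
qed

text \<open>Serves to complete a factorization of the cycle of \<open>P\<close> to one of the cycle
  of \<open>Q\<close> with the right number of factors; the points of \<open>Q - P\<close> are
  removed one at a time.\<close>

lemma circle_cycle_extend:
  assumes "P \<subseteq> Q" "Q \<subseteq> {1..m}" "P \<noteq> {}"
  shows "\<exists>rs. transps_on {1..m} rs \<and> length rs = card Q - card P
    \<and> circle_cycle m low Q = trans_prod rs \<circ> circle_cycle m low P"
  using assms
proof (induction "card (Q - P)" arbitrary: Q)
  case 0
  have "finite Q" using 0 finite_subset by blast
  then have "Q = P" using 0 by auto
  then show ?case by (intro exI[of _ "[]"]) simp
next
  case (Suc k)
  have fin: "finite Q" "finite P" using Suc.prems finite_subset[of _ "{1..m}"] by auto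
  have "card (Q - P) \<noteq> 0" using Suc(2) by simp
  then have "Q - P \<noteq> {}" by (intro notI) simp
  then obtain p where p: "p \<in> Q - P" by blast
  have "Q \<noteq> {p}" using p Suc.prems by auto
  then obtain q where q: "q \<in> Q" "q \<noteq> p"
    "circle_cycle m low Q = transpose p q \<circ> circle_cycle m low (Q - {p})"
    using ex_circle_cycle_remove[of Q m p low] p Suc.prems by blast
  have "Q - {p} - P = (Q - P) - {p}" by auto
  then have "k = card (Q - {p} - P)" using Suc(2) p fin by simp
  then obtain rs where rs: "transps_on {1..m} rs" "length rs = card (Q - {p}) - card P"
    "circle_cycle m low (Q - {p}) = trans_prod rs \<circ> circle_cycle m low P"
    using Suc(1)[of "Q - {p}"] p Suc.prems by blast
  have "card P \<le> card (Q - {p})" using p Suc.prems fin by (intro card_mono) auto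
  moreover have "card Q = Suc (card (Q - {p}))" using p fin by (auto dest: card.remove)
  ultimately have "length ((p, q) # rs) = card Q - card P" using rs(2) by simp
  moreover have "transps_on {1..m} ((p, q) # rs)" using rs(1) q(1,2) p Suc.prems by auto
  moreover have "circle_cycle m low Q = trans_prod ((p, q) # rs) \<circ> circle_cycle m low P"
    unfolding q(3) rs(3) trans_prod.simps comp_assoc ..
  ultimately show ?case by blast
qed

text \<open>If \<open>q\<close> follows \<open>p \<noteq> 1\<close> on the circle through \<open>P\<close>, then the chord \<open>p q\<close> cuts off no point, so that
  all points of \<open>P\<close> between \<open>p\<close> and \<open>q\<close> lie on the same side of it.\<close>

definition circle_next :: "(nat \<Rightarrow> bool) \<Rightarrow> nat set \<Rightarrow> nat \<Rightarrow> nat \<Rightarrow> bool" where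
  "circle_next low P p q \<longleftrightarrow>
    q < p \<and> \<not> low q \<and> (\<forall>i\<in>P. q < i \<and> i < p \<longrightarrow> low i) \<and> (low p \<longrightarrow> (\<forall>i\<in>P. i \<le> p))
  \<or> p < q \<and> low p \<and> (\<forall>i\<in>P. p < i \<and> i < q \<longrightarrow> \<not> low i) \<and> (\<not> low q \<longrightarrow> (\<forall>i\<in>P. i \<le> q))"

lemma ex_circle_next:
  assumes "P \<subseteq> {1..m}" "1 \<in> P" "\<not> low 1" "p \<in> P" "p \<noteq> 1"
  shows "\<exists>q\<in>P. q \<noteq> p \<and> circle_next low P p q
    \<and> circle_cycle m low P = transpose p q \<circ> circle_cycle m low (P - {p})"
proof -
  let ?l = "circle_list m low P"
  let ?R = "\<lambda>a b. low a \<and> \<not> low b \<or> low a \<and> low b \<and> a < b \<or> \<not> low a \<and> \<not> low b \<and> b < a"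
  have set: "set ?l = P" using assms(1) by (auto simp: set_circle_list)
  have sorted: "sorted_wrt ?R ?l"
  proof -
    let ?u = "filter (\<lambda>i. i \<in> P) [1..<Suc m]"
    have s: "sorted_wrt (<) ?u" by (intro sorted_wrt_filter sorted_wrt_upt)
    have "sorted_wrt ?R (filter low ?u)"
      using sorted_wrt_filter[OF s, of low] by (rule sorted_wrt_mono_rel[rotated]) auto
    moreover have "sorted_wrt (\<lambda>a b. ?R b a) (filter (\<lambda>i. \<not> low i) ?u)"
      using sorted_wrt_filter[OF s, of "\<lambda>i. \<not> low i"] by (rule sorted_wrt_mono_rel[rotated]) auto
    ultimately show ?thesis
      unfolding circle_list_def by (simp add: sorted_wrt_append sorted_wrt_rev)
  qed
  obtain as bs where l: "?l = as @ p # bs" using assms(4) set by (metis split_list)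
  have "1 \<in> set as \<or> 1 \<in> set bs" using l set assms(2,5) by auto
  \<comment> \<open>The leftmost point is an upper one, so it closes the list. Every other point
    thus has its cyclic successor inside the list, without wrapping around.\<close>
  moreover have "1 \<notin> set as"
  proof
    assume "1 \<in> set as"
    then have "?R 1 p" using sorted l by (auto simp: sorted_wrt_append)
    then show False using assms(1,3,4) by force
  qed
  ultimately obtain q cs where bs: "bs = q # cs" by (cases bs) auto
  have qP: "q \<in> P" using l bs set by auto
  have Rpq: "?R p q" using sorted l bs by (auto simp: sorted_wrt_append)
  then have "q \<noteq> p" by auto
  have other: "r = p \<or> r = q \<or> ?R r p \<or> ?R q r" if "r \<in> P" for r
  proof -
    have "r \<in> set as \<or> r = p \<or> r = q \<or> r \<in> set cs" using that set l bs by auto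
    then show ?thesis using sorted l bs by (auto simp: sorted_wrt_append)
  qed
  have "circle_next low P p q"
  proof (cases "q < p")
    case True
    then have nl: "\<not> low q" using Rpq by auto
    moreover have "low i" if "i \<in> P" "q < i" "i < p" for i
      using other[OF that(1)] that Rpq nl by auto
    moreover have "i \<le> p" if "i \<in> P" "low p" for i
      using other[OF that(1)] that Rpq nl True by auto
    ultimately show ?thesis using True by (simp add: circle_next_def)
  next
    case False
    then have lt: "p < q" using \<open>q \<noteq> p\<close> by simp
    then have lp: "low p" using Rpq by auto
    moreover have "\<not> low i" if "i \<in> P" "p < i" "i < q" for i
      using other[OF that(1)] that Rpq lp by auto
    moreover have "i \<le> q" if "i \<in> P" "\<not> low q" for i
      using other[OF that(1)] that Rpq lp lt by auto
    ultimately show ?thesis using lt by (simp add: circle_next_def)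
  qed
  moreover have "circle_cycle m low P = transpose p q \<circ> circle_cycle m low (P - {p})"
    using circle_cycle_remove[OF l] bs by simp
  ultimately show ?thesis using qP \<open>q \<noteq> p\<close> by blast
qed

lemma circle_cycle_moves:
  assumes "P \<subseteq> {1..m}" "2 \<le> card P" "p \<in> P"
  shows "circle_cycle m low P p \<noteq> p"
proof -
  have "P \<noteq> {p}" using assms(2) by auto
  then obtain q where q: "q \<in> P" "q \<noteq> p"
    "circle_cycle m low P = transpose p q \<circ> circle_cycle m low (P - {p})"
    using ex_circle_cycle_remove[OF assms(1,3), of low] by blast
  have "circle_cycle m low (P - {p}) p = p"
    using circle_cycle_permutes[of m low "P - {p}"] by (rule permutes_not_in) simp
  then show ?thesis using q by simp
qed

section \<open>Leaves of the graph of a factorization\<close>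

definition trans_degree :: "nat \<Rightarrow> (nat \<times> nat) list \<Rightarrow> nat" where
  "trans_degree p ts = length (filter (\<lambda>(a, b). a = p \<or> b = p) ts)"

lemma sum_trans_degree:
  "finite P \<Longrightarrow> transps_on P ts \<Longrightarrow> (\<Sum>p\<in>P. trans_degree p ts) = 2 * length ts"
proof (induction ts)
  case (Cons t ts)
  obtain a b where t: "t = (a, b)" by (cases t)
  have ab: "a \<in> P" "b \<in> P" "a \<noteq> b" and ts: "transps_on P ts" using Cons.prems t by auto
  have "trans_degree p (t # ts) = (if p = a then 1 else 0) + (if p = b then 1 else 0) + trans_degree p ts"
    for p using ab(3) by (auto simp: t trans_degree_def)
  then have "(\<Sum>p\<in>P. trans_degree p (t # ts))
      = (\<Sum>p\<in>P. if p = a then 1 else 0) + (\<Sum>p\<in>P. if p = b then 1 else 0) + (\<Sum>p\<in>P. trans_degree p ts)"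
    by (simp add: sum.distrib)
  then show ?case using Cons.IH[OF Cons.prems(1) ts] ab Cons.prems(1) by (simp add: sum.delta)
qed (simp add: trans_degree_def)

lemma trans_prod_fix: "trans_degree p ts = 0 \<Longrightarrow> trans_prod ts p = p"
proof (induction ts)
  case (Cons t ts)
  then show ?case by (cases t) (auto simp: trans_degree_def split: if_splits)
qed simp

lemma transps_on_remove: "trans_degree p ts = 0 \<Longrightarrow> transps_on P ts \<Longrightarrow> transps_on (P - {p}) ts"
  by (induction ts) (auto simp: trans_degree_def split: if_splits)

lemma trans_degree_one_split:
  assumes "trans_degree p ts = 1" "transps_on P ts"
  obtains us z vs where "ts = us @ (p, z) # vs \<or> ts = us @ (z, p) # vs"
    "trans_degree p us = 0" "trans_degree p vs = 0" "z \<in> P" "z \<noteq> p"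
    "transps_on (P - {p}) us" "transps_on (P - {p}) vs"
proof -
  let ?Q = "\<lambda>(a, b). a = p \<or> b = p"
  have "\<exists>t\<in>set ts. ?Q t"
  proof (rule ccontr)
    assume "\<not> ?thesis"
    then have "filter ?Q ts = []" by (simp add: filter_empty_conv)
    then show False using assms(1) by (simp add: trans_degree_def)
  qed
  then obtain us t vs where s: "ts = us @ t # vs" "?Q t" "\<forall>u\<in>set us. \<not> ?Q u"
    using split_list_first_prop[of ts ?Q] by blast
  then have d: "trans_degree p us = 0" "trans_degree p vs = 0"
    using assms(1) by (auto simp: trans_degree_def filter_empty_conv)
  obtain a b where t: "t = (a, b)" by (cases t)
  have on: "transps_on P us" "transps_on P vs" "a \<in> P" "b \<in> P" "a \<noteq> b"
    using assms(2) s(1) t by auto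
  show thesis
  proof (cases "a = p")
    case True
    then show thesis using that[of us b vs] s t d transps_on_remove on by auto
  next
    case False
    then have "b = p" using s(2) t by auto
    then show thesis using that[of us a vs] s t d transps_on_remove on by auto
  qed
qed

text \<open>The graph of a factorization of a cycle into few transpositions has a leaf \<open>p\<close>: the \<open>|P| - 1\<close>
  edges have \<open>2 |P| - 2\<close> ends. The transposition of that leaf can be moved to one end of the
  factorization.\<close>

lemma leaf_removal:
  assumes P: "P \<subseteq> {1..m}" "1 \<in> P" "2 \<le> card P" "\<not> low 1"
    and on: "transps_on P (ts @ us)" and len: "length (ts @ us) \<le> card P - 1"
    and prod: "trans_prod (ts @ us) = circle_cycle m low P"
  obtains p q where "p \<in> P" "p \<noteq> 1" "q \<in> P" "q \<noteq> p" "circle_next low P p q"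
    "(\<exists>ts'. length ts = Suc (length ts') \<and> transps_on (P - {p}) (ts' @ us)
        \<and> trans_prod ts = transpose p q \<circ> trans_prod ts'
        \<and> trans_prod (ts' @ us) = circle_cycle m low (P - {p}))
     \<or> (\<exists>us'. length us = Suc (length us') \<and> transps_on (P - {p}) (ts @ us')
        \<and> trans_prod (ts @ us') = circle_cycle m low (P - {p}))"
proof -
  have fin: "finite P" using P(1) finite_subset by blast
  have deg: "1 \<le> trans_degree p (ts @ us)" if "p \<in> P" for p
    using trans_prod_fix[of p "ts @ us"] circle_cycle_moves[OF P(1,3) that, of low] prod by fastforce
  \<comment> \<open>Otherwise the degrees would sum to at least \<open>2 (|P| - 1) + 1\<close>, more
    than twice the number of edges. The leaf has to differ from \<open>1\<close> for
    \<open>ex_circle_next\<close> to apply.\<close>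
  have "\<exists>p\<in>P - {1}. trans_degree p (ts @ us) \<le> 1"
  proof (rule ccontr)
    assume "\<not> ?thesis"
    then have "(\<Sum>p\<in>P - {1}. 2) \<le> (\<Sum>p\<in>P - {1}. trans_degree p (ts @ us))"
      by (intro sum_mono) (auto simp: not_le Suc_le_eq numeral_2_eq_2)
    moreover have "(\<Sum>p\<in>P. trans_degree p (ts @ us))
        = trans_degree 1 (ts @ us) + (\<Sum>p\<in>P - {1}. trans_degree p (ts @ us))"
      using fin P(2) by (rule sum.remove)
    ultimately have "2 * (card P - 1) + 1 \<le> 2 * length (ts @ us)"
      using deg[OF P(2)] sum_trans_degree[OF fin on] fin P(2) by (simp add: card_Diff_singleton)
    then show False using len by linarith
  qed
  then obtain p where p: "p \<in> P" "p \<noteq> 1" "trans_degree p (ts @ us) = 1"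
    using deg by (metis DiffD1 DiffD2 insertI1 le_antisym)
  obtain q where q: "q \<in> P" "q \<noteq> p" "circle_next low P p q"
    "circle_cycle m low P = transpose p q \<circ> circle_cycle m low (P - {p})"
    using ex_circle_next[OF P(1,2), of low p] P(4) p(1,2) by blast
  let ?c = "circle_cycle m low (P - {p})"
  have cp: "?c p = p"
    using circle_cycle_permutes[of m low "P - {p}"] by (rule permutes_not_in) simp
  have sum: "trans_degree p ts + trans_degree p us = 1" using p(3) by (simp add: trans_degree_def)
  show thesis
  proof (cases "trans_degree p us = 0")
    case True
    then have "trans_degree p ts = 1" using sum by simp
    then obtain as z bs where s: "ts = as @ (p, z) # bs \<or> ts = as @ (z, p) # bs"
      "trans_degree p as = 0" "trans_degree p bs = 0" "z \<in> P" "z \<noteq> p"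
      "transps_on (P - {p}) as" "transps_on (P - {p}) bs"
      by (rule trans_degree_one_split[of p ts P]) (use on in simp)
    have "trans_prod ts = trans_prod as \<circ> transpose p z \<circ> trans_prod bs"
      using s(1) by (auto simp: trans_prod_append comp_assoc transpose_commute[of z p])
    also have "trans_prod as \<circ> transpose p z = transpose p (trans_prod as z) \<circ> trans_prod as"
      using comp_transpose[OF bij_trans_prod, of as p z] trans_prod_fix[OF s(2)] by simp
    finally have ts: "trans_prod ts = transpose p (trans_prod as z) \<circ> trans_prod (as @ bs)"
      unfolding trans_prod_append comp_assoc .
    have eq: "transpose p (trans_prod as z) \<circ> trans_prod (as @ bs @ us) = transpose p q \<circ> ?c"
      using prod q(4) unfolding trans_prod_append ts comp_assoc by (simp only:)
    have "trans_prod (as @ bs @ us) p = p"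
      using s(2,3) True by (intro trans_prod_fix) (simp add: trans_degree_def)
    \<comment> \<open>Both sides of \<open>eq\<close> are a transposition that moves
      \<open>p\<close> after a permutation that fixes \<open>p\<close>, so their values at
      \<open>p\<close> identify the two transpositions.\<close>
    then have "trans_prod as z = q"
      using fun_cong[OF eq, of p] cp by simp
    moreover from this have "transpose p q (trans_prod ((as @ bs) @ us) x) = transpose p q (?c x)" for x
      using eq unfolding append_assoc by (metis comp_apply)
    then have "trans_prod ((as @ bs) @ us) = ?c" by (intro ext) (rule transpose_eq_imp_eq)
    moreover have "length ts = Suc (length (as @ bs))" using s(1) by auto
    moreover have "transps_on (P - {p}) ((as @ bs) @ us)" using s(6,7) transps_on_remove[OF True] on by simp
    ultimately have "length ts = Suc (length (as @ bs)) \<and> transps_on (P - {p}) ((as @ bs) @ us)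
        \<and> trans_prod ts = transpose p q \<circ> trans_prod (as @ bs)
        \<and> trans_prod ((as @ bs) @ us) = ?c"
      using ts by blast
    then show thesis by (intro that[OF p(1,2) q(1-3)] disjI1) (rule exI)
  next
    case False
    then have t0: "trans_degree p ts = 0" using sum by auto
    with sum have "trans_degree p us = 1" by simp
    then obtain as z bs where s: "us = as @ (p, z) # bs \<or> us = as @ (z, p) # bs"
      "trans_degree p as = 0" "trans_degree p bs = 0" "z \<in> P" "z \<noteq> p"
      "transps_on (P - {p}) as" "transps_on (P - {p}) bs"
      by (rule trans_degree_one_split[of p us P]) (use on in simp)
    \<comment> \<open>Moved over \<open>bs\<close> to the right end, the transposition of the leaf
      becomes \<open>(p ?y)\<close>. Moved from there to the left over all of \<open>?f\<close>, it
      must be \<open>(p q)\<close>, which then cancels.\<close>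
    let ?y = "inv' (trans_prod bs) z" and ?f = "trans_prod (ts @ as @ bs)"
    have bp: "inv' (trans_prod bs) p = p"
      using trans_prod_fix[OF s(3)] bij_trans_prod by (metis bij_inv_eq_iff)
    have "trans_prod (ts @ us) = trans_prod ts \<circ> trans_prod as \<circ> (transpose p z \<circ> trans_prod bs)"
      using s(1) by (auto simp: trans_prod_append comp_assoc transpose_commute[of z p])
    also have "transpose p z \<circ> trans_prod bs = trans_prod bs \<circ> transpose p ?y"
      using transpose_comp_eq[OF bij_trans_prod, of p z bs] bp by simp
    finally have "trans_prod (ts @ us) = ?f \<circ> transpose p ?y"
      unfolding trans_prod_append comp_assoc .
    then have eq: "?f \<circ> transpose p ?y = transpose p q \<circ> ?c" using prod q(4) by (simp only:)
    have fp: "?f p = p"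
      using s(2,3) t0 by (intro trans_prod_fix) (simp add: trans_degree_def)
    have "?f ?y = q" using fun_cong[OF eq, of p] cp by simp
    have "?f \<circ> transpose p ?y = transpose p q \<circ> ?f"
      using comp_transpose[OF bij_trans_prod, of "ts @ as @ bs" p ?y]
      unfolding fp \<open>?f ?y = q\<close> .
    then have "transpose p q (?f x) = transpose p q (?c x)" for x
      using eq by (metis comp_apply)
    then have "?f = ?c" by (intro ext) (rule transpose_eq_imp_eq)
    moreover have "length us = Suc (length (as @ bs))" using s(1) by auto
    moreover have "transps_on (P - {p}) (ts @ as @ bs)" using s(6,7) transps_on_remove[OF t0] on by simp
    ultimately have "length us = Suc (length (as @ bs)) \<and> transps_on (P - {p}) (ts @ as @ bs)
        \<and> trans_prod (ts @ as @ bs) = ?c"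
      by blast
    then show thesis by (intro that[OF p(1,2) q(1-3)] disjI2) (rule exI)
  qed
qed

text \<open>A shorter factorization would still have a leaf, and removing it would leave a
  factorization on fewer points that is again too short.\<close>

lemma circle_cycle_length:
  assumes "P \<subseteq> {1..m}" "1 \<in> P" "\<not> low 1" "transps_on P ts" "trans_prod ts = circle_cycle m low P"
  shows "card P - 1 \<le> length ts"
  using assms
proof (induction "card P" arbitrary: P ts rule: less_induct)
  case less
  show ?case
  proof (rule ccontr)
    assume lt: "\<not> ?thesis"
    obtain p q where p: "p \<in> P" "p \<noteq> 1" "q \<in> P" "q \<noteq> p" "circle_next low P p q"
      "(\<exists>ts'. length ts = Suc (length ts') \<and> transps_on (P - {p}) (ts' @ [])
        \<and> trans_prod ts = transpose p q \<circ> trans_prod ts'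
        \<and> trans_prod (ts' @ []) = circle_cycle m low (P - {p}))
       \<or> (\<exists>us'. length ([] :: (nat \<times> nat) list) = Suc (length us') \<and> transps_on (P - {p}) (ts @ us')
        \<and> trans_prod (ts @ us') = circle_cycle m low (P - {p}))"
      by (rule leaf_removal[of P m low ts "[]"]) (use less.prems lt in simp_all)
    then obtain ts' where ts': "length ts = Suc (length ts')" "transps_on (P - {p}) ts'"
      "trans_prod ts' = circle_cycle m low (P - {p})"
      by (metis append_Nil2 list.size(3) nat.distinct(1))
    have fin: "finite P" using less.prems(1) finite_subset by blast
    then have c: "card P = Suc (card (P - {p}))" using p(1) by (metis card.remove)
    have "card (P - {p}) - 1 \<le> length ts'"
    proof (rule less.hyps)
      show "P - {p} \<subseteq> {1..m}" "1 \<in> P - {p}" using less.prems(1,2) p(2) by auto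
    qed (use c ts' less.prems(3) in simp_all)
    then show False using lt ts'(1) c by simp
  qed
qed

section \<open>Standard Coxeter elements and their divisors\<close>

text \<open>The rightmost point sits where the lower half meets the upper one, so for either half it
  comes after the other lower points and before the other upper points.\<close>

lemma circle_list_last:
  "circle_list (Suc k) low {1..Suc k}
    = filter low [1..<Suc k] @ [Suc k] @ rev (filter (\<lambda>i. \<not> low i) [1..<Suc k])"
proof -
  have "filter (\<lambda>i. i \<in> {1..Suc k}) [1..<Suc (Suc k)] = [1..<Suc (Suc k)]"
    by (intro filter_True) auto
  moreover have "[1..<Suc (Suc k)] = [1..<Suc k] @ [Suc k]" by simp
  ultimately show ?thesis unfolding circle_list_def by (simp del: upt_Suc)
qed

lemma word_perm_fix: "(\<And>i. i \<in> set is \<Longrightarrow> p \<noteq> i \<and> p \<noteq> Suc i) \<Longrightarrow> word_perm (pos_word is) p = p"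
  by (induction "is") (auto simp: pos_word_def)

lemma bij_word_perm: "bij (word_perm w)"
  by (rule bijI[OF inj_word_perm]) (metis surjI word_perm_end_pos)

lemma word_perm_commute:
  assumes "\<And>i. i \<in> set is \<Longrightarrow> Suc i < k"
  shows "word_perm (pos_word is) \<circ> transpose k (Suc k) = transpose k (Suc k) \<circ> word_perm (pos_word is)"
proof -
  have "word_perm (pos_word is) k = k" "word_perm (pos_word is) (Suc k) = Suc k"
    using assms by (fastforce intro!: word_perm_fix)+
  then show ?thesis using comp_transpose[OF bij_word_perm[of "pos_word is"], of k "Suc k"] by simp
qed

text \<open>The point \<open>i + 1\<close> lies on the lower half of the circle if \<open>s\<^sub>i\<close> comes before
  \<open>s\<^sub>i\<^sub>+\<^sub>1\<close> in the word, and on the upper half otherwise.\<close>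

lemma coxeter_word_circle:
  assumes "distinct is" "set is = {1..n}"
  shows "\<exists>low. \<not> low 1 \<and> word_perm (pos_word is) = circle_cycle (Suc n) low {1..Suc n}"
  using assms
proof (induction n arbitrary: "is")
  case 0
  then show ?case
    by (intro exI[of _ "\<lambda>_. False"]) (simp add: pos_word_def circle_cycle_def circle_list_def)
next
  case (Suc n)
  let ?k = "Suc n"
  have "?k \<in> set is" using Suc.prems by simp
  then obtain as bs where s: "is = as @ ?k # bs" by (metis split_list)
  have ab: "distinct (as @ bs)" "set (as @ bs) = {1..n}"
  proof -
    have "set (as @ bs) = set is - {?k}" using Suc.prems(1) s by auto
    also have "\<dots> = {1..n}" unfolding Suc.prems(2) by auto
    finally show "set (as @ bs) = {1..n}" .
  qed (use Suc.prems(1) s in simp)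
  obtain low' where low': "\<not> low' 1" "word_perm (pos_word (as @ bs)) = circle_cycle ?k low' {1..?k}"
    using Suc.IH[OF ab] by blast
  \<comment> \<open>As rightmost point of the smaller circle, \<open>?k\<close> had the same place
    for either half, so \<open>low\<close> can still be set there. For \<open>n = 0\<close> the
    condition is false, and the point \<open>1\<close> becomes upper.\<close>
  let ?b = "n \<in> set as"
  define low where "low = low'(?k := ?b)"
  let ?D = "filter low' [1..<?k]" and ?U = "filter (\<lambda>i. \<not> low' i) [1..<?k]"
  have old: "circle_list ?k low' {1..?k} = ?D @ ?k # rev ?U"
    by (simp only: circle_list_last append.simps)
  have "filter low [1..<?k] = ?D" "filter (\<lambda>i. \<not> low i) [1..<?k] = ?U"
    unfolding low_def by (auto intro!: filter_cong)
  then have new: "circle_list (Suc ?k) low {1..Suc ?k} =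
      (if ?b then ?D @ [?k, Suc ?k] @ rev ?U else ?D @ [Suc ?k, ?k] @ rev ?U)"
    unfolding circle_list_last upt_Suc[of 1 ?k] by (simp add: low_def del: upt_Suc)
  have dist: "distinct (circle_list (Suc ?k) low {1..Suc ?k})" by (rule distinct_circle_list)
  have split: "word_perm (pos_word is)
      = word_perm (pos_word as) \<circ> (transpose ?k (Suc ?k) \<circ> word_perm (pos_word bs))"
    by (simp add: s pos_word_def word_perm_append)
  have join: "word_perm (pos_word (as @ bs)) = word_perm (pos_word as) \<circ> word_perm (pos_word bs)"
    by (simp add: pos_word_def word_perm_append)
  have range: "1 \<le> i \<and> i \<le> n" if "i \<in> set as \<or> i \<in> set bs" for i
    using ab(2) that by (auto simp: set_eq_iff)
  have "word_perm (pos_word is) = circle_cycle (Suc ?k) low {1..Suc ?k}"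
  proof (cases ?b)
    case True
    \<comment> \<open>All letters of \<open>bs\<close> commute with \<open>s_k\<close>, which
      therefore moves to the right end and inserts the new point directly after \<open>?k\<close>.
      In the other case it moves to the left end and inserts the point directly before
      \<open>?k\<close>.\<close>
    then have "n \<notin> set bs" using ab(1) by auto
    then have "Suc i < ?k" if "i \<in> set bs" for i using range[of i] that by (metis Suc_leI le_neq_implies_less not_less_eq)
    then have "word_perm (pos_word is) = word_perm (pos_word (as @ bs)) \<circ> transpose ?k (Suc ?k)"
      unfolding split join comp_assoc by (subst word_perm_commute) simp_all
    also have "\<dots> = cycle_of_list (rev ?U @ ?D @ [?k]) \<circ> transpose ?k (Suc ?k)"
      using cycle_of_list_rotate[of "?D @ [?k]" "rev ?U"] old distinct_circle_list[of ?k low' "{1..?k}"]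
      unfolding low'(2) circle_cycle_def by (simp del: upt_Suc)
    also have "\<dots> = cycle_of_list ((rev ?U @ ?D) @ [?k, Suc ?k])"
      unfolding cycle_of_list_snoc by simp
    also have "\<dots> = circle_cycle (Suc ?k) low {1..Suc ?k}"
      using cycle_of_list_rotate[of "?D @ [?k, Suc ?k]" "rev ?U"] new dist True
      unfolding circle_cycle_def by (simp del: upt_Suc)
    finally show ?thesis .
  next
    case False
    then have "Suc i < ?k" if "i \<in> set as" for i using range[of i] that by (metis Suc_leI le_neq_implies_less not_less_eq)
    then have "word_perm (pos_word is) = transpose ?k (Suc ?k) \<circ> word_perm (pos_word (as @ bs))"
      unfolding split join comp_assoc[symmetric] by (subst word_perm_commute) simp_all
    also have "\<dots> = transpose ?k (Suc ?k) \<circ> cycle_of_list (?k # rev ?U @ ?D)"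
      using cycle_of_list_rotate[of "?D" "?k # rev ?U"] old distinct_circle_list[of ?k low' "{1..?k}"]
      unfolding low'(2) circle_cycle_def by (simp del: upt_Suc)
    also have "\<dots> = cycle_of_list (Suc ?k # ?k # rev ?U @ ?D)"
      by (simp add: transpose_commute)
    also have "\<dots> = circle_cycle (Suc ?k) low {1..Suc ?k}"
      using cycle_of_list_rotate[of "?D" "[Suc ?k, ?k] @ rev ?U"] new dist False
      unfolding circle_cycle_def by (simp del: upt_Suc)
    finally show ?thesis .
  qed
  moreover have "\<not> low 1" using low'(1) range[of n] by (auto simp: low_def)
  ultimately show ?case by blast
qed

lemma standard_coxeter_circle:
  assumes "standard_coxeter_element n c"
  obtains low where "\<not> low 1" "c = circle_cycle (n + 1) low {1..n + 1}"
proof -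
  obtain xs where xs: "distinct xs" "set xs = simple_refl ` {1..n}" "c = list_mult (sym_group (n + 1)) xs"
    using assms by (auto simp: standard_coxeter_element_def simple_refls_def)
  have "xs \<in> lists (simple_refl ` {1..n})" using xs(2) by auto
  then obtain js where js: "js \<in> lists {1..n}" "xs = map simple_refl js"
    unfolding lists_image by blast
  have inj: "inj simple_refl"
  proof (rule injI)
    fix i j assume "simple_refl i = simple_refl j"
    then have "transpose i (Suc i) i = transpose j (Suc j) i" "transpose i (Suc i) j = transpose j (Suc j) j"
      by (simp_all add: simple_refl_def)
    then show "i = j" by (auto simp: Transposition.transpose_def split: if_splits)
  qed
  have "distinct js" using xs(1) js(2) by (simp add: distinct_map)
  moreover have "set js = {1..n}"
    using xs(2) inj_image_eq_iff[OF inj] unfolding js(2) set_map by blast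
  ultimately show thesis
    using coxeter_word_circle[of js n] that xs(3) js(2) by (auto simp: list_mult_simple_refl)
qed

section \<open>Reflection length and the divisors of the Coxeter element\<close>

lemma sym_group_inv:
  assumes "x permutes {1..m}" shows "inv\<^bsub>sym_group m\<^esub> x = inv' x"
proof -
  interpret group "sym_group m" by (rule sym_group_is_group)
  show ?thesis
    using assms permutes_inv[OF assms] permutes_inv_o(2)[OF assms]
    by (intro inv_equality) (simp_all only: sym_group_carrier sym_group_mult sym_group_one)
qed

lemma reflections_eq:
  assumes "1 \<le> n"
  shows "reflections n = {transpose a b | a b. a \<in> {1..n + 1} \<and> b \<in> {1..n + 1} \<and> a \<noteq> b}"
proof (intro subset_antisym subsetI)
  fix t assume "t \<in> reflections n"
  then obtain w i where w: "w permutes {1..n + 1}" "i \<in> {1..n}"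
    "t = w \<circ> simple_refl i \<circ> inv\<^bsub>sym_group (n + 1)\<^esub> w"
    by (auto simp: reflections_def simple_refls_def sym_group_carrier sym_group_mult)
  have "t = transpose (w i) (w (Suc i)) \<circ> (w \<circ> inv' w)"
    using w comp_transpose[OF permutes_bij[OF w(1)], of i "Suc i"]
    by (simp add: sym_group_inv simple_refl_def comp_assoc[symmetric])
  moreover have "w i \<in> {1..n + 1}" "w (Suc i) \<in> {1..n + 1}"
    using w(2) permutes_in_image[OF w(1)] by auto
  moreover have "w i \<noteq> w (Suc i)" using permutes_inj[OF w(1)] by (simp add: inj_eq)
  ultimately show "t \<in> {transpose a b | a b. a \<in> {1..n + 1} \<and> b \<in> {1..n + 1} \<and> a \<noteq> b}"
    using permutes_inv_o(1)[OF w(1)] by auto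
next
  fix t assume "t \<in> {transpose a b | a b. a \<in> {1..n + 1} \<and> b \<in> {1..n + 1} \<and> a \<noteq> b}"
  then obtain a b where ab: "t = transpose a b" "a \<in> {1..n + 1}" "b \<in> {1..n + 1}" "a \<noteq> b" by blast
  \<comment> \<open>The permutation \<open>w\<close> is to send \<open>1\<close> to \<open>a\<close>
    and \<open>2\<close> to \<open>b\<close>, so that it conjugates \<open>s_1\<close> to
    \<open>(a b)\<close>; \<open>z\<close> is the point that \<open>transpose 1 a\<close> sends to
    \<open>b\<close>.\<close>
  define z where "z = transpose 1 a b"
  define w where "w = transpose 1 a \<circ> transpose 2 z"
  have "z \<noteq> 1" "z \<in> {1..n + 1}" using ab assms by (auto simp: z_def transpose_eq_iff Transposition.transpose_def)
  then have w: "w permutes {1..n + 1}" unfolding w_def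
    using assms ab(2) by (intro permutes_compose permutes_swap_id) auto
  have "w 1 = a" "w 2 = b" using \<open>z \<noteq> 1\<close> by (simp_all add: w_def z_def)
  then have "w \<circ> simple_refl 1 = t \<circ> w"
    using comp_transpose[OF permutes_bij[OF w], of 1 2] ab(1)
    by (simp only: simple_refl_def one_add_one)
  then have "t = w \<circ> simple_refl 1 \<circ> inv' w"
    using permutes_inv_o(1)[OF w] by (simp add: comp_assoc)
  then show "t \<in> reflections n"
    unfolding reflections_def simple_refls_def using w assms
    by (auto simp: sym_group_carrier sym_group_mult sym_group_inv intro!: bexI[of _ w] image_eqI[of _ _ "simple_refl 1"])
qed

lemma list_mult_transposes:
  "list_mult (sym_group m) (map (\<lambda>(a, b). transpose a b) ts) = trans_prod ts"
  by (induction ts rule: trans_prod.induct)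
    (simp_all add: list_mult_def sym_group_mult sym_group_one)

lemma ex_transps_on:
  assumes "1 \<le> n" "set xs \<subseteq> reflections n"
  shows "\<exists>ts. transps_on {1..n + 1} ts \<and> xs = map (\<lambda>(a, b). transpose a b) ts"
  using assms(2)
proof (induction xs)
  case Nil
  show ?case by (intro exI[of _ "[]"]) simp
next
  case (Cons t xs)
  then obtain ts where ts: "transps_on {1..n + 1} ts" "xs = map (\<lambda>(a, b). transpose a b) ts" by auto
  obtain a b where "t = transpose a b" "a \<in> {1..n + 1}" "b \<in> {1..n + 1}" "a \<noteq> b"
    using Cons.prems unfolding reflections_eq[OF assms(1)] by auto
  then show ?case using ts by (intro exI[of _ "(a, b) # ts"]) simp
qed

lemma len_T_le:
  assumes "1 \<le> n" "transps_on {1..n + 1} ts"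
  shows "len_T n (trans_prod ts) \<le> length ts"
  unfolding len_T_def word_length_def
proof (rule Least_le)
  have "set (map (\<lambda>(a, b). transpose a b) ts) \<subseteq> reflections n"
    using assms(2) unfolding reflections_eq[OF assms(1)] transps_on_def by fastforce
  then show "\<exists>xs. set xs \<subseteq> reflections n \<and> length xs = length ts
      \<and> list_mult (sym_group (n + 1)) xs = trans_prod ts"
    by (intro exI[of _ "map (\<lambda>(a, b). transpose a b) ts"]) (simp add: list_mult_transposes)
qed

lemma ex_len_T:
  assumes "1 \<le> n" "x permutes {1..n + 1}"
  shows "\<exists>ts. transps_on {1..n + 1} ts \<and> length ts = len_T n x \<and> trans_prod ts = x"
proof -
  let ?P = "\<lambda>k. \<exists>xs. set xs \<subseteq> reflections n \<and> length xs = k \<and> list_mult (sym_group (n + 1)) xs = x"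
  obtain "is" where "is": "set is \<subseteq> {1..<n + 1}" "word_perm (pos_word is) = x"
    using ex_word_perm[OF assms(2)] by blast
  have "set (map simple_refl is) \<subseteq> reflections n"
    using "is"(1) unfolding reflections_eq[OF assms(1)] by (force simp: simple_refl_def)
  then have "?P (length is)"
    using "is"(2) by (intro exI[of _ "map simple_refl is"]) (simp add: list_mult_simple_refl)
  then have "?P (len_T n x)" unfolding len_T_def word_length_def by (rule LeastI)
  then obtain xs where xs: "set xs \<subseteq> reflections n" "length xs = len_T n x"
    "list_mult (sym_group (n + 1)) xs = x" by blast
  then show ?thesis using ex_transps_on[OF assms(1) xs(1)] by (auto simp: list_mult_transposes)
qed

lemma circle_cycle_singleton: "circle_cycle m low {p} = id"
proof -
  have "set (circle_list m low {p}) \<subseteq> {p}" by (auto simp: set_circle_list)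
  then show ?thesis using distinct_circle_list[of m low "{p}"]
    by (cases "circle_list m low {p}" rule: remdups_adj.cases) (auto simp: circle_cycle_def)
qed

lemma len_T_circle_cycle:
  assumes "1 \<le> n" "\<not> low 1"
  shows "len_T n (circle_cycle (n + 1) low {1..n + 1}) = n"
proof (rule antisym)
  let ?c = "circle_cycle (n + 1) low {1..n + 1}"
  obtain rs where rs: "transps_on {1..n + 1} rs" "length rs = n" "?c = trans_prod rs \<circ> circle_cycle (n + 1) low {1}"
    using circle_cycle_extend[of "{1}" "{1..n + 1}" "n + 1" low] by auto
  then have "?c = trans_prod rs" by (simp add: circle_cycle_singleton)
  then show "len_T n ?c \<le> n" using len_T_le[OF assms(1) rs(1)] rs(2) by simp
  have "?c permutes {1..n + 1}" using circle_cycle_permutes[of "n + 1" low "{1..n + 1}"] by simp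
  then obtain ts where "transps_on {1..n + 1} ts" "length ts = len_T n ?c" "trans_prod ts = ?c"
    using ex_len_T[OF assms(1)] by blast
  then show "n \<le> len_T n ?c" using circle_cycle_length[of "{1..n + 1}" "n + 1" low ts] assms(2) by simp
qed

lemma trans_prod_conj:
  assumes "bij g"
  shows "g \<circ> trans_prod ts = trans_prod (map (\<lambda>(a, b). (g a, g b)) ts) \<circ> g"
proof (induction ts rule: trans_prod.induct)
  case (2 a b ts)
  have "g \<circ> trans_prod ((a, b) # ts) = (g \<circ> transpose a b) \<circ> trans_prod ts" by (simp add: comp_assoc)
  also have "\<dots> = transpose (g a) (g b) \<circ> (g \<circ> trans_prod ts)"
    unfolding comp_transpose[OF assms] by (simp add: comp_assoc)
  finally show ?case unfolding 2 list.map prod.case trans_prod.simps comp_assoc .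
qed simp

text \<open>Conjugated by \<open>x^-1\<close>, the block \<open>ts\<close> moves across
  \<open>x\<close>, which leaves a factorization of \<open>x^-1 c\<close> into the complementary
  number of transpositions. Neither this one nor \<open>us\<close> can be shortened, since
  \<open>c\<close> is no product of fewer than \<open>n\<close> transpositions.\<close>

lemma factor_Div:
  assumes n: "1 \<le> n" and low: "\<not> low 1" and c: "c = circle_cycle (n + 1) low {1..n + 1}"
    and on: "transps_on {1..n + 1} (ts @ us @ vs)" and len: "length (ts @ us @ vs) = n"
    and prod: "trans_prod (ts @ us @ vs) = c"
  shows "trans_prod us \<in> Div n c" "len_T n (trans_prod us) = length us"
proof -
  let ?x = "trans_prod us" and ?m = "n + 1"
  have x: "?x permutes {1..?m}" using on by (intro trans_prod_permutes) simp
  let ?g = "inv' ?x"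
  have g: "?g permutes {1..?m}" by (rule permutes_inv[OF x])
  let ?ts = "map (\<lambda>(a, b). (?g a, ?g b)) ts"
  have "transps_on {1..?m} ts" using on by simp
  then have ts: "transps_on {1..?m} ?ts"
    using permutes_in_image[OF g] permutes_inj[OF g]
    unfolding transps_on_def by (auto simp: inj_eq simp del: atLeastAtMost_iff)
  have "?g \<circ> c = (?g \<circ> trans_prod ts) \<circ> ?x \<circ> trans_prod vs"
    unfolding prod[symmetric] trans_prod_append by (simp add: comp_assoc)
  also have "\<dots> = trans_prod ?ts \<circ> (?g \<circ> ?x) \<circ> trans_prod vs"
    unfolding trans_prod_conj[OF permutes_bij[OF g], of ts] by (simp only: comp_assoc)
  also have "\<dots> = trans_prod (?ts @ vs)"
    unfolding permutes_inv_o(2)[OF x] trans_prod_append by simp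
  finally have gc: "?g \<circ> c = trans_prod (?ts @ vs)" .
  have tv: "transps_on {1..?m} (?ts @ vs)" using ts on by simp
  have le: "len_T n ?x \<le> length us" "len_T n (?g \<circ> c) \<le> length ts + length vs"
    using len_T_le[OF n, of us] len_T_le[OF n tv] on unfolding gc by simp_all
  have gcp: "?g \<circ> c permutes {1..?m}" unfolding gc by (rule trans_prod_permutes[OF tv])
  obtain as bs where ab: "transps_on {1..?m} as" "length as = len_T n ?x" "trans_prod as = ?x"
    "transps_on {1..?m} bs" "length bs = len_T n (?g \<circ> c)" "trans_prod bs = ?g \<circ> c"
    using ex_len_T[OF n x] ex_len_T[OF n gcp] by blast
  have "trans_prod (as @ bs) = c"
    using permutes_inverses(1)[OF x] ab(3,6) by (simp add: trans_prod_append fun_eq_iff)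
  then have "n \<le> len_T n ?x + len_T n (?g \<circ> c)"
    using len_T_le[OF n, of "as @ bs"] ab len_T_circle_cycle[OF n, of low] low c by simp
  then have eq: "len_T n ?x = length us" "len_T n ?x + len_T n (?g \<circ> c) = n"
    using le len by simp_all
  then show "len_T n ?x = length us" by simp
  show "?x \<in> Div n c"
    using eq(2) x len_T_circle_cycle[OF n, of low] low
    unfolding Div_def abs_le_def by (simp add: sym_group_carrier sym_group_inv sym_group_mult c)
qed

lemma Div_factor:
  assumes n: "1 \<le> n" and low: "\<not> low 1" and c: "c = circle_cycle (n + 1) low {1..n + 1}"
    and x: "x \<in> Div n c"
  obtains ts us where "transps_on {1..n + 1} (ts @ us)" "length (ts @ us) = n"
    "trans_prod ts = x" "trans_prod (ts @ us) = c"
proof -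
  let ?m = "n + 1"
  have xp: "x permutes {1..?m}" and len: "len_T n x + len_T n (inv' x \<circ> c) = n"
    using x len_T_circle_cycle[OF n, of low] low
    unfolding Div_def abs_le_def by (auto simp: sym_group_carrier sym_group_inv sym_group_mult c)
  have "c permutes {1..?m}" using circle_cycle_permutes[of ?m low "{1..?m}"] unfolding c by simp
  then have "inv' x \<circ> c permutes {1..?m}" using permutes_inv[OF xp] by (rule permutes_compose)
  then obtain ts us where "transps_on {1..?m} ts" "length ts = len_T n x" "trans_prod ts = x"
    "transps_on {1..?m} us" "length us = len_T n (inv' x \<circ> c)" "trans_prod us = inv' x \<circ> c"
    using ex_len_T[OF n xp] ex_len_T[OF n] by blast
  moreover from this have "trans_prod (ts @ us) = c"
    using permutes_inverses(1)[OF xp] by (simp add: trans_prod_append fun_eq_iff)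
  ultimately show thesis using that[of ts us] len by simp
qed

section \<open>Simple elements of the dual braid monoid are layered\<close>

text \<open>Whatever the halves of the outer points, the cycle runs through \<open>i\<close>,
  \<open>k\<close>, \<open>j\<close> if the middle point is lower and through \<open>i\<close>,
  \<open>j\<close>, \<open>k\<close> if it is upper.\<close>

lemma circle_cycle_triple:
  assumes "1 \<le> i" "i < k" "k < j" "j \<le> m"
  shows "circle_cycle m low {i, k, j} =
    (if low k then transpose i k \<circ> transpose k j else transpose k j \<circ> transpose i k)"
proof -
  have f: "filter (\<lambda>x. x \<in> {i, k, j}) [1..<Suc m] = [i, k, j]"
  proof (rule sorted_distinct_set_unique)
    show "set (filter (\<lambda>x. x \<in> {i, k, j}) [1..<Suc m]) = set [i, k, j]" using assms by auto
  qed (use assms in \<open>auto simp del: upt_Suc intro!: sorted_wrt_filter\<close>)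
  have ne: "i \<noteq> k" "k \<noteq> j" "i \<noteq> j" using assms by auto
  show ?thesis
    unfolding circle_cycle_def circle_list_def f using ne
    by (cases "low i"; cases "low k"; cases "low j")
      (auto simp: fun_eq_iff Transposition.transpose_def)
qed

text \<open>Here \<open>f\<close> stands for the map that takes a divisor of \<open>c\<close> to its
  simple element inside the braid group. The assumptions speak of consecutive blocks of shortest
  factorizations of \<open>c\<close>, so that the induction on points can work with lists
  alone.\<close>

locale circle_lift =
  fixes n :: nat and low :: "nat \<Rightarrow> bool" and f :: "(nat \<Rightarrow> nat) \<Rightarrow> (nat \<times> bool) list set"
  assumes low_1: "\<not> low 1"
    and f_closed: "\<And>as ts vs. transps_on {1..n + 1} (as @ ts @ vs) \<Longrightarrow> length (as @ ts @ vs) = n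
      \<Longrightarrow> trans_prod (as @ ts @ vs) = circle_cycle (n + 1) low {1..n + 1}
      \<Longrightarrow> f (trans_prod ts) \<in> carrier (braid_group (n + 1))"
    and f_mult: "\<And>as ts us vs. transps_on {1..n + 1} (as @ ts @ us @ vs)
      \<Longrightarrow> length (as @ ts @ us @ vs) = n
      \<Longrightarrow> trans_prod (as @ ts @ us @ vs) = circle_cycle (n + 1) low {1..n + 1}
      \<Longrightarrow> f (trans_prod ts \<circ> trans_prod us)
        = f (trans_prod ts) \<otimes>\<^bsub>braid_group (n + 1)\<^esub> f (trans_prod us)"
    and f_one: "f id = braid_class (n + 1) []"
    and f_gen: "\<And>i. i \<in> {1..n} \<Longrightarrow> f (transpose i (Suc i)) = braid_class (n + 1) [(i, True)]"
begin

text \<open>The dual braid relations on three points: \<open>rs\<close> completes the factorization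
  of the three-cycle to one of \<open>c\<close>, in which the two transpositions are consecutive
  blocks.\<close>

lemma f_mult_transposes:
  assumes ij: "1 \<le> i" "i < k" "k < j" "j \<le> n + 1"
    and ab: "{a, b} \<subseteq> {i, k, j}" "a \<noteq> b" and cd: "{c, d} \<subseteq> {i, k, j}" "c \<noteq> d"
    and cyc: "transpose a b \<circ> transpose c d = circle_cycle (n + 1) low {i, k, j}"
  shows "f (circle_cycle (n + 1) low {i, k, j})
      = f (transpose a b) \<otimes>\<^bsub>braid_group (n + 1)\<^esub> f (transpose c d)"
    and "f (transpose a b) \<in> carrier (braid_group (n + 1))"
    and "f (transpose c d) \<in> carrier (braid_group (n + 1))"
proof -
  obtain rs where rs: "transps_on {1..n + 1} rs" "length rs = card {1..n + 1} - card {i, k, j}"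
    "circle_cycle (n + 1) low {1..n + 1} = trans_prod rs \<circ> circle_cycle (n + 1) low {i, k, j}"
    using circle_cycle_extend[of "{i, k, j}" "{1..n + 1}" "n + 1" low] ij by auto
  have sub: "{i, k, j} \<subseteq> {1..n + 1}" using ij by auto
  then have on: "transps_on {1..n + 1} [(a, b)]" "transps_on {1..n + 1} [(c, d)]"
    using ab cd by auto
  have "card {i, k, j} = 3" using ij by simp
  then have len: "length rs + 2 = n" using rs(2) ij by simp
  have prod: "trans_prod (rs @ [(a, b)] @ [(c, d)]) = circle_cycle (n + 1) low {1..n + 1}"
    unfolding trans_prod_append rs(3) cyc[symmetric] by simp
  show "f (circle_cycle (n + 1) low {i, k, j})
      = f (transpose a b) \<otimes>\<^bsub>braid_group (n + 1)\<^esub> f (transpose c d)"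
    using f_mult[of rs "[(a, b)]" "[(c, d)]" "[]"] rs(1) on len prod cyc by simp
  show "f (transpose a b) \<in> carrier (braid_group (n + 1))"
    using f_closed[of rs "[(a, b)]" "[(c, d)]"] rs(1) on len prod by simp
  show "f (transpose c d) \<in> carrier (braid_group (n + 1))"
    using f_closed[of "rs @ [(a, b)]" "[(c, d)]" "[]"] rs(1) on len prod by simp
qed

text \<open>For \<open>k = j - 1\<close>, equating two factorizations of the cycle on
  \<open>i\<close>, \<open>k\<close>, \<open>j\<close> exhibits \<open>f (transpose i j)\<close> as
  a conjugate of \<open>f (transpose i k)\<close> by the generator of index \<open>k\<close>, in a
  direction given by \<open>low k\<close>. So the strands of \<open>i\<close> and \<open>j\<close>
  pass over those of the lower points between them and under those of the upper ones, as the heights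
  prescribe.\<close>

lemma transposition_layered:
  assumes "1 \<le> i" "i < j" "j \<le> n + 1" "h j < h i"
    and "\<And>k. i < k \<Longrightarrow> k < j \<Longrightarrow> if low k then h k < h j else h i < h k"
  shows "\<exists>w\<in>braid_words (n + 1). f (transpose i j) = braid_class (n + 1) w \<and> layered h w
    \<and> word_perm w = transpose i j"
  using assms
proof (induction "j - i" arbitrary: j h)
  case (Suc d)
  interpret group "braid_group (n + 1)" by (rule group_braid_group)
  obtain k where k: "j = Suc k" using Suc.prems(2) by (cases j) auto
  show ?case
  proof (cases "i = k")
    case True
    then show ?thesis using f_gen[of i] Suc.prems k by (intro bexI[of _ "[(i, True)]"]) auto
  next
    case False
    then have ik: "i < k" "k < j" using k Suc.prems(2) by auto
    \<comment> \<open>The word to be built begins with a letter at \<open>k\<close>;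
      \<open>?h\<close> are the heights below that letter, where the strand of \<open>j\<close>
      occupies position \<open>k\<close>.\<close>
    let ?s = "transpose k j" and ?h = "h \<circ> transpose k (Suc k)"
    have hk: "if low k then h k < h j else h i < h k" using Suc.prems(5) ik by blast
    have h1: "?h k < ?h i" using Suc.prems(4) ik k by simp
    have h2: "if low l then ?h l < ?h k else ?h i < ?h l" if "i < l" "l < k" for l
      using Suc.prems(5)[of l] that ik unfolding k by (simp split: if_splits)
    have "d = k - i" "k \<le> n + 1" using Suc(2) Suc.prems(3) ik k by auto
    then obtain w where w: "w \<in> braid_words (n + 1)" "f (transpose i k) = braid_class (n + 1) w"
      "layered ?h w" "word_perm w = transpose i k"
      using Suc(1)[OF _ Suc.prems(1) ik(1) _ h1 h2] by blast
    have s: "f ?s = braid_class (n + 1) [(k, True)]" using f_gen[of k] Suc.prems k ik by simp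
    have ij: "f (transpose i j) \<in> carrier (braid_group (n + 1))" and
      rel: "if low k then f (transpose k j) \<otimes>\<^bsub>braid_group (n + 1)\<^esub> f (transpose i j)
              = f (transpose i k) \<otimes>\<^bsub>braid_group (n + 1)\<^esub> f (transpose k j)
            else f (transpose i j) \<otimes>\<^bsub>braid_group (n + 1)\<^esub> f (transpose k j)
              = f (transpose k j) \<otimes>\<^bsub>braid_group (n + 1)\<^esub> f (transpose i k)"
    proof -
      note cyc = circle_cycle_triple[OF Suc.prems(1) ik Suc.prems(3), of low]
      note mult = f_mult_transposes[OF Suc.prems(1) ik Suc.prems(3)]
      have "f (transpose i j) \<in> carrier (braid_group (n + 1)) \<and>
        (if low k then f (transpose k j) \<otimes>\<^bsub>braid_group (n + 1)\<^esub> f (transpose i j)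
              = f (transpose i k) \<otimes>\<^bsub>braid_group (n + 1)\<^esub> f (transpose k j)
            else f (transpose i j) \<otimes>\<^bsub>braid_group (n + 1)\<^esub> f (transpose k j)
              = f (transpose k j) \<otimes>\<^bsub>braid_group (n + 1)\<^esub> f (transpose i k))"
      proof (cases "low k")
        case True
        have eq1: "transpose i k \<circ> transpose k j = circle_cycle (n + 1) low {i, k, j}"
          using True unfolding cyc by simp
        have "transpose k j \<circ> transpose i j = transpose i k \<circ> transpose k j"
          using ik by (auto simp: fun_eq_iff Transposition.transpose_def)
        then have eq2: "transpose k j \<circ> transpose i j = circle_cycle (n + 1) low {i, k, j}"
          using eq1 by simp
        show ?thesis
          using mult(1)[OF _ _ _ _ eq1] mult(1,3)[OF _ _ _ _ eq2] True ik by simp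
      next
        case False
        have eq1: "transpose k j \<circ> transpose i k = circle_cycle (n + 1) low {i, k, j}"
          using False unfolding cyc by simp
        have "transpose i j \<circ> transpose k j = transpose k j \<circ> transpose i k"
          using ik by (auto simp: fun_eq_iff Transposition.transpose_def)
        then have eq2: "transpose i j \<circ> transpose k j = circle_cycle (n + 1) low {i, k, j}"
          using eq1 by simp
        show ?thesis
          using mult(1)[OF _ _ _ _ eq1] mult(1,2)[OF _ _ _ _ eq2] False ik by simp
      qed
      then show "f (transpose i j) \<in> carrier (braid_group (n + 1))"
        "if low k then f (transpose k j) \<otimes>\<^bsub>braid_group (n + 1)\<^esub> f (transpose i j)
              = f (transpose i k) \<otimes>\<^bsub>braid_group (n + 1)\<^esub> f (transpose k j)
            else f (transpose i j) \<otimes>\<^bsub>braid_group (n + 1)\<^esub> f (transpose k j)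
              = f (transpose k j) \<otimes>\<^bsub>braid_group (n + 1)\<^esub> f (transpose i k)"
        by blast+
    qed
    have kw: "[(k, b)] \<in> braid_words (n + 1)" for b using Suc.prems ik k by simp
    note carr = braid_class_in_carrier[OF kw] braid_class_in_carrier[OF w(1)]
    let ?w = "(k, \<not> low k) # w @ [(k, low k)]"
    have "f (transpose i j) = braid_class (n + 1) ?w"
    proof (cases "low k")
      case True
      then have "f (transpose i j) = inv\<^bsub>braid_group (n + 1)\<^esub> (braid_class (n + 1) [(k, True)])
          \<otimes>\<^bsub>braid_group (n + 1)\<^esub> braid_class (n + 1) (w @ [(k, True)])"
        using rel carr ij w(1) kw[of True] unfolding s w(2)
        by (subst inv_solve_left) (simp_all add: braid_group_mult braid_class_in_carrier del: braid_words_simps(2))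
      then show ?thesis
        using True w(1) kw[of True] kw[of False] by (simp add: braid_group_inv braid_group_mult)
    next
      case False
      then have "f (transpose i j) = braid_class (n + 1) ([(k, True)] @ w)
          \<otimes>\<^bsub>braid_group (n + 1)\<^esub> inv\<^bsub>braid_group (n + 1)\<^esub> (braid_class (n + 1) [(k, True)])"
        using rel carr ij w(1) kw[of True] unfolding s w(2)
        by (subst inv_solve_right) (simp_all add: braid_group_mult braid_class_in_carrier)
      then show ?thesis
        using False w(1) kw[of True] kw[of False] by (simp add: braid_group_inv braid_group_mult)
    qed
    moreover have "word_perm ?w = transpose i j"
      using w(4) ik by (auto simp: word_perm_append k fun_eq_iff Transposition.transpose_def)
    moreover have "layered h ?w"
      using hk Suc.prems(4) ik w(3,4) by (auto simp: layered_append k split: if_splits)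
    ultimately show ?thesis using w(1) kw[of True] by (intro bexI[of _ ?w]) auto
  qed
qed simp

text \<open>The strand starting in \<open>p\<close> moves along the chord from \<open>p\<close> to \<open>x\<inverse> p\<close>, and its height is to
  reflect the position of that chord relative to the others. The following is what has to be known
  about heights in order to insert a chord: if no upper point precedes a lower one between the upper
  point \<open>u\<close> and the lower point \<open>d\<close> to its right, then the chord of \<open>u\<close> lies above that of \<open>d\<close>. The
  rightmost point of \<open>P\<close> counts as a lower point.\<close>

definition upper_over_lower :: "nat set \<Rightarrow> (nat \<Rightarrow> int) \<Rightarrow> bool" where
  "upper_over_lower P g \<longleftrightarrow> (\<forall>u\<in>P. \<forall>d\<in>P. u < d \<and> \<not> low u \<and> (low d \<or> (\<forall>i\<in>P. i \<le> d))
    \<and> (\<forall>i\<in>P. \<forall>j\<in>P. u < i \<and> i < j \<and> j < d \<and> \<not> low i \<longrightarrow> \<not> low j) \<longrightarrow> g d < g u)"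

text \<open>Only the order of the values of \<open>g\<close> counts. The strands outside
  \<open>P\<close> are straight, and chords between points of \<open>P\<close> must pass over the
  lower and under the upper ones. No chord reaches beyond the rightmost point of \<open>P\<close>,
  so heights there are free.\<close>

definition extends_heights :: "nat set \<Rightarrow> (nat \<Rightarrow> int) \<Rightarrow> (nat \<Rightarrow> int) \<Rightarrow> bool" where
  "extends_heights P g h \<longleftrightarrow> (\<forall>a\<in>P. \<forall>b\<in>P. g a < g b \<longrightarrow> h a < h b)
    \<and> (\<forall>i\<in>{1..n + 1}. i \<notin> P \<and> (\<exists>r\<in>P. i < r) \<longrightarrow> (\<forall>a\<in>P. if low i then h i < h a else h a < h i))"

lemma upper_over_lowerD:
  "upper_over_lower P g \<Longrightarrow> u \<in> P \<Longrightarrow> d \<in> P \<Longrightarrow> u < d \<Longrightarrow> \<not> low u \<Longrightarrow> low d \<or> (\<forall>i\<in>P. i \<le> d)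
    \<Longrightarrow> (\<And>i j. i \<in> P \<Longrightarrow> j \<in> P \<Longrightarrow> u < i \<Longrightarrow> i < j \<Longrightarrow> j < d \<Longrightarrow> \<not> low i \<Longrightarrow> \<not> low j) \<Longrightarrow> g d < g u"
  unfolding upper_over_lower_def by blast

lemma extends_heightsD:
  assumes "extends_heights P g h"
  shows "a \<in> P \<Longrightarrow> b \<in> P \<Longrightarrow> g a < g b \<Longrightarrow> h a < h b"
    and "i \<in> {1..n + 1} \<Longrightarrow> i \<notin> P \<Longrightarrow> r \<in> P \<Longrightarrow> i < r \<Longrightarrow> a \<in> P
      \<Longrightarrow> if low i then h i < h a else h a < h i"
  using assms unfolding extends_heights_def by blast+

text \<open>Meant for a leaf \<open>p\<close> of the complementary factor, whose strand is straight:
  it goes below all others if \<open>p\<close> is lower and above them if it is upper. A rightmost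
  \<open>p\<close> goes to the bottom, because \<open>upper_over_lower\<close> counts it as a lower
  point.\<close>

lemma heights_fixed_point:
  assumes P: "finite P" "p \<in> P" "P \<noteq> {p}"
    and g': "inj_on g' (P - {p})" "upper_over_lower (P - {p}) g'"
  obtains g where "inj_on g P" "upper_over_lower P g"
    "\<forall>h. extends_heights P g h \<longrightarrow> extends_heights (P - {p}) g' h"
proof -
  let ?H = "g' ` (P - {p})"
  define bottom where "bottom \<longleftrightarrow> low p \<or> (\<forall>i\<in>P. i \<le> p)"
  define g where "g = g'(p := if bottom then Min ?H - 1 else Max ?H + 1)"
  have fin: "finite ?H" using P(1) by simp
  have gp: "if bottom then g p < g a else g a < g p" if "a \<in> P - {p}" for a
  proof -
    have "Min ?H \<le> g' a" "g' a \<le> Max ?H" using fin that by (auto intro: Min_le Max_ge)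
    then show ?thesis using that by (simp add: g_def)
  qed
  have g_eq: "g a = g' a" if "a \<in> P - {p}" for a using that by (simp add: g_def)
  have "inj_on g P"
  proof -
    have "inj_on g (P - {p})" using g'(1) inj_on_cong[of "P - {p}" g g', OF g_eq] by blast
    moreover have "g p \<notin> g ` (P - {p})" 
    proof
      assume "g p \<in> g ` (P - {p})"
      then obtain a where "a \<in> P - {p}" "g p = g a" by blast
      then show False using gp[of a] by (simp split: if_splits)
    qed
    ultimately show ?thesis using inj_on_insert[of g p "P - {p}"] P(2) by (simp add: insert_absorb)
  qed
  moreover have "upper_over_lower P g"
    unfolding upper_over_lower_def
  proof (intro ballI impI)
    fix u d
    assume ud: "u \<in> P" "d \<in> P" and *: "u < d \<and> \<not> low u \<and> (low d \<or> (\<forall>i\<in>P. i \<le> d)) \<and>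
      (\<forall>i\<in>P. \<forall>j\<in>P. u < i \<and> i < j \<and> j < d \<and> \<not> low i \<longrightarrow> \<not> low j)"
    then have lt: "u < d" and nu: "\<not> low u" and ld: "low d \<or> (\<forall>i\<in>P. i \<le> d)" by blast+
    have mono: "\<not> low j" if "i \<in> P" "j \<in> P" "u < i" "i < j" "j < d" "\<not> low i" for i j
      using * that by blast
    consider "u = p" | "d = p" | "u \<noteq> p" "d \<noteq> p" by blast
    then show "g d < g u"
    proof cases
      case 1
      then have "\<not> bottom" using lt nu ud(2) by (auto simp: bottom_def not_le)
      then show ?thesis using gp[of d] 1 ud lt by simp
    next
      case 2
      then have "bottom" using ld by (simp add: bottom_def)
      then show ?thesis using gp[of u] 2 ud lt by simp
    next
      case 3
      have "g' d < g' u"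
        by (rule upper_over_lowerD[OF g'(2)]) (use 3 ud lt nu ld mono in blast)+
      then show ?thesis using 3 ud by (simp add: g_eq)
    qed
  qed
  moreover have "extends_heights (P - {p}) g' h" if h: "extends_heights P g h" for h
    unfolding extends_heights_def
  proof (intro conjI ballI impI)
    fix a b assume "a \<in> P - {p}" "b \<in> P - {p}" "g' a < g' b"
    then show "h a < h b" using extends_heightsD(1)[OF h, of a b] by (simp add: g_eq)
  next
    fix i a assume i: "i \<in> {1..n + 1}" "i \<notin> P - {p} \<and> (\<exists>r\<in>P - {p}. i < r)" and a: "a \<in> P - {p}"
    then obtain r where r: "r \<in> P" "i < r" by blast
    show "if low i then h i < h a else h a < h i"
    proof (cases "i = p")
      case True
      then have "bottom \<longleftrightarrow> low i" using r by (auto simp: bottom_def not_le)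
      then show ?thesis
        using gp[OF a] extends_heightsD(1)[OF h, of i a] extends_heightsD(1)[OF h, of a i] a True P(2)
        by (simp split: if_splits)
    next
      case False
      then show ?thesis using extends_heightsD(2)[OF h i(1) _ r] i(2) a by blast
    qed
  qed
  ultimately show thesis using that[of g] by blast
qed

text \<open>Meant for a product of \<open>(p q)\<close> and a factor on \<open>P - {p}\<close>.
  Below a word for \<open>(p q)\<close> the heights are \<open>h \<circ> transpose p q\<close>;
  these must suit the second factor, while \<open>h\<close> itself must meet the hypotheses of
  \<open>transposition_layered\<close>.\<close>

lemma heights_chord:
  assumes P: "finite P" "P \<subseteq> {1..n + 1}" "p \<in> P" "q \<in> P" "p \<noteq> q" and pq: "circle_next low P p q"
    and g': "inj_on g' (P - {p})" "upper_over_lower (P - {p}) g'"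
  obtains g where "inj_on g P" "upper_over_lower P g"
    "\<And>h. extends_heights P g h \<Longrightarrow> extends_heights (P - {p}) g' (h \<circ> transpose p q)
      \<and> (let i = min p q; j = max p q in h j < h i \<and>
          (\<forall>k. i < k \<longrightarrow> k < j \<longrightarrow> (if low k then h k < h j else h i < h k)))"
proof -
  let ?H = "g' ` (P - {p})"
  have fin: "finite ?H" using P(1) by simp
  \<comment> \<open>The strand from \<open>p\<close> goes on from \<open>q\<close> and inherits its
    height. The strand from \<open>q\<close> goes to \<open>p\<close> and stays there; it is put on
    top if it is the left end of the chord and at the bottom otherwise, since the left end has to be
    the higher one.\<close>
  define g where "g = g'(q := if q < p then Max ?H + 1 else Min ?H - 1, p := g' q)"
  have gq': "if q < p then g' a < g q else g q < g' a" if "a \<in> P - {p}" for a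
  proof -
    have "g q = (if q < p then Max ?H + 1 else Min ?H - 1)" using P(5) by (simp add: g_def)
    moreover have "Min ?H \<le> g' a" "g' a \<le> Max ?H" using fin that by (auto intro: Min_le Max_ge)
    ultimately show ?thesis by simp
  qed
  have g_eq: "g a = g' a" if "a \<noteq> p" "a \<noteq> q" for a using that by (simp add: g_def)
  have g_p: "g p = g' q" by (simp add: g_def)
  have gq: "if q < p then g a < g q else g q < g a" if "a \<in> P" "a \<noteq> q" for a
    using gq'[of a] gq'[of q] that P(4,5) by (cases "a = p") (auto simp: g_p g_eq)
  have tr: "g (transpose p q a) = g' a" if "a \<in> P - {p}" for a
    using that g_p g_eq[of a] by (cases "a = q") auto
  have tr_in: "transpose p q a \<in> P" "transpose p q a \<noteq> q" if "a \<in> P - {p}" for a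
    using that P(3-5) by (auto simp: Transposition.transpose_def)
  have "inj_on g P"
  proof -
    have "inj_on g (P - {q})"
    proof (rule inj_onI)
      fix a b assume ab: "a \<in> P - {q}" "b \<in> P - {q}" "g a = g b"
      have "transpose p q a \<in> P - {p}" "transpose p q b \<in> P - {p}"
        using ab P(3-5) by (auto simp: Transposition.transpose_def)
      then have "transpose p q a = transpose p q b"
        using tr[of "transpose p q a"] tr[of "transpose p q b"] ab(3) inj_onD[OF g'(1)] by simp
      then show "a = b" by (rule transpose_eq_imp_eq)
    qed
    moreover have "g q \<notin> g ` (P - {q})"
    proof
      assume "g q \<in> g ` (P - {q})"
      then obtain a where "a \<in> P" "a \<noteq> q" "g q = g a" by blast
      then show False using gq[of a] by (simp split: if_splits)
    qed
    ultimately show ?thesis using inj_on_insert[of g q "P - {q}"] P(4) by (simp add: insert_absorb)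
  qed
  moreover have uol: "upper_over_lower P g"
    unfolding upper_over_lower_def
  proof (intro ballI impI)
    fix u d
    assume ud: "u \<in> P" "d \<in> P" and *: "u < d \<and> \<not> low u \<and> (low d \<or> (\<forall>i\<in>P. i \<le> d)) \<and>
      (\<forall>i\<in>P. \<forall>j\<in>P. u < i \<and> i < j \<and> j < d \<and> \<not> low i \<longrightarrow> \<not> low j)"
    then have ltd: "u < d" and nu: "\<not> low u" and ld: "low d \<or> (\<forall>i\<in>P. i \<le> d)" by blast+
    have mono: "\<not> low j" if "i \<in> P" "j \<in> P" "u < i" "i < j" "j < d" "\<not> low i" for i j
      using * that by blast
    show "g d < g u"
    proof (cases "q < p")
      case True
      then have nq: "\<not> low q" and btw: "\<And>i. i \<in> P \<Longrightarrow> q < i \<Longrightarrow> i < p \<Longrightarrow> low i"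
        and pmax: "low p \<Longrightarrow> \<forall>i\<in>P. i \<le> p"
        using pq by (auto simp: circle_next_def)
      have "d \<noteq> q"
      proof
        assume "d = q"
        then have "p \<le> q" using ld nq P(3) by blast
        then show False using True by simp
      qed
      consider "u = q" | "u = p" | "d = p" "u \<noteq> q" | "u \<noteq> q" "u \<noteq> p" "d \<noteq> p" by blast
      then show ?thesis
      proof cases
        case 1
        then show ?thesis using gq[of d] ud(2) \<open>d \<noteq> q\<close> True by simp
      next
        case 2
        \<comment> \<open>Only lower points lie between \<open>q\<close> and \<open>p\<close>, so no
          upper point precedes a lower one between \<open>q\<close> and \<open>d\<close>
          either.\<close>
        have "g' d < g' q"
        proof (rule upper_over_lowerD[OF g'(2)])
          fix i j assume ij: "i \<in> P - {p}" "j \<in> P - {p}" "q < i" "i < j" "j < d" "\<not> low i"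
          then have "p < i" using btw[of i] by force
          then show "\<not> low j" using mono[of i j] ij 2 by simp
        next
          show "low d \<or> (\<forall>i\<in>P - {p}. i \<le> d)" using ld by blast
        qed (use ud P(4,5) ltd 2 True nq in simp_all)
        then show ?thesis using 2 ltd \<open>d \<noteq> q\<close> by (simp add: g_p g_eq)
      next
        case 3
        then have max: "\<forall>i\<in>P. i \<le> p" using ld pmax by blast
        have "u < q" using btw[of u] ud(1) nu ltd 3 by force
        \<comment> \<open>A point between \<open>q\<close> and \<open>p\<close> would be lower
          because \<open>q\<close> follows \<open>p\<close> on the circle, and upper because it
          comes after the upper point \<open>q\<close> in the range from \<open>u\<close> to
          \<open>d\<close>. Hence \<open>q\<close> is rightmost once \<open>p\<close> is gone and
          takes over its role as a lower point.\<close>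
        have qmax: "i \<le> q" if "i \<in> P - {p}" for i
        proof (rule ccontr)
          assume "\<not> i \<le> q"
          then have "q < i" "i < p" using that max by force+
          then have "low i" "\<not> low i"
            using btw[of i] mono[of q i] that P(4) nq \<open>u < q\<close> 3(1) by simp_all
          then show False by simp
        qed
        have "g' q < g' u"
        proof (rule upper_over_lowerD[OF g'(2)])
          fix i j assume "i \<in> P - {p}" "j \<in> P - {p}" "u < i" "i < j" "j < q" "\<not> low i"
          then show "\<not> low j" using mono[of i j] True 3(1) by simp
        next
          show "low q \<or> (\<forall>i\<in>P - {p}. i \<le> q)" using qmax by blast
        qed (use ud P(4,5) nu \<open>u < q\<close> True in simp_all)
        then show ?thesis using 3 ltd by (simp add: g_p g_eq)
      next
        case 4
        have "g' d < g' u"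
          by (rule upper_over_lowerD[OF g'(2)]) (use 4 ud ltd nu ld mono in blast)+
        then show ?thesis using 4 \<open>d \<noteq> q\<close> by (simp add: g_eq)
      qed
    next
      case False
      then have lt: "p < q" using P(5) by simp
      then have lp: "low p" and btw: "\<And>i. i \<in> P \<Longrightarrow> p < i \<Longrightarrow> i < q \<Longrightarrow> \<not> low i"
        and qmax: "\<not> low q \<Longrightarrow> \<forall>i\<in>P. i \<le> q"
        using pq by (auto simp: circle_next_def)
      have "u \<noteq> p" using nu lp by blast
      have "u \<noteq> q"
      proof
        assume "u = q"
        then have "d \<le> u" using qmax nu ud(2) by blast
        then show False using ltd by simp
      qed
      consider "d = q" | "d = p" | "d \<noteq> p" "d \<noteq> q" by blast
      then show ?thesis
      proof cases
        case 1
        then show ?thesis using gq[of u] ud(1) \<open>u \<noteq> q\<close> False by simp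
      next
        case 2
        have "g' q < g' u"
        proof (rule upper_over_lowerD[OF g'(2)])
          fix i j assume ij: "i \<in> P - {p}" "j \<in> P - {p}" "u < i" "i < j" "j < q" "\<not> low i"
          show "\<not> low j"
          proof (cases "j < p")
            case True
            then show ?thesis using mono[of i j] ij 2 by simp
          next
            case False
            then show ?thesis using btw[of j] ij by simp
          qed
        next
          show "low q \<or> (\<forall>i\<in>P - {p}. i \<le> q)" using qmax by blast
        qed (use ud P(4,5) nu ltd 2 lt \<open>u \<noteq> p\<close> in simp_all)
        then show ?thesis using 2 \<open>u \<noteq> q\<close> \<open>u \<noteq> p\<close> by (simp add: g_p g_eq)
      next
        case 3
        have "g' d < g' u"
          by (rule upper_over_lowerD[OF g'(2)]) (use 3 ud ltd nu ld mono \<open>u \<noteq> p\<close> in blast)+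
        then show ?thesis using 3 \<open>u \<noteq> q\<close> \<open>u \<noteq> p\<close> by (simp add: g_eq)
      qed
    qed
  qed
  moreover have "extends_heights (P - {p}) g' (h \<circ> transpose p q)"
    if h: "extends_heights P g h" for h
    unfolding extends_heights_def
  proof (intro conjI ballI impI)
    fix a b assume "a \<in> P - {p}" "b \<in> P - {p}" "g' a < g' b"
    then show "(h \<circ> transpose p q) a < (h \<circ> transpose p q) b"
      using extends_heightsD(1)[OF h, of "transpose p q a" "transpose p q b"] tr tr_in by simp
  next
    fix i a assume i: "i \<in> {1..n + 1}" "i \<notin> P - {p} \<and> (\<exists>r\<in>P - {p}. i < r)" and a: "a \<in> P - {p}"
    then obtain r where r: "r \<in> P" "i < r" by blast
    let ?a = "transpose p q a"
    have "if low i then h (transpose p q i) < h ?a else h ?a < h (transpose p q i)"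
    proof (cases "i = p")
      case True
      \<comment> \<open>Below the chord, position \<open>p\<close> holds the strand from
        \<open>q\<close>, whose height is extreme. As \<open>p\<close> is not rightmost here, its
        half agrees with the side chosen in \<open>g\<close>.\<close>
      have "low p \<longleftrightarrow> \<not> q < p" using pq r True by (auto simp: circle_next_def not_le)
      then show ?thesis
        using gq[OF tr_in[OF a]] extends_heightsD(1)[OF h, of ?a q] extends_heightsD(1)[OF h, of q ?a]
          tr_in[OF a] P(4) True by (simp split: if_splits)
    next
      case False
      then have "i \<notin> P" using i(2) by blast
      then have "transpose p q i = i" using P(3,4) by (intro transpose_apply_other) auto
      then show ?thesis using extends_heightsD(2)[OF h i(1) \<open>i \<notin> P\<close> r tr_in(1)[OF a]] by simp
    qed
    then show "if low i then (h \<circ> transpose p q) i < (h \<circ> transpose p q) a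
        else (h \<circ> transpose p q) a < (h \<circ> transpose p q) i" by simp
  qed
  moreover have "let i = min p q; j = max p q in h j < h i \<and>
      (\<forall>k. i < k \<longrightarrow> k < j \<longrightarrow> (if low k then h k < h j else h i < h k))"
    if h: "extends_heights P g h" for h
  proof (cases "q < p")
    case True
    then have nq: "\<not> low q" and btw: "\<And>i. i \<in> P \<Longrightarrow> q < i \<Longrightarrow> i < p \<Longrightarrow> low i"
      using pq by (auto simp: circle_next_def)
    have "h p < h q" using extends_heightsD(1)[OF h P(3,4)] gq[OF P(3,5)] True by simp
    moreover have "if low k then h k < h p else h q < h k" if k: "q < k" "k < p" for k
    proof (cases "k \<in> P")
      case inP: True
      \<comment> \<open>All points between \<open>q\<close> and \<open>k\<close> are lower, so the
        invariant compares these two; the strand from \<open>p\<close> has the height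
        \<open>g' q\<close>.\<close>
      have "g' k < g' q"
      proof (rule upper_over_lowerD[OF g'(2)])
        fix i j assume "i \<in> P - {p}" "q < i" "i < j" "j < k" "\<not> low i"
        then show "\<not> low j" using btw[of i] k by simp
      next
        show "low k \<or> (\<forall>i\<in>P - {p}. i \<le> k)" using btw[OF inP k] by blast
      qed (use inP P(4,5) k nq in simp_all)
      then have "h k < h p"
        using extends_heightsD(1)[OF h inP P(3)] k by (simp add: g_p g_eq)
      then show ?thesis using btw[OF inP k] by simp
    next
      case False
      have "k \<in> {1..n + 1}" using k P(2-4) by force
      then show ?thesis
        using extends_heightsD(2)[OF h _ False P(3) k(2)] P(3,4) by (metis (full_types))
    qed
    ultimately show ?thesis using True by (simp add: Let_def min_def max_def)
  next
    case False
    then have lt: "p < q" using P(5) by simp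
    then have lp: "low p" and btw: "\<And>i. i \<in> P \<Longrightarrow> p < i \<Longrightarrow> i < q \<Longrightarrow> \<not> low i"
      and qmax: "\<not> low q \<Longrightarrow> \<forall>i\<in>P. i \<le> q"
      using pq by (auto simp: circle_next_def)
    have "h q < h p" using extends_heightsD(1)[OF h P(4,3)] gq[OF P(3,5)] False by simp
    moreover have "if low k then h k < h q else h p < h k" if k: "p < k" "k < q" for k
    proof (cases "k \<in> P")
      case inP: True
      have "g' q < g' k"
      proof (rule upper_over_lowerD[OF g'(2)])
        fix i j assume "j \<in> P - {p}" "k < i" "i < j" "j < q"
        then show "\<not> low j" using btw[of j] k by simp
      next
        show "low q \<or> (\<forall>i\<in>P - {p}. i \<le> q)" using qmax by blast
      qed (use inP P(4,5) k btw[of k] in simp_all)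
      then have "h p < h k"
        using extends_heightsD(1)[OF h P(3) inP] k by (simp add: g_p g_eq)
      then show ?thesis using btw[OF inP k] by simp
    next
      case notP: False
      have "k \<in> {1..n + 1}" using k P(2-4) by force
      then show ?thesis
        using extends_heightsD(2)[OF h _ notP P(4) k(2)] P(3,4) by (metis (full_types))
    qed
    ultimately show ?thesis using lt by (simp add: Let_def min_def max_def)
  qed
  ultimately show thesis using that[of g] by blast
qed

text \<open>A leaf in \<open>us\<close> leaves the braid of \<open>ts\<close> unchanged and only
  adds a straight strand. A leaf in \<open>ts\<close> splits \<open>(p q)\<close> off its left end:
  a word for this transposition is put in front of a word for the rest, which is layered for
  \<open>h \<circ> transpose p q\<close>.\<close>

lemma factor_layered:
  assumes "P \<subseteq> {1..n + 1}" "1 \<in> P" "transps_on P (ts @ us)" "length (ts @ us) = card P - 1"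
    "trans_prod (ts @ us) = circle_cycle (n + 1) low P"
  shows "\<exists>g. inj_on g P \<and> upper_over_lower P g \<and> (\<forall>h. extends_heights P g h \<longrightarrow>
    (\<exists>w\<in>braid_words (n + 1). f (trans_prod ts) = braid_class (n + 1) w \<and> layered h w))"
  using assms
proof (induction "card P" arbitrary: P ts us rule: less_induct)
  case less
  have fin: "finite P" using less.prems(1) finite_subset by blast
  show ?case
  proof (cases "P = {1}")
    case True
    then have "ts = []" using less.prems(4) by simp
    moreover have "upper_over_lower P (\<lambda>_. 0)" using True by (simp add: upper_over_lower_def)
    ultimately show ?thesis
      using True f_one by (intro exI[of _ "\<lambda>_. 0"]) (auto intro!: bexI[of _ "[]"] simp: id_def)
  next
    case False
    then have "card P \<noteq> 1" using less.prems(2) by (metis card_1_singletonE singletonD)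
    moreover have "card P \<noteq> 0" using less.prems(2) fin by auto
    ultimately have card: "2 \<le> card P" by linarith
    obtain p q where p: "p \<in> P" "p \<noteq> 1" "q \<in> P" "q \<noteq> p" "circle_next low P p q"
      and leaf: "(\<exists>ts'. length ts = Suc (length ts') \<and> transps_on (P - {p}) (ts' @ us)
          \<and> trans_prod ts = transpose p q \<circ> trans_prod ts'
          \<and> trans_prod (ts' @ us) = circle_cycle (n + 1) low (P - {p}))
        \<or> (\<exists>us'. length us = Suc (length us') \<and> transps_on (P - {p}) (ts @ us')
          \<and> trans_prod (ts @ us') = circle_cycle (n + 1) low (P - {p}))"
      by (rule leaf_removal[OF less.prems(1,2) card low_1 less.prems(3) _ less.prems(5)])
        (simp add: less.prems(4)[simplified])
    have card': "card P = Suc (card (P - {p}))" using p(1) fin by (auto dest: card.remove)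
    have P': "P - {p} \<subseteq> {1..n + 1}" "1 \<in> P - {p}" "card (P - {p}) < card P"
      using less.prems(1,2) p(2) card' by auto
    from leaf show ?thesis
    proof (elim disjE exE conjE)
      fix us' assume us': "length us = Suc (length us')" "transps_on (P - {p}) (ts @ us')"
        "trans_prod (ts @ us') = circle_cycle (n + 1) low (P - {p})"
      have len: "length (ts @ us') = card (P - {p}) - 1" using us'(1) less.prems(4) card' by simp
      obtain g' where g': "inj_on g' (P - {p})" "upper_over_lower (P - {p}) g'"
        "\<And>h. extends_heights (P - {p}) g' h \<Longrightarrow>
          \<exists>w\<in>braid_words (n + 1). f (trans_prod ts) = braid_class (n + 1) w \<and> layered h w"
        using less.hyps[OF P'(3) P'(1,2) us'(2) len us'(3)] by blast
      have "P \<noteq> {p}" using P'(2) by auto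
      obtain g where "inj_on g P" "upper_over_lower P g"
        "\<forall>h. extends_heights P g h \<longrightarrow> extends_heights (P - {p}) g' h"
        by (rule heights_fixed_point[OF fin p(1) \<open>P \<noteq> {p}\<close> g'(1,2)])
      then show ?thesis using g'(3) by blast
    next
      fix ts' assume ts': "length ts = Suc (length ts')" "transps_on (P - {p}) (ts' @ us)"
        "trans_prod ts = transpose p q \<circ> trans_prod ts'"
        "trans_prod (ts' @ us) = circle_cycle (n + 1) low (P - {p})"
      have len: "length (ts' @ us) = card (P - {p}) - 1" using ts'(1) less.prems(4) card' by simp
      obtain g' where g': "inj_on g' (P - {p})" "upper_over_lower (P - {p}) g'"
        "\<And>h. extends_heights (P - {p}) g' h \<Longrightarrow>
          \<exists>w\<in>braid_words (n + 1). f (trans_prod ts') = braid_class (n + 1) w \<and> layered h w"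
        using less.hyps[OF P'(3) P'(1,2) ts'(2) len ts'(4)] by blast
      have mult: "f (trans_prod ts)
          = f (transpose p q) \<otimes>\<^bsub>braid_group (n + 1)\<^esub> f (trans_prod ts')"
      proof -
        \<comment> \<open>The factorization concerns the cycle of \<open>P\<close>, while
          \<open>f_mult\<close> asks for one of the full cycle; \<open>rs\<close> supplies the
          missing transpositions on the left.\<close>
        obtain rs where rs: "transps_on {1..n + 1} rs" "length rs = card {1..n + 1} - card P"
          "circle_cycle (n + 1) low {1..n + 1} = trans_prod rs \<circ> circle_cycle (n + 1) low P"
          using circle_cycle_extend[OF less.prems(1) order_refl, of low] less.prems(2) by blast
        have "card P \<le> card {1..n + 1}" using less.prems(1) by (intro card_mono) auto
        then have "length (rs @ [(p, q)] @ ts' @ us) = n"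
          using rs(2) ts'(1) less.prems(4) card by simp
        moreover have "transps_on {1..n + 1} (ts' @ us)"
          using ts'(2) less.prems(1) by (intro transps_on_mono[OF ts'(2)]) auto
        then have "transps_on {1..n + 1} (rs @ [(p, q)] @ ts' @ us)"
          using rs(1) p less.prems(1) by auto
        moreover have "trans_prod (rs @ [(p, q)] @ ts' @ us) = circle_cycle (n + 1) low {1..n + 1}"
          using less.prems(5) ts'(3) unfolding rs(3) trans_prod_append
          by (simp add: fun_eq_iff)
        ultimately show ?thesis
          using f_mult[of rs "[(p, q)]" ts' us] ts'(3) by simp
      qed
      obtain g where g: "inj_on g P" "upper_over_lower P g"
        "\<And>h. extends_heights P g h \<Longrightarrow> extends_heights (P - {p}) g' (h \<circ> transpose p q)
          \<and> (let i = min p q; j = max p q in h j < h i \<and>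
              (\<forall>k. i < k \<longrightarrow> k < j \<longrightarrow> (if low k then h k < h j else h i < h k)))"
        using heights_chord[OF fin less.prems(1) p(1,3) p(4)[symmetric] p(5) g'(1,2)] by blast
      have "\<exists>w\<in>braid_words (n + 1). f (trans_prod ts) = braid_class (n + 1) w \<and> layered h w"
        if h: "extends_heights P g h" for h
      proof -
        let ?i = "min p q" and ?j = "max p q"
        have tr: "transpose ?i ?j = transpose p q" by (auto simp: min_def max_def transpose_commute)
        have "1 \<le> ?i" "?i < ?j" "?j \<le> n + 1" using p(1,3,4) less.prems(1) by auto
        then obtain v where v: "v \<in> braid_words (n + 1)" "f (transpose p q) = braid_class (n + 1) v"
          "layered h v" "word_perm v = transpose p q"
          using transposition_layered[of ?i ?j h] g(3)[OF h] unfolding tr Let_def by blast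
        obtain w where w: "w \<in> braid_words (n + 1)" "f (trans_prod ts') = braid_class (n + 1) w"
          "layered (h \<circ> transpose p q) w"
          using g'(3) g(3)[OF h] by blast
        show ?thesis
          using v w mult by (intro bexI[of _ "v @ w"]) (auto simp: braid_group_mult layered_append)
      qed
      then show ?thesis using g(1,2) by blast
    qed
  qed
qed

end

section \<open>The simple elements of the dual braid monoid as an instance of
  \<open>circle_lift\<close>\<close>

lemma dual_simple_in_carrier: "x \<in> Div n c \<Longrightarrow> dual_simple n c x \<in> carrier (dual_monoid n c)"
  by (simp add: dual_simple_def dual_monoid_def carrier_presented_monoid)

lemma dual_simple_mult:
  assumes "x \<in> Div n c" "y \<in> Div n c" "x \<circ> y \<in> Div n c" "len_T n (x \<circ> y) = len_T n x + len_T n y"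
  shows "dual_simple n c (x \<circ> y) = dual_simple n c x \<otimes>\<^bsub>dual_monoid n c\<^esub> dual_simple n c y"
proof -
  have "([x, y], [x \<circ> y]) \<in> dual_rels n c"
    using assms by (simp add: dual_rels_def sym_group_mult)
  then have "([x, y], [x \<circ> y]) \<in> word_cong (Div n c) (dual_rels n c)"
    using word_cong.rel[of "[x, y]" "[x \<circ> y]" "dual_rels n c" "Div n c" "[]" "[]"] assms by simp
  then have "word_class (Div n c) (dual_rels n c) [x, y] = word_class (Div n c) (dual_rels n c) [x \<circ> y]"
    using assms by (subst word_class_eq_iff) simp_all
  then show ?thesis
    using assms by (simp add: dual_simple_def dual_monoid_def mult_presented_monoid)
qed

lemma dual_simple_id:
  assumes "id \<in> Div n c" shows "dual_simple n c id = \<one>\<^bsub>dual_monoid n c\<^esub>"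
proof -
  have "([id], []) \<in> word_cong (Div n c) (dual_rels n c)"
    using word_cong.rel[of "[id]" "[]" "dual_rels n c" "Div n c" "[]" "[]"] assms
    by (simp add: dual_rels_def sym_group_one)
  then show ?thesis
    using assms by (simp add: dual_simple_def dual_monoid_def one_presented_monoid word_class_eq_iff)
qed

lemma circle_lift_bessis:
  assumes n: "1 \<le> n" and low: "\<not> low 1" and c: "c = circle_cycle (n + 1) low {1..n + 1}"
    and \<phi>: "bessis_embedding n c \<phi>"
  shows "circle_lift n low (\<lambda>x. \<phi> (dual_simple n c x))"
proof -
  let ?G = "braid_group (n + 1)" and ?M = "dual_monoid n c"
  have hom: "\<phi> \<in> hom ?M ?G" using \<phi> by (simp add: bessis_embedding_def mon_def)
  interpret G: group ?G by (rule group_braid_group)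
  interpret M: monoid ?M unfolding dual_monoid_def by (rule monoid_presented_monoid)
  note fact = factor_Div[OF n low c]
  show ?thesis
  proof
    show "\<not> low 1" by (rule low)
  next
    fix as ts vs
    assume "transps_on {1..n + 1} (as @ ts @ vs)" "length (as @ ts @ vs) = n"
      "trans_prod (as @ ts @ vs) = circle_cycle (n + 1) low {1..n + 1}"
    then show "\<phi> (dual_simple n c (trans_prod ts)) \<in> carrier ?G"
      using fact(1)[of as ts vs] c by (intro hom_in_carrier[OF hom] dual_simple_in_carrier) simp
  next
    fix as ts us vs
    assume *: "transps_on {1..n + 1} (as @ ts @ us @ vs)" "length (as @ ts @ us @ vs) = n"
      "trans_prod (as @ ts @ us @ vs) = circle_cycle (n + 1) low {1..n + 1}"
    have D: "trans_prod ts \<in> Div n c" "len_T n (trans_prod ts) = length ts"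
      "trans_prod us \<in> Div n c" "len_T n (trans_prod us) = length us"
      "trans_prod (ts @ us) \<in> Div n c" "len_T n (trans_prod (ts @ us)) = length (ts @ us)"
      using fact[of as ts "us @ vs"] fact[of "as @ ts" us vs] fact[of as "ts @ us" vs] * c by simp_all
    then have "dual_simple n c (trans_prod ts \<circ> trans_prod us)
        = dual_simple n c (trans_prod ts) \<otimes>\<^bsub>?M\<^esub> dual_simple n c (trans_prod us)"
      unfolding trans_prod_append by (intro dual_simple_mult) simp_all
    then show "\<phi> (dual_simple n c (trans_prod ts \<circ> trans_prod us))
        = \<phi> (dual_simple n c (trans_prod ts)) \<otimes>\<^bsub>?G\<^esub> \<phi> (dual_simple n c (trans_prod us))"
      using hom_mult[OF hom] D(1,3) dual_simple_in_carrier by metis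
  next
    obtain rs where rs: "transps_on {1..n + 1} rs" "length rs = n"
      "circle_cycle (n + 1) low {1..n + 1} = trans_prod rs \<circ> circle_cycle (n + 1) low {1}"
      using circle_cycle_extend[of "{1}" "{1..n + 1}" "n + 1" low] by auto
    then have "trans_prod ([] @ [] @ rs) = c" by (simp add: c circle_cycle_singleton)
    then have "id \<in> Div n c" using fact(1)[of "[]" "[]" rs] rs by simp
    \<comment> \<open>Membership in \<open>hom\<close> concerns products only; the image of the unit
      is an idempotent of a group, hence the unit.\<close>
    moreover have "\<phi> \<one>\<^bsub>?M\<^esub> = \<one>\<^bsub>?G\<^esub>"
    proof -
      have "\<phi> \<one>\<^bsub>?M\<^esub> \<in> carrier ?G" by (rule hom_in_carrier[OF hom M.one_closed])
      moreover have "\<phi> \<one>\<^bsub>?M\<^esub> \<otimes>\<^bsub>?G\<^esub> \<phi> \<one>\<^bsub>?M\<^esub> = \<phi> \<one>\<^bsub>?M\<^esub>"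
        using hom_mult[OF hom M.one_closed M.one_closed] by simp
      ultimately show ?thesis using G.l_cancel_one by blast
    qed
    ultimately show "\<phi> (dual_simple n c id) = braid_class (n + 1) []"
      by (simp add: dual_simple_id braid_group_one)
  next
    fix i assume "i \<in> {1..n}"
    then show "\<phi> (dual_simple n c (transpose i (Suc i))) = braid_class (n + 1) [(i, True)]"
      using \<phi> by (simp add: bessis_embedding_def simple_refl_def)
  qed
qed

theorem theorem5p12:
  fixes n :: nat
    and c :: "nat \<Rightarrow> nat"
    and \<phi> :: "(nat \<Rightarrow> nat) list set \<Rightarrow> (nat \<times> bool) list set"
  assumes "n \<ge> 1"
    and "standard_coxeter_element n c"
    and "bessis_embedding n c \<phi>"
  shows "\<forall>\<beta> \<in> \<phi> ` dual_simples n c. mikado (n + 1) \<beta> \<and> rational_permutation_braid n \<beta>"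
proof
  fix \<beta> assume "\<beta> \<in> \<phi> ` dual_simples n c"
  then obtain x where x: "x \<in> Div n c" "\<beta> = \<phi> (dual_simple n c x)"
    by (auto simp: dual_simples_def)
  let ?m = "n + 1"
  obtain low where low: "\<not> low 1" "c = circle_cycle ?m low {1..?m}"
    by (rule standard_coxeter_circle[OF assms(2)])
  interpret circle_lift n low "\<lambda>x. \<phi> (dual_simple n c x)"
    by (rule circle_lift_bessis[OF assms(1) low assms(3)])
  obtain ts us where ts: "transps_on {1..?m} (ts @ us)" "length (ts @ us) = n"
    "trans_prod ts = x" "trans_prod (ts @ us) = c"
    by (rule Div_factor[OF assms(1) low x(1)])
  obtain g where g: "inj_on g {1..?m}" and lay: "\<And>h. extends_heights {1..?m} g h \<Longrightarrow>
      \<exists>w\<in>braid_words ?m. \<beta> = braid_class ?m w \<and> layered h w"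
    using factor_layered[of "{1..?m}" ts us] ts low(2) x(2) by auto
  \<comment> \<open>There are no strands outside \<open>{1..?m}\<close>; the values there are chosen
    above the maximum and strictly increasing, to make \<open>h\<close> injective on all
    naturals.\<close>
  define h where "h p = (if p \<in> {1..?m} then g p else Max (g ` {1..?m}) + 1 + int p)" for p
  have "g p < h q" if "p \<in> {1..?m}" "q \<notin> {1..?m}" for p q
  proof -
    have "g p \<le> Max (g ` {1..?m})" using that(1) by (intro Max_ge) simp_all
    moreover have "h q = Max (g ` {1..?m}) + 1 + int q" unfolding h_def using that(2) by (rule if_not_P)
    ultimately show ?thesis by simp
  qed
  then have inj: "inj h"
    using g by (intro injI) (metis h_def add_left_cancel inj_onD less_irrefl of_nat_eq_iff)
  have "extends_heights {1..?m} g h" by (auto simp: extends_heights_def h_def)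
  then obtain w where w: "w \<in> braid_words ?m" "\<beta> = braid_class ?m w" "layered h w"
    using lay by blast
  \<comment> \<open>The word \<open>w\<close> is put together from words for single chords and may
    contain double crossings.\<close>
  obtain v where v: "braid_eq ?m w v" "tight v" "layered h v"
    using layered_tighten[OF w(1,3) inj] by blast
  have vw: "v \<in> braid_words ?m" using braid_eq_words[OF v(1)] by simp
  have "\<beta> = braid_class ?m v" using w(2) braid_class_eq_iff[OF w(1) vw] v(1) by simp
  then show "mikado ?m \<beta> \<and> rational_permutation_braid n \<beta>"
    using mikado_layered[OF _ vw crosses_once_tight[OF v(2)] v(3) inj]
      rational_permutation_braid_layered[OF vw v(3) inj] by simp
qed

end
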